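(* Let $\gamma:S^n\to\mathbb R_{>0}$ be of class $C^2$. There is no closed piecewise-smooth weakly immersed hypersurface in $\mathbb R^{n+1}$ that is a critical point of $\mathcal F_\gamma$. This means that there is no closed piecewise-smooth weakly immersed hypersurface in $\mathbb R^{n+1}$ whose anisotropic mean curvature is constant zero.
   Context: $S^n$ is the unit sphere in $\mathbb R^{n+1}$. **Piecewise-$C^r$ weak immersion.** $M=\cup_{i=1}^kM_i$ is an $n$-dimensional oriented compact connected $C^\infty$ manifold (closed, without boundary), where each $M_i$ is an $n$-dimensional connected compact submanifold of $M$ with piecewise-$C^\infty$ boundary and $M_i\cap M_j=\partial M_i\cap\partial M_j$ for $i\neq j$. A map $X:M\to\mathbb R^{n+1}$ is a piecewise-$C^r$ weak immersion (or piecewise-$C^r$ weakly immersed hypersurface) if for each $i$: (A1) $X$ is continuous and $X|_{M_i}$ is of class $C^r$; (A2) $X$ restricted to the interior $M_i^o$ is a $C^r$-immersion; (A3) the unit normal field $\nu_i:M_i^o\to S^n$ extends to a $C^{r-1}$ map $\nu_i:M_i\to S^n$; here $\nu_i$ is chosen so that, for local coordinates $(u^1,\dots,u^n)$ in $M_i$, $(\nu_i,\partial_{u^1}X,\dots,\partial_{u^n}X)$ gives the canonical orientation of $\mathbb R^{n+1}$. Piecewise-smooth means $r=\infty$. $S(X)$ is the set of points of $M$ at which $X$ is not an immersion (points outside $S(X)$ are called regular); $\nu$ is the unit normal along $X|_{M\setminus S(X)}$, and $dA$ is the $n$-dimensional volume form induced by $X$. **Energy and critical points.** $\mathcal F_\gamma(X)=\int_M\gamma(\nu)\,dA$.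 $X$ is a critical point of $\mathcal F_\gamma$ (no volume constraint being imposed) if $\frac{d}{d\epsilon}\mathcal F_\gamma(X_\epsilon)|_{\epsilon=0}=0$ for every variation $X_\epsilon$ of $X$ (a one-parameter family with $X_0=X$, $C^\infty$ in $\epsilon$). **Anisotropic mean curvature.** Let $\xi(\nu)=D\gamma|_\nu+\gamma(\nu)\nu$ for $\nu\in S^n$, where $D\gamma$ is the gradient of $\gamma$ on $S^n$ and $T_\nu S^n$ is regarded as a linear subspace of $\mathbb R^{n+1}$. The anisotropic mean curvature of $X$ is defined at regular points by $\Lambda=-\frac1n\operatorname{trace}d(\xi\circ\nu)$, where $d(\xi\circ\nu)$ is regarded as an endomorphism of the tangent space.
   Formalization: "Anisotropic mean curvature constant zero" is read as: zero at all regular points and, in addition, X is a critical point for volume-preserving variations; with vanishing at regular points alone the second sentence is false, as polygons and the boundary of a cube show. *)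

theory Defs
  imports "HOL-Analysis.Analysis" "HOL-Library.Extended_Nat"
begin

section \<open>Functions of class \<open>C\<^sup>r\<close>\<close>

fun Ck_on :: "nat \<Rightarrow> 'a::euclidean_space set \<Rightarrow> ('a \<Rightarrow> 'b::euclidean_space) \<Rightarrow> bool" where
  "Ck_on 0 W f \<longleftrightarrow> continuous_on W f"
| "Ck_on (Suc k) W f \<longleftrightarrow>
     (\<forall>x\<in>W. f differentiable (at x)) \<and> (\<forall>v. Ck_on k W (\<lambda>x. frechet_derivative f (at x) v))"

text \<open>\<open>Ck_on\<close> is meant for open sets. On an arbitrary set (a domain with boundary, a sphere),
  being of class \<open>C\<^sup>r\<close> means having a \<open>C\<^sup>r\<close> extension near every point of the set.\<close>

definition Cr_on :: "enat \<Rightarrow> 'a::euclidean_space set \<Rightarrow> ('a \<Rightarrow> 'b::euclidean_space) \<Rightarrow> bool" where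
  "Cr_on r S f \<longleftrightarrow>
     (\<forall>x\<in>S. \<exists>W g. open W \<and> x \<in> W \<and> (\<forall>k. enat k \<le> r \<longrightarrow> Ck_on k W g) \<and>
        (\<forall>y\<in>S \<inter> W. f y = g y))"


section \<open>Closed oriented manifolds\<close>

text \<open>A chart is a pair of its domain and its coordinate map. The dimension is
  \<open>n = CARD('n) \<ge> 1\<close>.\<close>

type_synonym ('a, 'n) chart = "'a set \<times> ('a \<Rightarrow> real ^ 'n)"

definition chart_inv :: "('a, 'n::finite) chart \<Rightarrow> real ^ 'n \<Rightarrow> 'a" where
  "chart_inv c = inv_into (fst c) (snd c)"

definition is_chart :: "'a topology \<Rightarrow> ('a, 'n::finite) chart \<Rightarrow> bool" where
  "is_chart T c \<longleftrightarrow>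
     openin T (fst c) \<and> open (snd c ` fst c) \<and>
     homeomorphic_map (subtopology T (fst c)) (top_of_set (snd c ` fst c)) (snd c)"

definition oriented_atlas :: "'a topology \<Rightarrow> ('a, 'n::finite) chart set \<Rightarrow> bool" where
  "oriented_atlas T A \<longleftrightarrow>
     (\<forall>c\<in>A. is_chart T c) \<and> (\<Union>c\<in>A. fst c) = topspace T \<and>
     (\<forall>c\<in>A. \<forall>d\<in>A.
        Cr_on \<infinity> (snd c ` (fst c \<inter> fst d)) (snd d \<circ> chart_inv c) \<and>
        (\<forall>u\<in>snd c ` (fst c \<inter> fst d). det (jacobian (snd d \<circ> chart_inv c) (at u)) > 0))"

definition closed_oriented_manifold :: "'a topology \<Rightarrow> ('a, 'n::finite) chart set \<Rightarrow> bool" where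
  "closed_oriented_manifold T A \<longleftrightarrow>
     topspace T \<noteq> {} \<and> Hausdorff_space T \<and> second_countable T \<and>
     compact_space T \<and> connected_space T \<and> oriented_atlas T A"

definition smooth_on :: "('a, 'n::finite) chart set \<Rightarrow> 'a set \<Rightarrow> ('a \<Rightarrow> 'b::euclidean_space) \<Rightarrow> bool" where
  "smooth_on A S f \<longleftrightarrow> (\<forall>c\<in>A. Cr_on \<infinity> (snd c ` (fst c \<inter> S)) (f \<circ> chart_inv c))"

text \<open>Matrix of the differential of \<open>f\<close> at \<open>p\<close> with respect to the coordinates of \<open>c\<close>; its columns
  are the partial derivatives of \<open>f\<close>.\<close>

definition diff_matrix ::
    "('a, 'n::finite) chart \<Rightarrow> ('a \<Rightarrow> real ^ 'm::finite) \<Rightarrow> 'a \<Rightarrow> real ^ 'n ^ 'm" where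
  "diff_matrix c f p = jacobian (f \<circ> chart_inv c) (at (snd c p))"

text \<open>Pieces with piecewise smooth boundary.\<close>

definition smooth_hypersurface ::
    "'a topology \<Rightarrow> ('a, 'n::finite) chart set \<Rightarrow> 'a set \<Rightarrow> bool" where
  "smooth_hypersurface T A S \<longleftrightarrow>
     S \<subseteq> topspace T \<and>
     (\<forall>p\<in>S. \<exists>W (g :: 'a \<Rightarrow> real). openin T W \<and> p \<in> W \<and> smooth_on A W g \<and>
        S \<inter> W = {q \<in> W. g q = 0} \<and>
        (\<forall>q\<in>S \<inter> W. \<forall>c\<in>A. q \<in> fst c \<longrightarrow>
           frechet_derivative (g \<circ> chart_inv c) (at (snd c q)) \<noteq> (\<lambda>v. 0)))"

definition piecewise_smooth_frontier ::
    "'a topology \<Rightarrow> ('a, 'n::finite) chart set \<Rightarrow> 'a set \<Rightarrow> bool" where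
  "piecewise_smooth_frontier T A P \<longleftrightarrow>
     (\<exists>\<H>. finite \<H> \<and> T frontier_of P = \<Union>\<H> \<and>
        (\<forall>H\<in>\<H>. \<exists>S. smooth_hypersurface T A S \<and> H \<subseteq> S \<and>
           H = T closure_of (subtopology T S interior_of H)))"

text \<open>Locally, a codimension-zero submanifold with boundary corresponds to a half space under
  a homeomorphism of neighbourhoods in the ambient manifold. This homeomorphism is only
  topological: the boundary may have edges and corners.\<close>

definition submanifold_piecewise_smooth_boundary ::
    "'a topology \<Rightarrow> ('a, 'n::finite) chart set \<Rightarrow> 'a set \<Rightarrow> bool" where
  "submanifold_piecewise_smooth_boundary T A P \<longleftrightarrow>
     P \<noteq> {} \<and> compactin T P \<and> connectedin T P \<and>
     (\<forall>p\<in>P. \<exists>(h :: ('a, 'n) chart) l. is_chart T h \<and> p \<in> fst h \<and>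
        snd h ` (fst h \<inter> P) = snd h ` fst h \<inter> {x. 0 \<le> x $ l}) \<and>
     piecewise_smooth_frontier T A P"

definition manifold_decomposition ::
    "'a topology \<Rightarrow> ('a, 'n::finite) chart set \<Rightarrow> nat \<Rightarrow> (nat \<Rightarrow> 'a set) \<Rightarrow> bool" where
  "manifold_decomposition T A k M \<longleftrightarrow>
     (\<Union>i\<in>{1..k}. M i) = topspace T \<and>
     (\<forall>i\<in>{1..k}. submanifold_piecewise_smooth_boundary T A (M i)) \<and>
     (\<forall>i\<in>{1..k}. \<forall>j\<in>{1..k}. i \<noteq> j \<longrightarrow>
        M i \<inter> M j = T frontier_of (M i) \<inter> T frontier_of (M j))"


section \<open>Piecewise smooth weak immersions\<close>

text \<open>The ambient space \<open>\<real>\<^sup>n\<^sup>+\<^sup>1\<close> is \<open>real ^ 'n option\<close>, with \<open>None\<close> as the first coordinate, followed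
  by the coordinates \<open>Some l\<close> in the order of those of \<open>real ^ 'n\<close>. The matrix
  \<open>(w, \<partial>\<^sub>1 X, \<dots>, \<partial>\<^sub>n X)\<close> is then a square matrix with rows and columns indexed by \<open>'n option\<close>,
  and the sign of its determinant does not depend on the ordering of \<open>'n\<close>.\<close>

definition frame_matrix ::
    "real ^ 'n option \<Rightarrow> real ^ 'n::finite ^ 'n option \<Rightarrow> real ^ 'n option ^ 'n option" where
  "frame_matrix w D = (\<chi> a b. case b of None \<Rightarrow> w $ a | Some l \<Rightarrow> D $ a $ l)"

definition is_unit_normal ::
    "('a, 'n::finite) chart set \<Rightarrow> ('a \<Rightarrow> real ^ 'n option) \<Rightarrow> 'a \<Rightarrow> real ^ 'n option \<Rightarrow> bool" where
  "is_unit_normal A X p w \<longleftrightarrow>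
     norm w = 1 \<and>
     (\<forall>c\<in>A. p \<in> fst c \<longrightarrow>
        (\<forall>l. w \<bullet> column l (diff_matrix c X p) = 0) \<and>
        det (frame_matrix w (diff_matrix c X p)) > 0)"

definition unit_normal ::
    "('a, 'n::finite) chart set \<Rightarrow> ('a \<Rightarrow> real ^ 'n option) \<Rightarrow> 'a \<Rightarrow> real ^ 'n option" where
  "unit_normal A X p = (THE w. is_unit_normal A X p w)"

definition smooth_immersion_on ::
    "('a, 'n::finite) chart set \<Rightarrow> 'a set \<Rightarrow> ('a \<Rightarrow> real ^ 'n option) \<Rightarrow> bool" where
  "smooth_immersion_on A W X \<longleftrightarrow>
     smooth_on A W X \<and>
     (\<forall>p\<in>W. \<forall>c\<in>A. p \<in> fst c \<longrightarrow> inj ((*v) (diff_matrix c X p)))"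

text \<open>The conditions (A1)--(A3) for \<open>r = \<infinity>\<close>, where \<open>C\<^sup>r\<^sup>-\<^sup>1\<close> is again \<open>C\<^sup>\<infinity>\<close>.\<close>

definition piecewise_smooth_weak_immersion ::
    "'a topology \<Rightarrow> ('a, 'n::finite) chart set \<Rightarrow> nat \<Rightarrow> (nat \<Rightarrow> 'a set) \<Rightarrow>
     ('a \<Rightarrow> real ^ 'n option) \<Rightarrow> bool" where
  "piecewise_smooth_weak_immersion T A k M X \<longleftrightarrow>
     continuous_map T euclidean X \<and>
     (\<forall>i\<in>{1..k}.
        smooth_on A (M i) X \<and>
        smooth_immersion_on A (T interior_of M i) X \<and>
        (\<exists>N. smooth_on A (M i) N \<and> (\<forall>p\<in>M i. norm (N p) = 1) \<and>
             (\<forall>p\<in>T interior_of M i. is_unit_normal A X p (N p))))"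

definition closed_weakly_immersed_hypersurface ::
    "'a topology \<Rightarrow> ('a, 'n::finite) chart set \<Rightarrow> nat \<Rightarrow> (nat \<Rightarrow> 'a set) \<Rightarrow>
     ('a \<Rightarrow> real ^ 'n option) \<Rightarrow> bool" where
  "closed_weakly_immersed_hypersurface T A k M X \<longleftrightarrow>
     closed_oriented_manifold T A \<and> manifold_decomposition T A k M \<and>
     piecewise_smooth_weak_immersion T A k M X"

definition singular_set ::
    "'a topology \<Rightarrow> ('a, 'n::finite) chart set \<Rightarrow> ('a \<Rightarrow> real ^ 'n option) \<Rightarrow> 'a set" where
  "singular_set T A X =
     {p \<in> topspace T. \<not> (\<exists>W. openin T W \<and> p \<in> W \<and> smooth_immersion_on A W X)}"


section \<open>The anisotropic energy\<close>

text \<open>Integrals over \<open>M\<close> are computed by cutting \<open>M\<close> into finitely many disjoint Borel pieces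
  \<open>K\<^sub>j - (K\<^sub>0 \<union> \<dots> \<union> K\<^sub>j\<^sub>-\<^sub>1)\<close>, each relatively compact in the domain of a chart of the atlas; by the change
  of variables formula the value does not depend on the chosen cover. The integrand lives on
  the complement of \<open>S(X)\<close>; for weak immersions, \<open>S(X)\<close> lies in the union of the piecewise smooth
  boundaries \<open>\<partial>M\<^sub>i\<close> and hence is negligible.\<close>

definition compact_chart_cover ::
    "'a topology \<Rightarrow> ('a, 'n::finite) chart set \<Rightarrow> (('a, 'n) chart \<times> 'a set) list \<Rightarrow> bool" where
  "compact_chart_cover T A Q \<longleftrightarrow>
     (\<forall>(c, K)\<in>set Q. c \<in> A \<and> compactin T K \<and> K \<subseteq> fst c) \<and>
     (\<Union>(c, K)\<in>set Q. K) = topspace T"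

definition volume_density ::
    "('a, 'n::finite) chart \<Rightarrow> ('a \<Rightarrow> real ^ 'n option) \<Rightarrow> 'a \<Rightarrow> real" where
  "volume_density c X p = sqrt (det (transpose (diff_matrix c X p) ** diff_matrix c X p))"

definition hypersurface_integral ::
    "'a topology \<Rightarrow> ('a, 'n::finite) chart set \<Rightarrow> ('a \<Rightarrow> real ^ 'n option) \<Rightarrow> ('a \<Rightarrow> real) \<Rightarrow> real" where
  "hypersurface_integral T A X f =
     (let Q = (SOME Q. compact_chart_cover T A Q) in
      \<Sum>j<length Q. let c = fst (Q ! j); B = snd (Q ! j) - (\<Union>l<j. snd (Q ! l)) in
        set_lebesgue_integral lborel (snd c ` (B - singular_set T A X))
          (\<lambda>u. f (chart_inv c u) * volume_density c X (chart_inv c u)))"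

definition anisotropic_energy ::
    "'a topology \<Rightarrow> ('a, 'n::finite) chart set \<Rightarrow> (real ^ 'n option \<Rightarrow> real) \<Rightarrow>
     ('a \<Rightarrow> real ^ 'n option) \<Rightarrow> real" where
  "anisotropic_energy T A \<gamma> X = hypersurface_integral T A X (\<lambda>p. \<gamma> (unit_normal A X p))"

definition enclosed_volume ::
    "'a topology \<Rightarrow> ('a, 'n::finite) chart set \<Rightarrow> ('a \<Rightarrow> real ^ 'n option) \<Rightarrow> real" where
  "enclosed_volume T A X =
     hypersurface_integral T A X (\<lambda>p. X p \<bullet> unit_normal A X p) / (real CARD('n) + 1)"

text \<open>Variations pass through piecewise smooth weak immersions with the same pieces and are jointly
  smooth in the parameter and the point of each piece.\<close>

definition variation ::
    "'a topology \<Rightarrow> ('a, 'n::finite) chart set \<Rightarrow> nat \<Rightarrow> (nat \<Rightarrow> 'a set) \<Rightarrow>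
     ('a \<Rightarrow> real ^ 'n option) \<Rightarrow> (real \<Rightarrow> 'a \<Rightarrow> real ^ 'n option) \<Rightarrow> bool" where
  "variation T A k M X Y \<longleftrightarrow>
     (\<forall>p\<in>topspace T. Y 0 p = X p) \<and>
     (\<exists>e>0. (\<forall>t\<in>{-e<..<e}. piecewise_smooth_weak_immersion T A k M (Y t)) \<and>
        (\<forall>i\<in>{1..k}. \<forall>c\<in>A.
           Cr_on \<infinity> ({-e<..<e} \<times> snd c ` (fst c \<inter> M i)) (\<lambda>(t, u). Y t (chart_inv c u))))"

definition critical_point ::
    "'a topology \<Rightarrow> ('a, 'n::finite) chart set \<Rightarrow> nat \<Rightarrow> (nat \<Rightarrow> 'a set) \<Rightarrow>
     (real ^ 'n option \<Rightarrow> real) \<Rightarrow> ('a \<Rightarrow> real ^ 'n option) \<Rightarrow> bool" where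
  "critical_point T A k M \<gamma> X \<longleftrightarrow>
     (\<forall>Y. variation T A k M X Y \<longrightarrow>
        ((\<lambda>t. anisotropic_energy T A \<gamma> (Y t)) has_real_derivative 0) (at 0))"

definition volume_constrained_critical_point ::
    "'a topology \<Rightarrow> ('a, 'n::finite) chart set \<Rightarrow> nat \<Rightarrow> (nat \<Rightarrow> 'a set) \<Rightarrow>
     (real ^ 'n option \<Rightarrow> real) \<Rightarrow> ('a \<Rightarrow> real ^ 'n option) \<Rightarrow> bool" where
  "volume_constrained_critical_point T A k M \<gamma> X \<longleftrightarrow>
     (\<forall>Y. variation T A k M X Y \<and>
          (\<forall>\<^sub>F t in nhds 0. enclosed_volume T A (Y t) = enclosed_volume T A X) \<longrightarrow>
        ((\<lambda>t. anisotropic_energy T A \<gamma> (Y t)) has_real_derivative 0) (at 0))"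


section \<open>Anisotropic mean curvature\<close>

definition sphere_gradient :: "('e::euclidean_space \<Rightarrow> real) \<Rightarrow> 'e \<Rightarrow> 'e" where
  "sphere_gradient \<gamma> x =
     (THE w. w \<bullet> x = 0 \<and> (\<gamma> has_derivative (\<lambda>v. w \<bullet> v)) (at x within sphere 0 1))"

definition cahn_hoffman :: "('e::euclidean_space \<Rightarrow> real) \<Rightarrow> 'e \<Rightarrow> 'e" where
  "cahn_hoffman \<gamma> x = sphere_gradient \<gamma> x + \<gamma> x *\<^sub>R x"

text \<open>In a chart \<open>c\<close> around \<open>p\<close>, the endomorphism \<open>d(\<xi> \<circ> \<nu>)\<close> of the tangent space is represented by
  the matrix \<open>L\<close> with \<open>\<partial>\<^sub>l (\<xi> \<circ> \<nu>) = \<Sum>\<^sub>m L\<^sub>m\<^sub>l \<partial>\<^sub>m X\<close>; its trace does not depend on \<open>c\<close>.\<close>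

definition anisotropic_mean_curvature ::
    "('a, 'n::finite) chart set \<Rightarrow> (real ^ 'n option \<Rightarrow> real) \<Rightarrow>
     ('a \<Rightarrow> real ^ 'n option) \<Rightarrow> 'a \<Rightarrow> real" where
  "anisotropic_mean_curvature A \<gamma> X p =
     (let c = (SOME c. c \<in> A \<and> p \<in> fst c);
          L = (THE L :: real ^ 'n ^ 'n.
                 diff_matrix c (\<lambda>q. cahn_hoffman \<gamma> (unit_normal A X q)) p = diff_matrix c X p ** L)
      in - trace L / real CARD('n))"

text \<open>Constant anisotropic mean curvature of a piecewise smooth hypersurface means stationarity for
  volume-preserving variations, with the given value of \<open>\<Lambda>\<close> at the regular points. Constancy of
  \<open>\<Lambda>\<close> at the regular points alone says nothing about the edges: every polyhedron has
  \<open>\<Lambda> = 0\<close> there.\<close>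

definition has_constant_anisotropic_mean_curvature ::
    "'a topology \<Rightarrow> ('a, 'n::finite) chart set \<Rightarrow> nat \<Rightarrow> (nat \<Rightarrow> 'a set) \<Rightarrow>
     (real ^ 'n option \<Rightarrow> real) \<Rightarrow> ('a \<Rightarrow> real ^ 'n option) \<Rightarrow> real \<Rightarrow> bool" where
  "has_constant_anisotropic_mean_curvature T A k M \<gamma> X \<Lambda>\<^sub>0 \<longleftrightarrow>
     volume_constrained_critical_point T A k M \<gamma> X \<and>
     (\<forall>p\<in>topspace T - singular_set T A X. anisotropic_mean_curvature A \<gamma> X p = \<Lambda>\<^sub>0)"

end

theory Submission
  imports Defs
begin

text \<open>The energy of a homothetic copy \<open>(1 + t) X\<close> is \<open>(1 + t)\<^sup>n\<close> times the energy of \<open>X\<close>, and the energy is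
strictly positive. Along \<open>(1 + t) X\<close> its derivative at \<open>t = 0\<close> is therefore \<open>n\<close> times a positive number,
so \<open>X\<close> is not critical.

If only volume-preserving variations are admitted, the homothety has to be compensated. Let \<open>\<phi>\<close> be a
bump function supported in a coordinate box inside the interior of one piece, and let \<open>w\<close> be a constant
vector with \<open>w \<bullet> \<nu> > 0\<close> on the box. The perturbation \<open>X + s \<phi> w\<close> changes the differential of \<open>X\<close> by a matrix of
rank one, and determinants are affine in such changes. Hence the enclosed volume of \<open>X + s \<phi> w\<close> is
exactly \<open>V + s \<beta>\<close> with \<open>\<beta> > 0\<close>, and \<open>(1 + t) (X + \<sigma>(t) \<phi> w)\<close> has constant volume for an explicit function
\<open>\<sigma>\<close>. By the first variation formula the energy of \<open>X + s \<phi> w\<close> has the derivative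
\<open>- n \<integral> \<Lambda> \<phi> (w \<bullet> \<nu>) dA\<close> at \<open>s = 0\<close>. When \<open>\<Lambda> = 0\<close>, the derivative of the energy along the volume-preserving
variation is thus again \<open>n\<close> times the energy of \<open>X\<close>, which is not zero.

In coordinates the unit normal times the volume density is the generalised cross product
\<open>C = \<partial>\<^sub>1 X \<times> \<dots> \<times> \<partial>\<^sub>n X\<close>, defined by \<open>e \<bullet> C = det (e, \<partial>\<^sub>1 X, \<dots>, \<partial>\<^sub>n X)\<close>. The integrand of the volume is
\<open>X \<bullet> C\<close>, and that of the energy is \<open>\<Gamma>(C)\<close> for the extension \<open>\<Gamma>\<close> of \<open>\<gamma>\<close> that is positively homogeneous of
degree one; the gradient of \<open>\<Gamma>\<close> is the Cahn--Hoffman map \<open>\<xi>\<close>. Both first variations therefore contain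
\<open>\<integral> \<Sum>\<^sub>l (\<partial>\<^sub>l \<phi>) det (\<eta>, \<partial>\<^sub>1 X, \<dots>, w, \<dots>, \<partial>\<^sub>n X)\<close> with \<open>w\<close> in the place of \<open>\<partial>\<^sub>l X\<close>, where \<open>\<eta>\<close> is \<open>X\<close> or
\<open>\<xi> \<circ> \<nu>\<close>. Integration by parts (\<open>has_integral_row_det_by_parts\<close>) makes the second derivatives of \<open>X\<close>
cancel in pairs and leaves the trace of the matrix that expresses the \<open>\<partial>\<^sub>l \<eta>\<close> through the \<open>\<partial>\<^sub>m X\<close>: it is
\<open>n\<close> for \<open>\<eta> = X\<close> and \<open>- n \<Lambda>\<close> for \<open>\<eta> = \<xi> \<circ> \<nu>\<close>.

Integrals over the manifold are sums over the cells of a chosen cover. Some cell contains a nonempty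
open part of the interior of a piece (\<open>open_subset_of_cell\<close>), and the bump is placed there, so that
only one summand changes. Each piece carries \<open>X\<close> smoothly up to its boundary, so that the volume
density is bounded on the regular points of a cell (\<open>chart_normal_bounded\<close>); this gives the
integrability without which the positivity of the energy and the splitting of the integrals would
fail.\<close>

section \<open>Calculus of smooth maps\<close>

text \<open>Openness of \<open>W\<close> makes the derivatives at a point of \<open>W\<close> depend on the values in \<open>W\<close> only.\<close>

lemma Ck_on_cong:
  assumes "open W" "\<And>x. x \<in> W \<Longrightarrow> f x = g x"
  shows "Ck_on k W f \<longleftrightarrow> Ck_on k W g"
  using assms
proof (induction k arbitrary: f g)
  case 0
  then show ?case by (simp cong: continuous_on_cong)
next
  case (Suc k)
  have *: "(f differentiable at x) = (g differentiable at x)" if "x \<in> W" for x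
    using that Suc.prems unfolding differentiable_def
    by (metis has_derivative_transform_within_open)
  have **: "frechet_derivative f (at x) = frechet_derivative g (at x)"
    if "x \<in> W" "f differentiable at x" for x
    using that Suc.prems by (metis frechet_derivative_transform_within_open)
  have "Ck_on k W (\<lambda>x. frechet_derivative f (at x) v) \<longleftrightarrow> Ck_on k W (\<lambda>x. frechet_derivative g (at x) v)"
    if "\<forall>x\<in>W. f differentiable at x" for v
    by (rule Suc.IH) (use ** that Suc.prems in auto)
  with * show ?case by auto
qed

lemma Ck_on_SucI:
  assumes "open W" "\<And>x. x \<in> W \<Longrightarrow> (f has_derivative f' x) (at x)"
    and "\<And>v. Ck_on k W (\<lambda>x. f' x v)"
  shows "Ck_on (Suc k) W f"
proof -
  have "frechet_derivative f (at x) = f' x" if "x \<in> W" for x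
    using assms(2)[OF that] frechet_derivative_at by metis
  then have "Ck_on k W (\<lambda>x. frechet_derivative f (at x) v)" for v
    using Ck_on_cong[OF assms(1), of "\<lambda>x. frechet_derivative f (at x) v" "\<lambda>x. f' x v"] assms(3)
    by simp
  then show ?thesis using assms(2) by (auto simp: differentiable_def)
qed

lemma
  assumes "Ck_on (Suc k) W f"
  shows Ck_on_SucD_has_derivative:
      "x \<in> W \<Longrightarrow> (f has_derivative frechet_derivative f (at x)) (at x)"
    and Ck_on_SucD_frechet: "Ck_on k W (\<lambda>x. frechet_derivative f (at x) v)"
  using assms by (simp_all flip: frechet_derivative_works)

lemma Ck_on_SucD: "Ck_on (Suc k) W f \<Longrightarrow> Ck_on k W f"
proof (induction k arbitrary: f)
  case 0
  then show ?case
    by (auto intro!: continuous_at_imp_continuous_on differentiable_imp_continuous_within)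
next
  case (Suc k)
  then show ?case by (metis Ck_on.simps(2))
qed

lemma Ck_on_mono: "k \<le> m \<Longrightarrow> Ck_on m W f \<Longrightarrow> Ck_on k W f"
  by (induction m) (auto simp: le_Suc_eq intro: Ck_on_SucD simp del: Ck_on.simps)

lemma Ck_on_imp_continuous_on: "Ck_on k W f \<Longrightarrow> continuous_on W f"
  using Ck_on_mono[of 0 k] by simp

lemma Ck_on_subset: "Ck_on k W f \<Longrightarrow> S \<subseteq> W \<Longrightarrow> Ck_on k S f"
  by (induction k arbitrary: f) (auto intro: continuous_on_subset)

lemma Ck_on_locally:
  assumes "\<And>x. x \<in> S \<Longrightarrow> \<exists>W. open W \<and> x \<in> W \<and> Ck_on k W f"
  shows "Ck_on k S f"
  using assms
proof (induction k arbitrary: f)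
  case 0
  then have "isCont f x" if "x \<in> S" for x
    using that by (metis Ck_on.simps(1) continuous_on_eq_continuous_at)
  then show ?case by (simp add: continuous_at_imp_continuous_on)
next
  case (Suc k)
  have "f differentiable at x" if "x \<in> S" for x
    using Suc.prems[OF that] by auto
  moreover have "Ck_on k S (\<lambda>x. frechet_derivative f (at x) v)" for v
    by (rule Suc.IH) (use Suc.prems in fastforce)
  ultimately show ?case by simp
qed

lemma Ck_on_const: "open W \<Longrightarrow> Ck_on k W (\<lambda>x. c)"
proof (induction k arbitrary: c)
  case (Suc k)
  show ?case by (rule Ck_on_SucI[where f' = "\<lambda>_ _. 0"]) (use Suc in auto)
qed simp

lemma Ck_on_ident: "open W \<Longrightarrow> Ck_on k W (\<lambda>x. x)"
proof (cases k)
  case (Suc m)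
  assume "open W"
  then show ?thesis unfolding Suc
    by (intro Ck_on_SucI[where f' = "\<lambda>_ v. v"] Ck_on_const) auto
qed simp

lemma Ck_on_bounded_linear:
  assumes "bounded_linear h" "open W" "Ck_on k W f"
  shows "Ck_on k W (\<lambda>x. h (f x))"
  using assms(3)
proof (induction k arbitrary: f)
  case 0
  then show ?case using assms(1) by (simp add: bounded_linear.continuous_on)
next
  case (Suc k)
  note D = Ck_on_SucD_has_derivative[OF Suc.prems] Ck_on_SucD_frechet[OF Suc.prems]
  show ?case
    by (rule Ck_on_SucI[where f' = "\<lambda>x v. h (frechet_derivative f (at x) v)"])
      (rule assms bounded_linear.has_derivative[OF assms(1)] Suc.IH D | assumption)+
qed

lemma Ck_on_add:
  assumes "open W" "Ck_on k W f" "Ck_on k W g"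
  shows "Ck_on k W (\<lambda>x. f x + g x)"
  using assms(2,3)
proof (induction k arbitrary: f g)
  case 0
  then show ?case by (simp add: continuous_on_add)
next
  case (Suc k)
  note D = Suc.prems[THEN Ck_on_SucD_has_derivative] Suc.prems[THEN Ck_on_SucD_frechet]
  show ?case
    by (rule Ck_on_SucI[where
        f' = "\<lambda>x v. frechet_derivative f (at x) v + frechet_derivative g (at x) v"])
      (rule assms has_derivative_add Suc.IH D | assumption)+
qed

lemma Ck_on_sum:
  assumes "open W" "\<And>i. i \<in> I \<Longrightarrow> Ck_on k W (f i)"
  shows "Ck_on k W (\<lambda>x. \<Sum>i\<in>I. f i x)"
  using assms(2)
  by (induction I rule: infinite_finite_induct) (simp_all add: Ck_on_const Ck_on_add assms(1))

lemma Ck_on_bilinear: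
  assumes "bounded_bilinear h" "open W" "Ck_on k W f" "Ck_on k W g"
  shows "Ck_on k W (\<lambda>x. h (f x) (g x))"
  using assms(3,4)
proof (induction k arbitrary: f g)
  case 0
  then show ?case using assms(1) by (simp add: bounded_bilinear.continuous_on)
next
  case (Suc k)
  note D = Suc.prems[THEN Ck_on_SucD]
  show ?case
  proof (rule Ck_on_SucI[where
        f' = "\<lambda>x v. h (f x) (frechet_derivative g (at x) v) + h (frechet_derivative f (at x) v) (g x)"])
    show "((\<lambda>x. h (f x) (g x)) has_derivative
       (\<lambda>v. h (f x) (frechet_derivative g (at x) v) + h (frechet_derivative f (at x) v) (g x))) (at x)"
      if "x \<in> W" for x
      using that by (intro bounded_bilinear.FDERIV[OF assms(1)] Suc.prems[THEN Ck_on_SucD_has_derivative])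
    show "Ck_on k W (\<lambda>x. h (f x) (frechet_derivative g (at x) v) + h (frechet_derivative f (at x) v) (g x))" for v
      by (rule Ck_on_add assms Suc.IH D Suc.prems[THEN Ck_on_SucD_frechet])+
  qed (use assms in auto)
qed

lemmas Ck_on_scaleR = Ck_on_bilinear[OF bounded_bilinear_scaleR]
lemmas Ck_on_mult = Ck_on_bilinear[OF bounded_bilinear_mult]
lemmas Ck_on_inner = Ck_on_bilinear[OF bounded_bilinear_inner]

lemma Ck_on_prod:
  fixes f :: "'i \<Rightarrow> 'a::euclidean_space \<Rightarrow> real"
  assumes "open W" "\<And>i. i \<in> I \<Longrightarrow> Ck_on k W (f i)"
  shows "Ck_on k W (\<lambda>x. \<Prod>i\<in>I. f i x)"
  using assms(2)
  by (induction I rule: infinite_finite_induct) (simp_all add: Ck_on_const Ck_on_mult assms(1))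

text \<open>By the chain rule, the derivative of the composition in a direction \<open>v\<close> is a sum of products of
components of the derivative of \<open>f\<close> with compositions of partial derivatives of \<open>g\<close> with \<open>f\<close>; the
induction is applied to the latter, for all \<open>g\<close> simultaneously.\<close>

lemma Ck_on_compose:
  assumes "open W" "open V" "f ` W \<subseteq> V" "Ck_on k W f" "Ck_on k V g"
  shows "Ck_on k W (\<lambda>x. g (f x))"
  using assms(4,5)
proof (induction k arbitrary: g)
  case 0
  then show ?case using assms(3) by (auto intro: continuous_on_compose2)
next
  case (Suc k)
  let ?D = "\<lambda>x v. \<Sum>b\<in>Basis. (frechet_derivative f (at x) v \<bullet> b) *\<^sub>R frechet_derivative g (at (f x)) b"
  show ?case
  proof (rule Ck_on_SucI[where f' = ?D])
    fix x assume x: "x \<in> W"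
    have g: "(g has_derivative frechet_derivative g (at (f x))) (at (f x))"
      using Ck_on_SucD_has_derivative[OF Suc.prems(2)] x assms(3) by blast
    have f: "(f has_derivative frechet_derivative f (at x)) (at x)"
      using Ck_on_SucD_has_derivative[OF Suc.prems(1)] x by blast
    have "frechet_derivative g (at (f x)) (frechet_derivative f (at x) v) = ?D x v" for v
    proof -
      have "frechet_derivative g (at (f x)) (frechet_derivative f (at x) v) =
        frechet_derivative g (at (f x)) (\<Sum>b\<in>Basis. (frechet_derivative f (at x) v \<bullet> b) *\<^sub>R b)"
        by (simp only: euclidean_representation)
      also have "\<dots> = ?D x v"
        by (simp only: linear_sum[OF has_derivative_linear[OF g]] linear_scale[OF has_derivative_linear[OF g]])
      finally show ?thesis .
    qed
    then show "((\<lambda>x. g (f x)) has_derivative ?D x) (at x)"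
      using has_derivative_compose[OF f g] by (simp only:)
  next
    fix v
    have "Ck_on k W (\<lambda>x. frechet_derivative g (at (f x)) b)" for b
      by (rule Suc.IH[OF Ck_on_SucD[OF Suc.prems(1)] Ck_on_SucD_frechet[OF Suc.prems(2)]])
    moreover have "Ck_on k W (\<lambda>x. frechet_derivative f (at x) v \<bullet> b)" for b
      by (rule Ck_on_bounded_linear[OF bounded_linear_inner_left assms(1) Ck_on_SucD_frechet[OF Suc.prems(1)]])
    ultimately show "Ck_on k W (\<lambda>x. ?D x v)"
      by (intro Ck_on_sum Ck_on_scaleR assms)
  qed (use assms in auto)
qed

lemma Ck_on_vec_lambda:
  fixes f :: "'i::finite \<Rightarrow> 'a::euclidean_space \<Rightarrow> real"
  assumes "open W" "\<And>i. Ck_on k W (f i)"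
  shows "Ck_on k W (\<lambda>x. \<chi> i. f i x)"
proof -
  have "(\<lambda>x. \<chi> i. f i x) = (\<lambda>x. \<Sum>i\<in>UNIV. f i x *\<^sub>R axis i 1)"
    by (auto simp: vec_eq_iff axis_def if_distrib cong: if_cong)
  moreover have "Ck_on k W (\<lambda>x. \<Sum>i\<in>UNIV. f i x *\<^sub>R (axis i 1 :: real^'i))"
    by (intro Ck_on_sum Ck_on_scaleR Ck_on_const assms)
  ultimately show ?thesis by simp
qed

lemma Ck_on_powr: "Ck_on k {0<..} (\<lambda>x::real. x powr a)"
proof (induction k arbitrary: a)
  case 0
  show ?case by (auto intro!: continuous_intros)
next
  case (Suc k)
  show ?case
  proof (rule Ck_on_SucI[where f' = "\<lambda>x v. (a * x powr (a - 1)) * v"])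
    show "((\<lambda>x. x powr a) has_derivative (\<lambda>v. (a * x powr (a - 1)) * v)) (at x)"
      if "x \<in> {0<..}" for x
      using that by (auto intro!: derivative_eq_intros simp: fun_eq_iff powr_diff)
    show "Ck_on k {0<..} (\<lambda>x. a * x powr (a - 1) * v)" for v
      by (intro Ck_on_mult Ck_on_const Suc.IH) auto
  qed auto
qed

lemma Ck_on_norm: "Ck_on k (- {0}) (\<lambda>x::'a::euclidean_space. norm x)"
proof -
  have op: "open (- {0::'a})" by auto
  have "Ck_on k (- {0}) (\<lambda>x::'a. (x \<bullet> x) powr (1/2))"
    by (rule Ck_on_compose[OF op _ _ _ Ck_on_powr]) (auto intro!: Ck_on_inner Ck_on_ident)
  then show ?thesis by (simp add: powr_half_sqrt norm_eq_sqrt_inner)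
qed

section \<open>Smoothness on arbitrary sets\<close>

lemma Cr_on_infinity_iff:
  "Cr_on \<infinity> S f \<longleftrightarrow>
     (\<forall>x\<in>S. \<exists>W g. open W \<and> x \<in> W \<and> (\<forall>k. Ck_on k W g) \<and> (\<forall>y\<in>S \<inter> W. f y = g y))"
  by (simp add: Cr_on_def)

lemma Cr_on_infinityE:
  assumes "Cr_on \<infinity> S f" "x \<in> S"
  obtains W g where "open W" "x \<in> W" "\<And>k. Ck_on k W g" "\<And>y. y \<in> S \<Longrightarrow> y \<in> W \<Longrightarrow> f y = g y"
proof -
  from assms(1)[unfolded Cr_on_infinity_iff, rule_format, OF assms(2)]
  obtain W g where "open W" "x \<in> W" "\<forall>k. Ck_on k W g" "\<forall>y\<in>S \<inter> W. f y = g y"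
    by (elim exE conjE)
  then show thesis by (intro that[of W g]) auto
qed

lemma Cr_on_openI:
  assumes "open W" "\<And>k. Ck_on k W f" "S \<subseteq> W"
  shows "Cr_on \<infinity> S f"
  unfolding Cr_on_infinity_iff
  using assms by (intro ballI exI[of _ W] exI[of _ f]) auto

text \<open>On an open set a local extension coincides with the function itself near each point, so the two
have the same derivatives.\<close>

lemma Cr_on_openD:
  assumes "open S" "Cr_on \<infinity> S f"
  shows "Ck_on k S f"
proof (rule Ck_on_locally)
  fix x assume "x \<in> S"
  with assms(2) obtain W g where W: "open W" "x \<in> W" "\<And>k. Ck_on k W g"
    "\<And>y. y \<in> S \<Longrightarrow> y \<in> W \<Longrightarrow> f y = g y"
    by (rule Cr_on_infinityE) blast
  have "Ck_on k (S \<inter> W) f"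
    using Ck_on_cong[of "S \<inter> W" f g k] W assms(1) Ck_on_subset[of k W g "S \<inter> W"] by auto
  then show "\<exists>W. open W \<and> x \<in> W \<and> Ck_on k W f"
    using W \<open>x \<in> S\<close> assms(1) by blast
qed

lemma Cr_on_subset:
  assumes "Cr_on \<infinity> S f" "R \<subseteq> S"
  shows "Cr_on \<infinity> R f"
  unfolding Cr_on_infinity_iff
proof
  fix x assume "x \<in> R"
  with assms(2) have "x \<in> S" ..
  with assms(1) obtain W h where "open W" "x \<in> W" "\<And>k. Ck_on k W h"
    "\<And>y. y \<in> S \<Longrightarrow> y \<in> W \<Longrightarrow> f y = h y"
    by (rule Cr_on_infinityE) blast
  then show "\<exists>W h. open W \<and> x \<in> W \<and> (\<forall>k. Ck_on k W h) \<and> (\<forall>y\<in>R \<inter> W. f y = h y)"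
    using assms(2) by (intro exI[of _ W] exI[of _ h]) auto
qed

lemma Cr_on_cong:
  assumes "Cr_on \<infinity> S f" "\<And>x. x \<in> S \<Longrightarrow> f x = g x"
  shows "Cr_on \<infinity> S g"
  unfolding Cr_on_infinity_iff
proof
  fix x assume "x \<in> S"
  with assms(1) obtain W h where "open W" "x \<in> W" "\<And>k. Ck_on k W h"
    "\<And>y. y \<in> S \<Longrightarrow> y \<in> W \<Longrightarrow> f y = h y"
    by (rule Cr_on_infinityE) blast
  then show "\<exists>W h. open W \<and> x \<in> W \<and> (\<forall>k. Ck_on k W h) \<and> (\<forall>y\<in>S \<inter> W. g y = h y)"
    using assms(2) by (intro exI[of _ W] exI[of _ h]) auto
qed

lemma Cr_on_locally:
  assumes "\<And>x. x \<in> S \<Longrightarrow> \<exists>W. open W \<and> x \<in> W \<and> Cr_on \<infinity> (S \<inter> W) f"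
  shows "Cr_on \<infinity> S f"
  unfolding Cr_on_infinity_iff
proof
  fix x assume x: "x \<in> S"
  then obtain W where W: "open W" "x \<in> W" "Cr_on \<infinity> (S \<inter> W) f" using assms by blast
  obtain V g where V: "open V" "x \<in> V" "\<And>k. Ck_on k V g"
    "\<And>y. y \<in> S \<inter> W \<Longrightarrow> y \<in> V \<Longrightarrow> f y = g y"
    using Cr_on_infinityE[OF W(3), of x] x W by auto
  have "Ck_on k (W \<inter> V) g" for k using V(3) Ck_on_subset by blast
  then show "\<exists>W g. open W \<and> x \<in> W \<and> (\<forall>k. Ck_on k W g) \<and> (\<forall>y\<in>S \<inter> W. f y = g y)"
    using W V by (intro exI[of _ "W \<inter> V"] exI[of _ g]) auto
qed

lemma Cr_on_imp_continuous_on: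
  assumes "Cr_on \<infinity> S f" shows "continuous_on S f"
  unfolding continuous_on_eq_continuous_within
proof
  fix x assume x: "x \<in> S"
  with assms obtain W g where W: "open W" "x \<in> W" "\<And>k. Ck_on k W g"
    "\<And>y. y \<in> S \<Longrightarrow> y \<in> W \<Longrightarrow> f y = g y"
    by (rule Cr_on_infinityE) blast
  have "continuous_on W g" using W(3) Ck_on_imp_continuous_on by blast
  then have "continuous (at x within S) g"
    using W continuous_on_eq_continuous_at continuous_at_imp_continuous_at_within by blast
  moreover have "\<forall>\<^sub>F y in at x within S. g y = f y"
    using W unfolding eventually_at_topological by auto
  ultimately show "continuous (at x within S) f"
    unfolding continuous_within W(4)[OF x W(2)] by (rule Lim_transform_eventually)
qed

lemma Cr_on_compose:
  assumes "Cr_on \<infinity> S f" "Cr_on \<infinity> R g" "f ` S \<subseteq> R"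
  shows "Cr_on \<infinity> S (\<lambda>x. g (f x))"
  unfolding Cr_on_infinity_iff
proof
  fix x assume x: "x \<in> S"
  obtain W f' where W: "open W" "x \<in> W" "\<And>k. Ck_on k W f'"
    "\<And>y. y \<in> S \<Longrightarrow> y \<in> W \<Longrightarrow> f y = f' y"
    using Cr_on_infinityE[OF assms(1) x] by blast
  obtain V g' where V: "open V" "f x \<in> V" "\<And>k. Ck_on k V g'"
    "\<And>y. y \<in> R \<Longrightarrow> y \<in> V \<Longrightarrow> g y = g' y"
    using Cr_on_infinityE[OF assms(2)] x assms(3) by (metis imageI subsetD)
  define U where "U = W \<inter> f' -` V"
  have "continuous_on W f'" using W(3) Ck_on_imp_continuous_on by blast
  then have U: "open U" unfolding U_def using W V by (metis Int_commute continuous_open_preimage)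
  have "Ck_on k U (\<lambda>x. g' (f' x))" for k
    by (rule Ck_on_compose[OF U V(1) _ Ck_on_subset[OF W(3)] V(3)]) (auto simp: U_def)
  moreover have "x \<in> U" using W V x by (auto simp: U_def)
  moreover have "g (f y) = g' (f' y)" if "y \<in> S \<inter> U" for y
    using that W(4)[of y] V(4)[of "f y"] assms(3) by (auto simp: U_def)
  ultimately show "\<exists>W h. open W \<and> x \<in> W \<and> (\<forall>k. Ck_on k W h) \<and> (\<forall>y\<in>S \<inter> W. g (f y) = h y)"
    using U by (intro exI[of _ U] exI[of _ "\<lambda>x. g' (f' x)"]) auto
qed

lemma Cr_on_const: "Cr_on \<infinity> S (\<lambda>x. c)"
  by (rule Cr_on_openI[of UNIV]) (auto intro: Ck_on_const)

lemma Cr_on_bounded_linear: "bounded_linear h \<Longrightarrow> Cr_on \<infinity> S h"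
  using Ck_on_bounded_linear[OF _ _ Ck_on_ident]
  by (intro Cr_on_openI[of UNIV]) auto

lemma Cr_on_bilinear:
  assumes "bounded_bilinear h" "Cr_on \<infinity> S f" "Cr_on \<infinity> S g"
  shows "Cr_on \<infinity> S (\<lambda>x. h (f x) (g x))"
  unfolding Cr_on_infinity_iff
proof
  fix x assume x: "x \<in> S"
  obtain W f' where W: "open W" "x \<in> W" "\<And>k. Ck_on k W f'"
    "\<And>y. y \<in> S \<Longrightarrow> y \<in> W \<Longrightarrow> f y = f' y"
    using Cr_on_infinityE[OF assms(2) x] by blast
  obtain V g' where V: "open V" "x \<in> V" "\<And>k. Ck_on k V g'"
    "\<And>y. y \<in> S \<Longrightarrow> y \<in> V \<Longrightarrow> g y = g' y"
    using Cr_on_infinityE[OF assms(3) x] by blast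
  have "Ck_on k (W \<inter> V) (\<lambda>x. h (f' x) (g' x))" for k
    using W V by (intro Ck_on_bilinear[OF assms(1)] Ck_on_subset[OF W(3)] Ck_on_subset[OF V(3)]) auto
  then show "\<exists>W k. open W \<and> x \<in> W \<and> (\<forall>j. Ck_on j W k) \<and> (\<forall>y\<in>S \<inter> W. h (f y) (g y) = k y)"
    using W V by (intro exI[of _ "W \<inter> V"] exI[of _ "\<lambda>x. h (f' x) (g' x)"]) auto
qed

lemmas Cr_on_scaleR = Cr_on_bilinear[OF bounded_bilinear_scaleR]
lemmas Cr_on_mult = Cr_on_bilinear[OF bounded_bilinear_mult]

lemma Cr_on_add:
  assumes "Cr_on \<infinity> S f" "Cr_on \<infinity> S g"
  shows "Cr_on \<infinity> S (\<lambda>x. f x + g x)"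
  unfolding Cr_on_infinity_iff
proof
  fix x assume x: "x \<in> S"
  obtain W f' where W: "open W" "x \<in> W" "\<And>k. Ck_on k W f'"
    "\<And>y. y \<in> S \<Longrightarrow> y \<in> W \<Longrightarrow> f y = f' y"
    using Cr_on_infinityE[OF assms(1) x] by blast
  obtain V g' where V: "open V" "x \<in> V" "\<And>k. Ck_on k V g'"
    "\<And>y. y \<in> S \<Longrightarrow> y \<in> V \<Longrightarrow> g y = g' y"
    using Cr_on_infinityE[OF assms(2) x] by blast
  have "Ck_on k (W \<inter> V) (\<lambda>x. f' x + g' x)" for k
    using W V by (intro Ck_on_add Ck_on_subset[OF W(3)] Ck_on_subset[OF V(3)]) auto
  then show "\<exists>W k. open W \<and> x \<in> W \<and> (\<forall>j. Ck_on j W k) \<and> (\<forall>y\<in>S \<inter> W. f y + g y = k y)"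
    using W V by (intro exI[of _ "W \<inter> V"] exI[of _ "\<lambda>x. f' x + g' x"]) auto
qed

lemma Cr_on_powr:
  assumes "Cr_on \<infinity> S f" "\<And>x. x \<in> S \<Longrightarrow> (f x::real) > 0"
  shows "Cr_on \<infinity> S (\<lambda>x. f x powr a)"
  by (rule Cr_on_compose[OF assms(1) Cr_on_openI[OF open_greaterThan Ck_on_powr subset_refl]])
    (use assms(2) in auto)

section \<open>Bump functions\<close>

text \<open>The powers of \<open>1 / x\<close> make the family closed under differentiation; \<open>flat_exp 0\<close> is the classical smooth
function that vanishes exactly on the nonpositive half line.\<close>

definition flat_exp :: "nat \<Rightarrow> real \<Rightarrow> real" where
  "flat_exp m x = (if x > 0 then (1 / x) ^ m * exp (- (1 / x)) else 0)"

text \<open>At \<open>x = 0\<close> the difference quotient from the right is \<open>y\<^sup>m\<^sup>+\<^sup>1 / exp y\<close> with \<open>y = 1 / x\<close>, which tends to \<open>0\<close>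
as \<open>y\<close> tends to infinity.\<close>

lemma flat_exp_has_derivative:
  "(flat_exp m has_real_derivative (flat_exp (m + 2) x - real m * flat_exp (m + 1) x)) (at x)"
proof (cases x "0::real" rule: linorder_cases)
  case less
  have "((\<lambda>_. 0) has_real_derivative 0) (at x)" by simp
  then have "(flat_exp m has_real_derivative 0) (at x)"
    by (rule has_field_derivative_transform_within_open[of _ _ _ "{..<0}"]) (use less in \<open>auto simp: flat_exp_def\<close>)
  then show ?thesis using less by (simp add: flat_exp_def)
next
  case equal
  have lim: "((\<lambda>y. y ^ Suc m / exp y) \<longlongrightarrow> 0) (at_top::real filter)"
    by (rule tendsto_power_div_exp_0)
  have "((\<lambda>h::real. (inverse h) ^ Suc m / exp (inverse h)) \<longlongrightarrow> 0) (at_right 0)"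
    using filterlim_compose[OF lim filterlim_inverse_at_top_right] .
  then have "((\<lambda>h. (flat_exp m (0 + h) - flat_exp m 0) / h) \<longlongrightarrow> 0) (at_right 0)"
    by (rule Lim_transform_eventually)
      (auto simp: eventually_at_topological flat_exp_def exp_minus field_simps intro!: exI[of _ UNIV])
  moreover have "((\<lambda>h. (flat_exp m (0 + h) - flat_exp m 0) / h) \<longlongrightarrow> 0) (at_left 0)"
    by (rule tendsto_eventually) (auto simp: eventually_at_topological flat_exp_def intro!: exI[of _ UNIV])
  ultimately have "((\<lambda>h. (flat_exp m (0 + h) - flat_exp m 0) / h) \<longlongrightarrow> 0) (at 0)"
    by (simp add: filterlim_split_at_real)
  then have "(flat_exp m has_real_derivative 0) (at 0)" by (simp add: DERIV_def)
  then show ?thesis using equal by (simp add: flat_exp_def)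
next
  case greater
  have "((\<lambda>x. (1 / x) ^ m * exp (- (1 / x))) has_real_derivative
      (flat_exp (m + 2) x - real m * flat_exp (m + 1) x)) (at x)"
    using greater
    by (auto intro!: derivative_eq_intros simp: flat_exp_def)
       (cases m; auto simp: field_simps power2_eq_square)
  then show ?thesis
    by (rule has_field_derivative_transform_within_open[of _ _ _ "{0<..}"]) (use greater in \<open>auto simp: flat_exp_def\<close>)
qed

lemma Ck_on_flat_exp: "Ck_on k UNIV (flat_exp m)"
proof (induction k arbitrary: m)
  case 0
  show ?case
    using flat_exp_has_derivative
    by (metis Ck_on.simps(1) DERIV_isCont continuous_at_imp_continuous_on)
next
  case (Suc k)
  show ?case
  proof (rule Ck_on_SucI[where f' = "\<lambda>x v. (flat_exp (m + 2) x + (- real m) * flat_exp (m + 1) x) * v"])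
    show "Ck_on k UNIV (\<lambda>x. (flat_exp (m + 2) x + (- real m) * flat_exp (m + 1) x) * v)" for v
      by (rule Ck_on_mult Ck_on_add Ck_on_const Suc.IH open_UNIV)+
    show "(flat_exp m has_derivative (*) (flat_exp (m + 2) x + - real m * flat_exp (m + 1) x)) (at x)" for x
      using flat_exp_has_derivative[of m x] by (simp add: has_field_derivative_def)
  qed auto
qed

lemma ex_smooth_bump:
  fixes u :: "'e::euclidean_space"
  assumes "r > 0"
  shows "\<exists>\<phi> :: 'e \<Rightarrow> real. (\<forall>k. Ck_on k UNIV \<phi>) \<and> (\<forall>x. \<phi> x \<ge> 0) \<and> \<phi> u > 0 \<and>
    (\<forall>x. x \<notin> ball u r \<longrightarrow> \<phi> x = 0)"
proof (intro exI conjI allI impI)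
  let ?\<phi> = "\<lambda>x. flat_exp 0 (r\<^sup>2 + (- 1) * ((x + - u) \<bullet> (x + - u)))"
  show "Ck_on k UNIV ?\<phi>" for k
    by (rule Ck_on_compose[OF open_UNIV open_UNIV subset_UNIV _ Ck_on_flat_exp])
      (intro Ck_on_add Ck_on_mult Ck_on_inner Ck_on_const Ck_on_ident open_UNIV)
  show "?\<phi> x \<ge> 0" for x by (simp add: flat_exp_def)
  show "?\<phi> u > 0" using assms by (simp add: flat_exp_def)
  show "?\<phi> x = 0" if "x \<notin> ball u r" for x
  proof -
    have "r\<^sup>2 \<le> (norm (x - u))\<^sup>2"
      using that assms by (intro power_mono) (auto simp: dist_norm norm_minus_commute)
    then show ?thesis by (simp add: flat_exp_def dot_square_norm)
  qed
qed

section \<open>Determinants as functions of their rows\<close>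

text \<open>With the rows given as a function, replacing a row is a function update, and multilinearity can be
stated without case distinctions on indices.\<close>

definition row_det :: "('m::finite \<Rightarrow> real ^ 'm) \<Rightarrow> real" where
  "row_det f = det (\<chi> i. f i)"

lemma row_det_add: "row_det (f(i := x + y)) = row_det (f(i := x)) + row_det (f(i := y))"
  using det_row_add[of i "\<lambda>_. x" "\<lambda>_. y" f] by (simp add: row_det_def fun_upd_def)

lemma row_det_scale: "row_det (f(i := c *\<^sub>R x)) = c * row_det (f(i := x))"
  using det_row_mul[of i c "\<lambda>_. x" f]
  unfolding row_det_def fun_upd_def scalar_mult_eq_scaleR .

lemma row_det_sum:
  assumes "finite S"
  shows "row_det (f(i := (\<Sum>j\<in>S. g j))) = (\<Sum>j\<in>S. row_det (f(i := g j)))"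
  using det_linear_row_sum[OF assms, of i "\<lambda>_. g" f]
  unfolding row_det_def fun_upd_def .

lemma row_det_identical: "i \<noteq> j \<Longrightarrow> f i = f j \<Longrightarrow> row_det f = 0"
  unfolding row_det_def by (rule det_identical_rows[of i j]) (simp_all add: row_def)

lemma row_det_add_multiple:
  assumes "i \<noteq> j"
  shows "row_det (f(i := x + c *\<^sub>R f j)) = row_det (f(i := x))"
  using row_det_identical[of i j "f(i := f j)"] assms
  by (simp add: row_det_add row_det_scale)

text \<open>The determinant with \<open>x + y\<close> in both rows vanishes; expanding it leaves the sum of the two
determinants in question, since those with \<open>x\<close> or \<open>y\<close> twice vanish as well.\<close>

lemma row_det_swap:
  assumes "i \<noteq> j"
  shows "row_det (f(i := y, j := x)) = - row_det (f(i := x, j := y))"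
proof -
  have add: "row_det (f(i := x + y, j := z)) = row_det (f(i := x, j := z)) + row_det (f(i := y, j := z))" for z
    using row_det_add[of "f(j := z)" i x y] by (simp only: fun_upd_twist[OF assms])
  have "0 = row_det (f(i := x + y, j := x + y))"
    using assms by (intro row_det_identical[symmetric, of i j]) auto
  also have "\<dots> = (row_det (f(i := x, j := x)) + row_det (f(i := y, j := x)))
      + (row_det (f(i := x, j := y)) + row_det (f(i := y, j := y)))"
    by (simp only: row_det_add add)
  also have "\<dots> = row_det (f(i := x, j := y)) + row_det (f(i := y, j := x))"
    using assms row_det_identical[of i j "f(i := x, j := x)"] row_det_identical[of i j "f(i := y, j := y)"]
    by simp
  finally show ?thesis by simp
qed

text \<open>As soon as one row equals \<open>w\<close>, multiples of \<open>w\<close> may be added to all other rows.\<close>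

lemma row_det_rank_one_upd:
  assumes "finite S" "k \<notin> S"
  shows "row_det ((\<lambda>i. f i + (if i \<in> S then a i else 0) *\<^sub>R w)(k := w)) = row_det (f(k := w))"
  using assms
proof (induction S)
  case (insert l S)
  let ?g = "\<lambda>S i. f i + (if i \<in> S then a i else 0) *\<^sub>R w"
  have "(?g (insert l S))(k := w) = ((?g S)(k := w))(l := f l + a l *\<^sub>R ((?g S)(k := w)) k)"
    using insert by (auto simp: fun_eq_iff)
  moreover have "((?g S)(k := w))(l := f l) = (?g S)(k := w)"
    using insert by (auto simp: fun_eq_iff)
  moreover have "row_det (((?g S)(k := w))(l := f l + a l *\<^sub>R ((?g S)(k := w)) k))
      = row_det (((?g S)(k := w))(l := f l))"
    using insert by (intro row_det_add_multiple) auto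
  moreover have "row_det ((?g S)(k := w)) = row_det (f(k := w))"
    using insert by blast
  ultimately show ?case by (simp only:)
qed simp

text \<open>Only terms of first order in the coefficients \<open>a i\<close> survive, because in a term of higher order the
row \<open>w\<close> occurs twice. This exact formula for perturbations of rank one is what makes the volume
affine in the size of a bump.\<close>

lemma row_det_rank_one:
  "row_det (\<lambda>i. f i + a i *\<^sub>R w) = row_det f + (\<Sum>i\<in>UNIV. a i * row_det (f(i := w)))"
proof -
  have "row_det (\<lambda>i. f i + (if i \<in> S then a i else 0) *\<^sub>R w)
     = row_det f + (\<Sum>i\<in>S. a i * row_det (f(i := w)))" if "finite S" for S
    using that
  proof (induction S)
    case (insert k S)
    let ?g = "\<lambda>S i. f i + (if i \<in> S then a i else 0) *\<^sub>R w"
    define g where "g = ?g S"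
    have *: "?g (insert k S) = g(k := g k + a k *\<^sub>R w)"
      using insert by (auto simp: fun_eq_iff g_def)
    have "row_det (?g (insert k S)) = row_det g + a k * row_det (g(k := w))"
      unfolding * using row_det_add[of g k "g k" "a k *\<^sub>R w"]
      by (simp only: row_det_scale fun_upd_triv)
    moreover have "row_det (g(k := w)) = row_det (f(k := w))"
      unfolding g_def by (rule row_det_rank_one_upd[OF insert(1,2)])
    ultimately show ?case using insert by (simp add: g_def fun_upd_def)
  qed simp
  from this[of UNIV] show ?thesis by simp
qed

text \<open>Exchanging \<open>l\<close> and \<open>m\<close> swaps two rows, so the sum equals its own negative. In the integration by parts
below, \<open>H l m\<close> is the second derivative \<open>\<partial>\<^sub>l \<partial>\<^sub>m X\<close>.\<close>

lemma row_det_antisymmetric_sum: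
  assumes "\<And>l m. H l m = H m l"
  shows "(\<Sum>l\<in>I. \<Sum>m\<in>I - {l}. row_det (f(l := w, m := H l m))) = 0"
proof -
  let ?T = "\<lambda>l m. if l = m then 0 else row_det (f(l := w, m := H l m))"
  have T: "?T m l = - ?T l m" for l m
    using row_det_swap[of m l f "H m l" w] assms[of l m] by (auto simp: fun_upd_twist)
  have "(\<Sum>l\<in>I. \<Sum>m\<in>I. ?T l m) = (\<Sum>m\<in>I. \<Sum>l\<in>I. - ?T m l)"
    by (subst sum.swap) (simp only: T[symmetric])
  then have "(\<Sum>l\<in>I. \<Sum>m\<in>I. ?T l m) = 0"
    by (simp only: sum_negf)
  moreover have "(\<Sum>m\<in>I - {l}. row_det (f(l := w, m := H l m))) = (\<Sum>m\<in>I. ?T l m)" for l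
    by (cases "finite I") (rule sum.mono_neutral_cong_left, auto)
  ultimately show ?thesis by simp
qed

lemma row_det_eq_sum:
  "row_det f = (\<Sum>p\<in>{p. p permutes UNIV}. of_int (sign p) * (\<Prod>i\<in>UNIV. f i $ p i))"
  by (simp add: row_det_def det_def)

text \<open>The product rule is applied to each product in the Leibniz formula, and the sum is then collected by
the row that has been differentiated.\<close>

lemma row_det_has_derivative:
  fixes f :: "'m::finite \<Rightarrow> 'a::real_normed_vector \<Rightarrow> real ^ 'm"
  assumes "\<And>i. (f i has_derivative f' i) (at x within S)"
  shows "((\<lambda>x. row_det (\<lambda>i. f i x)) has_derivative
           (\<lambda>h. \<Sum>k\<in>UNIV. row_det ((\<lambda>i. f i x)(k := f' k h)))) (at x within S)"
proof -
  have comp: "((\<lambda>x. f i x $ j) has_derivative (\<lambda>h. f' i h $ j)) (at x within S)" for i j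
    using bounded_linear.has_derivative[OF bounded_linear_vec_nth assms] .
  have "((\<lambda>x. row_det (\<lambda>i. f i x)) has_derivative
     (\<lambda>h. \<Sum>p\<in>{p. p permutes UNIV}. of_int (sign p) *
        (\<Sum>i\<in>UNIV. f' i h $ p i * (\<Prod>j\<in>UNIV - {i}. f j x $ p j)))) (at x within S)"
    unfolding row_det_eq_sum
    by (intro has_derivative_sum has_derivative_mult_right has_derivative_prod comp)
  moreover have "(\<Sum>p\<in>{p. p permutes UNIV}. of_int (sign p) *
        (\<Sum>i\<in>UNIV. f' i h $ p i * (\<Prod>j\<in>UNIV - {i}. f j x $ p j))) =
     (\<Sum>k\<in>UNIV. row_det ((\<lambda>i. f i x)(k := f' k h)))" for h
  proof -
    have "(\<Prod>i\<in>UNIV. ((\<lambda>i. f i x)(k := f' k h)) i $ p i) =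
        f' k h $ p k * (\<Prod>j\<in>UNIV - {k}. f j x $ p j)" for k p
      by (subst prod.remove[of _ k]) (auto intro!: prod.cong)
    then show ?thesis
      unfolding row_det_eq_sum by (subst sum.swap) (simp add: sum_distrib_left)
  qed
  ultimately show ?thesis by simp
qed

lemma Ck_on_row_det:
  fixes f :: "'m::finite \<Rightarrow> 'a::euclidean_space \<Rightarrow> real ^ 'm"
  assumes "open W" "\<And>i. Ck_on k W (f i)"
  shows "Ck_on k W (\<lambda>x. row_det (\<lambda>i. f i x))"
  unfolding row_det_eq_sum
  by (intro Ck_on_sum Ck_on_mult Ck_on_prod Ck_on_const assms(1)
      Ck_on_bounded_linear[OF bounded_linear_vec_nth assms(1)] assms(2))

definition block_matrix :: "real \<Rightarrow> real ^ 'n ^ 'n \<Rightarrow> real ^ 'n::finite option ^ 'n option" where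
  "block_matrix c J = (\<chi> a b. case a of
       None \<Rightarrow> (case b of None \<Rightarrow> c | Some m \<Rightarrow> 0)
     | Some l \<Rightarrow> (case b of None \<Rightarrow> 0 | Some m \<Rightarrow> J $ l $ m))"

lemma sum_option:
  "(\<Sum>b\<in>(UNIV :: 'n::finite option set). f b) = f None + (\<Sum>l\<in>UNIV. f (Some l))"
  by (simp add: UNIV_option_conv sum.reindex)

lemma prod_option:
  "(\<Prod>b\<in>(UNIV :: 'n::finite option set). f b) = f None * (\<Prod>l\<in>UNIV. f (Some l))"
  by (simp add: UNIV_option_conv prod.reindex)

lemma block_matrix_mult: "block_matrix c J ** block_matrix d K = block_matrix (c * d) (J ** K)"
  by (auto simp: block_matrix_def matrix_matrix_mult_def vec_eq_iff sum_option split: option.splits)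

text \<open>Both sides are multiplicative in \<open>J\<close>, so it is enough to compare them on the elementary matrices, on
diagonal matrices and on matrices with a zero row.\<close>

lemma det_block_matrix_1:
  fixes J :: "real ^ 'n::finite ^ 'n"
  shows "det (block_matrix 1 J) = det J"
proof (induction J rule: induct_matrix_elementary_alt)
  case (1 A B)
  then show ?case
    using block_matrix_mult[of 1 A 1 B] by (metis det_mul mult_1)
next
  case (2 A i)
  then have "row (Some i) (block_matrix 1 A) = 0"
    by (auto simp: row_def block_matrix_def vec_eq_iff split: option.splits)
  then show ?case using 2 det_zero_row(2) by metis
next
  case (3 A)
  then have "det (block_matrix 1 A) = (\<Prod>b\<in>UNIV. block_matrix 1 A $ b $ b)"
    by (intro det_diagonal) (auto simp: block_matrix_def split: option.splits)
  with 3 show ?case by (simp add: det_diagonal prod_option block_matrix_def)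
next
  case (4 m n)
  let ?S = "(\<chi> i j. mat 1 $ i $ Transposition.transpose m n j) :: real^'n^'n"
  let ?S' = "(\<chi> i j. mat 1 $ i $ Transposition.transpose (Some m) (Some n) j) :: real^'n option^'n option"
  have "block_matrix 1 ?S = ?S'"
    by (auto simp: vec_eq_iff block_matrix_def mat_def Transposition.transpose_def split: option.splits)
  moreover have "det ?S = - 1"
    using det_permute_columns[OF permutes_swap_id[of m UNIV n], of "mat 1 :: real^'n^'n"] 4
    by (simp add: sign_swap_id)
  moreover have "det ?S' = - 1"
    using det_permute_columns[OF permutes_swap_id[of "Some m" UNIV "Some n"], of "mat 1 :: real^'n option^'n option"] 4
    by (simp add: sign_swap_id)
  ultimately show ?case by simp
next
  case (5 m n)
  let ?E = "(\<chi> i j. of_bool (i = m \<and> j = n \<or> i = j)) :: real^'n^'n"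
  let ?E' = "(\<chi> i j. of_bool (i = Some m \<and> j = Some n \<or> i = j)) :: real^'n option^'n option"
  have "block_matrix 1 ?E = ?E'"
    by (auto simp: vec_eq_iff block_matrix_def split: option.splits)
  moreover have "det ?E = 1"
  proof -
    have "?E = (\<chi> k. if k = m then row m (mat 1 :: real^'n^'n) + 1 *s row n (mat 1) else row k (mat 1))"
      using 5 by (auto simp: vec_eq_iff row_def mat_def)
    then show ?thesis using det_row_operation[OF 5, of "mat 1 :: real^'n^'n" 1] by simp
  qed
  moreover have "det ?E' = 1"
  proof -
    have "?E' = (\<chi> k. if k = Some m then row (Some m) (mat 1 :: real^'n option^'n option)
        + 1 *s row (Some n) (mat 1) else row k (mat 1))"
      using 5 by (auto simp: vec_eq_iff row_def mat_def)
    then show ?thesis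
      using det_row_operation[of "Some m" "Some n" "mat 1 :: real^'n option^'n option" 1] 5 by simp
  qed
  ultimately show ?case by simp
qed

lemma det_block_matrix: "det (block_matrix c J) = c * det J"
proof -
  define f where "f = (\<lambda>i. block_matrix 1 J $ i)"
  have "(\<lambda>i. block_matrix c J $ i) = f(None := c *\<^sub>R f None)"
    by (auto simp: f_def fun_eq_iff vec_eq_iff block_matrix_def split: option.splits)
  then have "row_det (\<lambda>i. block_matrix c J $ i) = c * row_det f"
    by (simp only: row_det_scale fun_upd_triv)
  then show ?thesis by (simp add: f_def row_det_def det_block_matrix_1)
qed

section \<open>The generalised cross product\<close>

text \<open>The rows \<open>w, v\<^sub>1, \<dots>, v\<^sub>n\<close>; the index \<open>None\<close> of the first coordinate carries \<open>w\<close>.\<close>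

abbreviation frame :: "real ^ 'n option \<Rightarrow> ('n \<Rightarrow> real ^ 'n option) \<Rightarrow> 'n::finite option \<Rightarrow> real ^ 'n option" where
  "frame w v \<equiv> case_option w v"

text \<open>The vector with \<open>w \<bullet> cross v = det (w, v\<^sub>1, \<dots>, v\<^sub>n)\<close> for all \<open>w\<close>. For \<open>v\<^sub>l = \<partial>\<^sub>l X\<close> it is the unit normal times
the volume density.\<close>

definition cross :: "('n::finite \<Rightarrow> real ^ 'n option) \<Rightarrow> real ^ 'n option" where
  "cross v = (\<chi> a. row_det (frame (axis a 1) v))"

lemma frame_upd_None: "(frame w v)(None := y) = frame y v"
  by (auto simp: fun_eq_iff split: option.splits)

lemma frame_upd_Some: "(frame w v)(Some l := y) = frame w (v(l := y))"
  by (auto simp: fun_eq_iff split: option.splits)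

lemma det_frame_matrix: "det (frame_matrix w D) = row_det (frame w (\<lambda>l. column l D))"
proof -
  have "frame_matrix w D = transpose (\<chi> b. frame w (\<lambda>l. column l D) b)"
    by (auto simp: frame_matrix_def transpose_def column_def vec_eq_iff split: option.splits)
  then show ?thesis by (simp add: row_det_def)
qed

lemma row_det_frame_sum:
  "finite S \<Longrightarrow> row_det (frame (\<Sum>j\<in>S. g j) v) = (\<Sum>j\<in>S. row_det (frame (g j) v))"
  using row_det_sum[of S "frame 0 v" None g] by (simp only: frame_upd_None)

lemma row_det_frame_scale: "row_det (frame (c *\<^sub>R w) v) = c * row_det (frame w v)"
  using row_det_scale[of "frame 0 v" None c w] by (simp only: frame_upd_None)

lemma row_det_frame: "row_det (frame w v) = w \<bullet> cross v"
proof -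
  have "w = (\<Sum>a\<in>UNIV. w $ a *\<^sub>R axis a 1)"
    by (simp add: vec_eq_iff axis_def if_distrib cong: if_cong)
  then have "row_det (frame w v) = row_det (frame (\<Sum>a\<in>UNIV. w $ a *\<^sub>R axis a 1) v)"
    by (simp only:)
  also have "\<dots> = (\<Sum>a\<in>UNIV. w $ a * row_det (frame (axis a 1) v))"
    by (simp only: row_det_frame_sum[OF finite] row_det_frame_scale)
  also have "\<dots> = w \<bullet> cross v" by (simp add: inner_vec_def cross_def)
  finally show ?thesis .
qed

lemma det_frame_matrix_cross: "det (frame_matrix w D) = w \<bullet> cross (\<lambda>l. column l D)"
  by (simp add: det_frame_matrix row_det_frame)

lemma inner_cross_eq_0: "v l \<bullet> cross v = 0"
  unfolding row_det_frame[symmetric] by (rule row_det_identical[of None "Some l"]) auto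

text \<open>The rows of the new frame arise from the old ones by multiplication with the block matrix formed of
\<open>1\<close> and the transpose of \<open>J\<close>.\<close>

lemma row_det_frame_linear:
  "row_det (frame w (\<lambda>l. \<Sum>m\<in>UNIV. J $ m $ l *\<^sub>R v m)) = det J * row_det (frame w v)"
proof -
  have "(\<chi> b. frame w (\<lambda>l. \<Sum>m\<in>UNIV. J $ m $ l *\<^sub>R v m) b) =
    block_matrix 1 (transpose J) ** (\<chi> b. frame w v b)"
    by (auto simp: vec_eq_iff matrix_matrix_mult_def block_matrix_def sum_option transpose_def
        split: option.splits)
  then show ?thesis
    by (simp add: row_det_def det_mul det_block_matrix)
qed

lemma cross_linear: "cross (\<lambda>l. \<Sum>m\<in>UNIV. J $ m $ l *\<^sub>R v m) = det J *\<^sub>R cross v"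
  by (simp add: cross_def row_det_frame_linear vec_eq_iff)

lemma column_matrix_mult:
  "column l (D ** J) = (\<Sum>m\<in>UNIV. J $ m $ l *\<^sub>R column m (D :: real ^ 'n ^ 'm))"
  by (simp add: column_def matrix_matrix_mult_def vec_eq_iff mult.commute)

lemma cross_columns_mult:
  "cross (\<lambda>l. column l (D ** J)) = det J *\<^sub>R cross (\<lambda>l. column l D)"
  by (simp add: column_matrix_mult cross_linear)

lemma cross_scaleR: "cross (\<lambda>l. c *\<^sub>R v l) = c ^ CARD('n) *\<^sub>R cross (v :: 'n::finite \<Rightarrow> _)"
proof -
  have "(\<Sum>m\<in>UNIV. (\<chi> i j. if i = j then c else 0) $ m $ l *\<^sub>R v m) = c *\<^sub>R v l" for l
    by (simp add: if_distrib[of "\<lambda>x. x *\<^sub>R _"] cong: if_cong)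
  moreover have "det ((\<chi> i j. if i = j then c else 0) :: real^'n^'n) = c ^ CARD('n)"
    by (subst det_diagonal) auto
  ultimately show ?thesis using cross_linear[of "\<chi> i j. if i = j then c else 0" v] by simp
qed

lemma frame_matrix_mult_vec:
  "frame_matrix w D *v y = y $ None *\<^sub>R w + D *v (\<chi> l. y $ Some l)"
  by (simp add: frame_matrix_def matrix_vector_mult_def vec_eq_iff sum_option mult.commute)

text \<open>Let \<open>C\<close> be the cross product of the columns of \<open>D\<close>. As \<open>C\<close> is orthogonal to these columns, the Gram
matrix of the frame \<open>(C, D)\<close> is block diagonal with determinant \<open>(C \<bullet> C) det (D\<^sup>T D)\<close>; this
determinant is also the square of \<open>det (C, D) = C \<bullet> C\<close>.\<close>

lemma det_gram:
  fixes D :: "real ^ 'n::finite ^ 'n option"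
  assumes "cross (\<lambda>l. column l D) \<noteq> 0"
  shows "det (transpose D ** D) = cross (\<lambda>l. column l D) \<bullet> cross (\<lambda>l. column l D)"
proof -
  let ?C = "cross (\<lambda>l. column l D)"
  let ?F = "frame_matrix ?C D"
  have orth: "(\<Sum>a\<in>UNIV. D $ a $ l * ?C $ a) = 0" for l
    using inner_cross_eq_0[of "\<lambda>l. column l D" l] by (simp add: inner_vec_def column_def)
  then have orth': "(\<Sum>a\<in>UNIV. ?C $ a * D $ a $ l) = 0" for l
    by (simp only: mult.commute)
  have "(transpose ?F ** ?F) $ a $ b = block_matrix (?C \<bullet> ?C) (transpose D ** D) $ a $ b" for a b
    by (cases a; cases b) (simp_all add: matrix_matrix_mult_def transpose_def frame_matrix_def
        block_matrix_def inner_vec_def orth orth')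
  then have "transpose ?F ** ?F = block_matrix (?C \<bullet> ?C) (transpose D ** D)"
    by (simp add: vec_eq_iff)
  then have "det (transpose ?F ** ?F) = det (block_matrix (?C \<bullet> ?C) (transpose D ** D))"
    by simp
  then have "det ?F * det ?F = (?C \<bullet> ?C) * det (transpose D ** D)"
    by (simp only: det_block_matrix det_mul det_transpose)
  then show ?thesis using assms by (simp add: det_frame_matrix_cross)
qed

lemma det_nz_iff_inj_mult_vec: "det A \<noteq> 0 \<longleftrightarrow> inj ((*v) (A :: real ^ 'm::finite ^ 'm))"
  using det_nz_iff_inj[OF matrix_vector_mul_linear[of A]] by simp

text \<open>If \<open>C\<close> is not zero, then \<open>(C, D)\<close> is invertible and the columns of \<open>D\<close> are independent. Conversely, for an
injective \<open>D\<close>, a nonzero vector \<open>w\<close> orthogonal to the range completes the columns to a basis, and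
\<open>w \<bullet> C = det (w, D)\<close> is not zero.\<close>

lemma inj_iff_cross_nz:
  fixes D :: "real ^ 'n::finite ^ 'n option"
  shows "inj ((*v) D) \<longleftrightarrow> cross (\<lambda>l. column l D) \<noteq> 0"
proof
  let ?C = "cross (\<lambda>l. column l D)"
  assume "?C \<noteq> 0"
  then have "det (frame_matrix ?C D) \<noteq> 0" by (simp add: det_frame_matrix_cross)
  then have inj: "inj ((*v) (frame_matrix ?C D))" by (simp only: det_nz_iff_inj_mult_vec)
  show "inj ((*v) D)"
  proof (rule injI)
    fix x y assume eq: "D *v x = D *v y"
    let ?e = "\<lambda>x::real^'n. (\<chi> b. case b of None \<Rightarrow> 0 | Some l \<Rightarrow> x $ l) :: real^'n option"
    have "frame_matrix ?C D *v ?e x = frame_matrix ?C D *v ?e y"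
      using eq by (simp add: frame_matrix_mult_vec)
    then have "?e x = ?e y" using inj injD by metis
    then have "?e x $ Some l = ?e y $ Some l" for l by (simp only:)
    then show "x = y" by (simp add: vec_eq_iff)
  qed
next
  let ?C = "cross (\<lambda>l. column l D)"
  assume inj: "inj ((*v) D)"
  have "dim (range ((*v) D)) \<le> DIM(real^'n)"
    by (metis dim_image_le dim_UNIV matrix_vector_mul_linear)
  then have "dim (range ((*v) D)) < DIM(real^'n option)" by simp
  then obtain w where w: "w \<noteq> 0" "\<And>y. y \<in> span (range ((*v) D)) \<Longrightarrow> orthogonal w y"
    using orthogonal_to_subspace_exists[of "range ((*v) D)"] by metis
  then have w2: "w \<bullet> (D *v x) = 0" for x
    by (simp add: orthogonal_def span_base)
  have "inj ((*v) (frame_matrix w D))"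
  proof (subst linear_injective_0[OF matrix_vector_mul_linear], intro allI impI)
    fix y assume y: "frame_matrix w D *v y = 0"
    then have *: "y $ None *\<^sub>R w + D *v (\<chi> l. y $ Some l) = 0" by (simp add: frame_matrix_mult_vec)
    then have "w \<bullet> (y $ None *\<^sub>R w + D *v (\<chi> l. y $ Some l)) = 0" by simp
    then have y0: "y $ None = 0" using w w2 by (simp add: inner_add_right)
    then have "D *v (\<chi> l. y $ Some l) = D *v 0" using * by simp
    then have "(\<chi> l. y $ Some l) = 0" using inj injD by metis
    then have "y $ Some l = 0" for l by (simp add: vec_eq_iff)
    then show "y = 0" using y0 by (metis (mono_tags) option.exhaust vec_eq_iff zero_index)
  qed
  then have "det (frame_matrix w D) \<noteq> 0" by (simp only: det_nz_iff_inj_mult_vec)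
  then show "?C \<noteq> 0" by (auto simp: det_frame_matrix_cross)
qed

text \<open>The frame \<open>(C, D)\<close> spans the whole space and \<open>C\<close> is orthogonal to the range of \<open>D\<close>, so the coefficient of \<open>C\<close>
in a vector orthogonal to \<open>C\<close> is zero.\<close>

lemma orthogonal_cross_imp_range:
  fixes D :: "real ^ 'n::finite ^ 'n option"
  assumes "cross (\<lambda>l. column l D) \<noteq> 0" "z \<bullet> cross (\<lambda>l. column l D) = 0"
  obtains y where "z = D *v y"
proof -
  let ?C = "cross (\<lambda>l. column l D)"
  have "det (frame_matrix ?C D) \<noteq> 0" using assms by (simp add: det_frame_matrix_cross)
  then have "surj ((*v) (frame_matrix ?C D))"
    unfolding det_nz_iff_inj_mult_vec
    by (rule linear_injective_imp_surjective[OF matrix_vector_mul_linear]) simp_all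
  then obtain y where y: "z = frame_matrix ?C D *v y" by (metis surjD)
  have D: "(D *v x) \<bullet> ?C = 0" for x
  proof -
    have "D *v x = (\<Sum>l\<in>UNIV. x $ l *\<^sub>R column l D)"
      by (simp add: matrix_mult_sum scalar_mult_eq_scaleR)
    then show ?thesis
      by (simp add: inner_sum_left inner_cross_eq_0[of "\<lambda>l. column l D"])
  qed
  have "y $ None = 0"
    using assms unfolding y frame_matrix_mult_vec by (simp add: inner_add_left D)
  then show thesis using that y by (simp add: frame_matrix_mult_vec)
qed

text \<open>The part of \<open>w\<close> orthogonal to \<open>C\<close> lies in the range of \<open>D\<close> and is orthogonal to it, so it vanishes. The
sign of the remaining multiple of \<open>C\<close> is that of \<open>w \<bullet> C = det (w, D)\<close>.\<close>

lemma unit_normal_unique: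
  fixes D :: "real ^ 'n::finite ^ 'n option"
  assumes "norm w = 1" "\<And>l. w \<bullet> column l D = 0" "det (frame_matrix w D) > 0"
  shows "w = cross (\<lambda>l. column l D) /\<^sub>R norm (cross (\<lambda>l. column l D))"
proof -
  let ?C = "cross (\<lambda>l. column l D)"
  have pos: "w \<bullet> ?C > 0" using assms(3) by (simp add: det_frame_matrix_cross)
  then have C: "?C \<noteq> 0" by auto
  define z where "z = w - (w \<bullet> ?C / (?C \<bullet> ?C)) *\<^sub>R ?C"
  have zC: "z \<bullet> ?C = 0" using C by (simp add: z_def inner_diff_left)
  obtain y where y: "z = D *v y" using orthogonal_cross_imp_range[OF C zC] .
  have "z \<bullet> column l D = 0" for l
    using assms(2) inner_cross_eq_0[of "\<lambda>l. column l D" l]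
    by (simp add: z_def inner_diff_left inner_commute[of "cross _" "column _ _"])
  then have "z \<bullet> (D *v y) = 0"
    by (simp add: matrix_mult_sum scalar_mult_eq_scaleR inner_sum_right)
  then have "z = 0" using y by simp
  then have w: "w = (w \<bullet> ?C / (?C \<bullet> ?C)) *\<^sub>R ?C" by (simp add: z_def)
  then have "norm w = (w \<bullet> ?C / (?C \<bullet> ?C)) * norm ?C"
    using pos by (metis abs_of_pos divide_pos_pos inner_gt_zero_iff C norm_scaleR)
  then have "w \<bullet> ?C / (?C \<bullet> ?C) = inverse (norm ?C)" using assms(1) C pos by (simp add: field_simps)
  then show ?thesis using w by simp
qed

lemma unit_normal_works:
  fixes D :: "real ^ 'n::finite ^ 'n option"
  assumes "cross (\<lambda>l. column l D) \<noteq> 0"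
  defines "w \<equiv> cross (\<lambda>l. column l D) /\<^sub>R norm (cross (\<lambda>l. column l D))"
  shows "norm w = 1" "w \<bullet> column l D = 0" "det (frame_matrix w D) > 0"
  using assms(1) inner_cross_eq_0[of "\<lambda>l. column l D" l]
  by (auto simp: w_def det_frame_matrix_cross inner_commute)

text \<open>In the \<open>l\<close>-th determinant, the components of \<open>\<eta> l\<close> along \<open>v m\<close> with \<open>m \<noteq> l\<close> repeat a row. The component
along \<open>v l\<close> has the coefficient \<open>L\<^sub>l\<^sub>l\<close>, and exchanging the first row with the row \<open>l\<close> costs a sign.\<close>

lemma sum_row_det_trace:
  assumes "\<And>l. \<eta> l = (\<Sum>m\<in>UNIV. L $ m $ l *\<^sub>R v m)"
  shows "(\<Sum>l\<in>UNIV. row_det (frame (\<eta> l) (v(l := w)))) = - trace L * row_det (frame w v)"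
proof -
  have "row_det (frame (\<eta> l) (v(l := w))) = - (L $ l $ l * row_det (frame w v))" for l
  proof -
    have "row_det (frame (\<eta> l) (v(l := w))) = (\<Sum>m\<in>UNIV. L $ m $ l * row_det (frame (v m) (v(l := w))))"
      unfolding assms by (simp only: row_det_frame_sum[OF finite] row_det_frame_scale)
    also have "\<dots> = L $ l $ l * row_det (frame (v l) (v(l := w)))"
    proof (subst sum.remove[of _ l])
      have "row_det (frame (v m) (v(l := w))) = 0" if "m \<noteq> l" for m
        by (rule row_det_identical[of None "Some m"]) (use that in auto)
      then show "L $ l $ l * row_det (frame (v l) (v(l := w))) +
        (\<Sum>m\<in>UNIV - {l}. L $ m $ l * row_det (frame (v m) (v(l := w)))) =
        L $ l $ l * row_det (frame (v l) (v(l := w)))" by simp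
    qed auto
    also have "row_det (frame (v l) (v(l := w))) = - row_det (frame w v)"
    proof -
      have "frame (v l) (v(l := w)) = (frame 0 v)(None := v l, Some l := w)"
        "frame w v = (frame 0 v)(None := w, Some l := v l)"
        by (simp_all only: frame_upd_None frame_upd_Some fun_upd_triv)
      then show ?thesis
        by (simp only:) (rule row_det_swap, simp)
    qed
    finally show ?thesis by simp
  qed
  then show ?thesis by (simp add: trace_def sum_negf sum_distrib_right)
qed

section \<open>Second derivatives and integration by parts\<close>

text \<open>The derivative of \<open>f\<close> at \<open>x\<close> in the direction \<open>v\<close>; with \<open>v = axis l 1\<close> it is the partial derivative
\<open>\<partial>\<^sub>l f\<close>.\<close>

abbreviation fder :: "'a::real_normed_vector \<Rightarrow> ('a \<Rightarrow> 'b::real_normed_vector) \<Rightarrow> 'a \<Rightarrow> 'b" where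
  "fder v f x \<equiv> frechet_derivative f (at x) v"

lemma has_real_derivative_along_line:
  assumes "(f has_derivative f') (at (x + s *\<^sub>R u))"
  shows "((\<lambda>s. f (x + s *\<^sub>R u)) has_real_derivative f' u) (at s)"
proof -
  have "((\<lambda>s. x + s *\<^sub>R u) has_derivative (\<lambda>h. h *\<^sub>R u)) (at s)"
    by (auto intro!: derivative_eq_intros)
  then have "((\<lambda>s. f (x + s *\<^sub>R u)) has_derivative (\<lambda>h. f' (h *\<^sub>R u))) (at s)"
    using has_derivative_compose[of "\<lambda>s. x + s *\<^sub>R u" _ s UNIV f f'] assms by blast
  moreover have "f' (h *\<^sub>R u) = f' u * h" for h
    using linear_scale[OF has_derivative_linear[OF assms]] by simp
  ultimately show ?thesis by (simp add: has_field_derivative_def)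
qed

text \<open>The mean value theorem is applied twice: to the difference of \<open>f\<close> in the direction \<open>v\<close> as a function on
a segment in the direction \<open>u\<close>, and to the derivative of \<open>f\<close> along \<open>u\<close> on a segment in the direction \<open>v\<close>.\<close>

lemma second_difference:
  fixes f :: "'a::euclidean_space \<Rightarrow> real"
  assumes f: "Ck_on 2 W f" and W: "ball x r \<subseteq> W" and t: "0 < t" "t * (norm u + norm v) < r"
  obtains p where "dist x p < r"
    "f (x + t *\<^sub>R u + t *\<^sub>R v) - f (x + t *\<^sub>R u) - f (x + t *\<^sub>R v) + f x = t\<^sup>2 * fder v (fder u f) p"
proof -
  have f2: "Ck_on (Suc (Suc 0)) W f" using f by (simp add: numeral_2_eq_2)
  have in_ball: "dist x (x + a *\<^sub>R u + b *\<^sub>R v) < r" if "0 \<le> a" "a \<le> t" "0 \<le> b" "b \<le> t" for a b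
  proof -
    have "norm (a *\<^sub>R u + b *\<^sub>R v) \<le> a * norm u + b * norm v"
      using norm_triangle_ineq[of "a *\<^sub>R u" "b *\<^sub>R v"] that by simp
    also have "\<dots> \<le> t * norm u + t * norm v"
      using that by (intro add_mono mult_right_mono) auto
    also have "\<dots> < r" using t(2) by (simp add: algebra_simps)
    finally have "norm (- (a *\<^sub>R u + b *\<^sub>R v)) < r" by (simp only: norm_minus_cancel)
    moreover have "x - (x + a *\<^sub>R u + b *\<^sub>R v) = - (a *\<^sub>R u + b *\<^sub>R v)" by simp
    ultimately show ?thesis by (simp only: dist_norm)
  qed
  have inW: "x + a *\<^sub>R u + b *\<^sub>R v \<in> W" if "0 \<le> a" "a \<le> t" "0 \<le> b" "b \<le> t" for a b
    using in_ball[OF that] W by auto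
  have D1: "(f has_derivative (\<lambda>h. fder h f p)) (at p)" if "p \<in> W" for p
    using Ck_on_SucD_has_derivative[OF f2 that] by (simp only:)
  have D2: "(fder u f has_derivative (\<lambda>h. fder h (fder u f) p)) (at p)" if "p \<in> W" for p
    using Ck_on_SucD_has_derivative[OF Ck_on_SucD_frechet[OF f2] that] by (simp only:)
  let ?h = "\<lambda>s. f (x + t *\<^sub>R v + s *\<^sub>R u) - f (x + s *\<^sub>R u)"
  have "\<exists>s>0. s < t \<and> ?h t - ?h 0 = (t - 0) * (fder u f (x + t *\<^sub>R v + s *\<^sub>R u) - fder u f (x + s *\<^sub>R u))"
  proof (rule MVT2[OF t(1)])
    fix s assume "0 \<le> s" "s \<le> t"
    then have "x + t *\<^sub>R v + s *\<^sub>R u \<in> W" "x + s *\<^sub>R u \<in> W"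
      using inW[of s t] inW[of s 0] t by (simp_all add: algebra_simps)
    then show "(?h has_real_derivative fder u f (x + t *\<^sub>R v + s *\<^sub>R u) - fder u f (x + s *\<^sub>R u)) (at s)"
      by (intro DERIV_diff has_real_derivative_along_line[OF D1])
  qed
  then obtain s where s: "0 < s" "s < t"
    "?h t - ?h 0 = t * (fder u f (x + t *\<^sub>R v + s *\<^sub>R u) - fder u f (x + s *\<^sub>R u))" by auto
  let ?k = "\<lambda>\<tau>. fder u f (x + s *\<^sub>R u + \<tau> *\<^sub>R v)"
  have "\<exists>\<tau>>0. \<tau> < t \<and> ?k t - ?k 0 = (t - 0) * fder v (fder u f) (x + s *\<^sub>R u + \<tau> *\<^sub>R v)"
  proof (rule MVT2[OF t(1)])
    fix \<tau> assume "0 \<le> \<tau>" "\<tau> \<le> t"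
    then have "x + s *\<^sub>R u + \<tau> *\<^sub>R v \<in> W" using inW[of s \<tau>] s by simp
    then show "(?k has_real_derivative fder v (fder u f) (x + s *\<^sub>R u + \<tau> *\<^sub>R v)) (at \<tau>)"
      by (intro has_real_derivative_along_line[OF D2])
  qed
  then obtain \<tau> where \<tau>: "0 < \<tau>" "\<tau> < t"
    "?k t - ?k 0 = t * fder v (fder u f) (x + s *\<^sub>R u + \<tau> *\<^sub>R v)" by auto
  show thesis
  proof (rule that)
    show "dist x (x + s *\<^sub>R u + \<tau> *\<^sub>R v) < r" using in_ball[of s \<tau>] s \<tau> by simp
    have eqs: "x + t *\<^sub>R v + s *\<^sub>R u = x + s *\<^sub>R u + t *\<^sub>R v" "x + t *\<^sub>R v + t *\<^sub>R u = x + t *\<^sub>R u + t *\<^sub>R v"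
      by (simp_all only: add.assoc add.commute[of "t *\<^sub>R v"])
    show "f (x + t *\<^sub>R u + t *\<^sub>R v) - f (x + t *\<^sub>R u) - f (x + t *\<^sub>R v) + f x
        = t\<^sup>2 * fder v (fder u f) (x + s *\<^sub>R u + \<tau> *\<^sub>R v)"
      using s(3) \<tau>(3) unfolding eqs scaleR_zero_left add_0_right power2_eq_square
      by (simp only: mult.assoc)
  qed
qed

text \<open>The second difference does not change when \<open>u\<close> and \<open>v\<close> are exchanged, and after division by \<open>t\<^sup>2\<close> it is
the value of either mixed derivative at some point near \<open>x\<close>. By continuity the two mixed derivatives
at \<open>x\<close> differ by less than any positive number.\<close>

lemma symmetric_second_derivative_real:
  fixes f :: "'a::euclidean_space \<Rightarrow> real"
  assumes f: "Ck_on 2 W f" and W: "open W" "x \<in> W"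
  shows "fder v (fder u f) x = fder u (fder v f) x"
proof (rule ccontr)
  assume ne: "\<not> ?thesis"
  define e where "e = \<bar>fder v (fder u f) x - fder u (fder v f) x\<bar> / 2"
  have e: "e > 0" using ne by (simp add: e_def)
  have f2: "Ck_on (Suc (Suc 0)) W f" using f by (simp add: numeral_2_eq_2)
  have cont: "isCont (fder v (fder u f)) x" for u v
    using Ck_on_imp_continuous_on[OF Ck_on_SucD_frechet[OF Ck_on_SucD_frechet[OF f2]]] W
    by (simp add: continuous_on_eq_continuous_at)
  obtain r0 where r0: "r0 > 0" "ball x r0 \<subseteq> W" using W open_contains_ball by blast
  from cont[of u v] e obtain r1 where r1: "r1 > 0"
    "\<forall>p. dist p x < r1 \<longrightarrow> dist (fder v (fder u f) p) (fder v (fder u f) x) < e"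
    unfolding continuous_at_eps_delta by (elim allE[of _ e] impE exE conjE)
  from cont[of v u] e obtain r2 where r2: "r2 > 0"
    "\<forall>p. dist p x < r2 \<longrightarrow> dist (fder u (fder v f) p) (fder u (fder v f) x) < e"
    unfolding continuous_at_eps_delta by (elim allE[of _ e] impE exE conjE)
  define r where "r = min r0 (min r1 r2)"
  have r: "r > 0" "ball x r \<subseteq> W" using r0 r1 r2 by (auto simp: r_def)
  \<comment> \<open>the summand \<open>1\<close> keeps the denominator positive when \<open>u\<close> and \<open>v\<close> are zero\<close>
  define t where "t = r / (2 * (norm u + norm v + 1))"
  have pos: "norm u + norm v + 1 > 0" by (smt (verit) norm_ge_zero)
  have t: "t > 0" using r pos by (simp add: t_def)
  have "t * (norm u + norm v) < t * (2 * (norm u + norm v + 1))"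
    using t pos by (intro mult_strict_left_mono) (smt (verit) norm_ge_zero, simp)
  also have "\<dots> = r" using pos by (simp add: t_def)
  finally have tr: "t * (norm u + norm v) < r" .
  obtain p where p: "dist x p < r"
    "f (x + t *\<^sub>R u + t *\<^sub>R v) - f (x + t *\<^sub>R u) - f (x + t *\<^sub>R v) + f x = t\<^sup>2 * fder v (fder u f) p"
    using second_difference[OF f r(2) t tr] .
  have tr': "t * (norm v + norm u) < r" using tr by (simp add: add.commute)
  obtain q where q: "dist x q < r"
    "f (x + t *\<^sub>R v + t *\<^sub>R u) - f (x + t *\<^sub>R v) - f (x + t *\<^sub>R u) + f x = t\<^sup>2 * fder u (fder v f) q"
    using second_difference[OF f r(2) t tr'] .
  have "t\<^sup>2 * fder v (fder u f) p = t\<^sup>2 * fder u (fder v f) q"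
    using p(2) q(2) by (simp add: algebra_simps)
  then have "fder v (fder u f) p = fder u (fder v f) q" using t by simp
  moreover have "dist (fder v (fder u f) p) (fder v (fder u f) x) < e"
    using r1(2)[rule_format, of p] p(1) by (simp add: r_def dist_commute)
  moreover have "dist (fder u (fder v f) q) (fder u (fder v f) x) < e"
    using r2(2)[rule_format, of q] q(1) by (simp add: r_def dist_commute)
  ultimately show False unfolding e_def dist_real_def by (smt (verit) field_sum_of_halves)
qed

lemma fder_bounded_linear:
  assumes "bounded_linear h" "f differentiable (at x)"
  shows "fder v (\<lambda>x. h (f x)) x = h (fder v f x)"
  using bounded_linear.has_derivative[OF assms(1) assms(2)[unfolded frechet_derivative_works]]
    frechet_derivative_at by metis

lemma symmetric_second_derivative:
  fixes f :: "'a::euclidean_space \<Rightarrow> 'b::euclidean_space"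
  assumes f: "Ck_on 2 W f" and W: "open W" "x \<in> W"
  shows "fder v (fder u f) x = fder u (fder v f) x"
proof (rule euclidean_eqI)
  fix b :: 'b assume "b \<in> Basis"
  have f2: "Ck_on (Suc (Suc 0)) W f" using f by (simp add: numeral_2_eq_2)
  have fb: "Ck_on 2 W (\<lambda>x. f x \<bullet> b)" by (rule Ck_on_bounded_linear[OF bounded_linear_inner_left W(1) f])
  have *: "fder v (fder u f) x \<bullet> b = fder v (fder u (\<lambda>x. f x \<bullet> b)) x" for u v
  proof -
    have "fder u (\<lambda>x. f x \<bullet> b) y = fder u f y \<bullet> b" if "y \<in> W" for y
      by (rule fder_bounded_linear[OF bounded_linear_inner_left]) (use f2 that in auto)
    moreover have "fder u f differentiable (at x)" using f2 W by auto
    ultimately have "fder v (fder u (\<lambda>x. f x \<bullet> b)) x = fder v (\<lambda>x. fder u f x \<bullet> b) x"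
      using frechet_derivative_transform_within_open[of "\<lambda>x. fder u f x \<bullet> b" x W "fder u (\<lambda>x. f x \<bullet> b)"] W
        differentiableI[OF bounded_linear.has_derivative[OF bounded_linear_inner_left[of b]
            \<open>fder u f differentiable (at x)\<close>[unfolded frechet_derivative_works]]]
      by simp
    then show ?thesis
      using fder_bounded_linear[OF bounded_linear_inner_left \<open>fder u f differentiable (at x)\<close>, where v = v] by simp
  qed
  show "fder v (fder u f) x \<bullet> b = fder u (fder v f) x \<bullet> b"
    unfolding * by (rule symmetric_second_derivative_real[OF fb W])
qed

text \<open>The integral of the translate \<open>h (x + t v)\<close> over a large box is the same for all small \<open>t\<close>.
Differentiating under the integral sign at \<open>t = 0\<close> gives the integral of the derivative.\<close>

lemma has_integral_derivative_compact_support: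
  fixes h :: "'e::euclidean_space \<Rightarrow> real"
  assumes h: "Ck_on 1 UNIV h" and supp: "\<And>x. x \<notin> cbox a b \<Longrightarrow> h x = 0"
  shows "(fder v h has_integral 0) (cbox a b)"
proof -
  have h1: "Ck_on (Suc 0) UNIV h" using h by simp
  have D: "(h has_derivative (\<lambda>w. fder w h x)) (at x)" for x
    using Ck_on_SucD_has_derivative[OF h1 UNIV_I] by (simp only:)
  have c0: "continuous_on UNIV h" and c1: "continuous_on UNIV (fder v h)"
    using Ck_on_imp_continuous_on[OF h] Ck_on_imp_continuous_on[OF Ck_on_SucD_frechet[OF h1]] by auto
  obtain R where R: "\<And>x. x \<in> cbox a b \<Longrightarrow> norm x \<le> R"
    using bounded_cbox bounded_iff by metis
  have "bounded (cball (0::'e) (R + norm v))" by simp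
  then obtain c where c: "cball (0::'e) (R + norm v) \<subseteq> cbox (- c) c"
    using bounded_subset_cbox_symmetric by blast
  define d where "d = - c"
  have sub: "(\<lambda>x. x - t *\<^sub>R v) ` cbox a b \<subseteq> cbox d c" if "t \<in> {-1..1}" for t
  proof
    fix y assume "y \<in> (\<lambda>x. x - t *\<^sub>R v) ` cbox a b"
    then obtain x where x: "x \<in> cbox a b" "y = x - t *\<^sub>R v" by auto
    have "\<bar>t\<bar> * norm v \<le> 1 * norm v" using that by (intro mult_right_mono) auto
    then have "norm y \<le> R + norm v"
      using R[OF x(1)] norm_triangle_ineq4[of x "t *\<^sub>R v"] x(2) by simp
    then show "y \<in> cbox d c" using c by (auto simp: d_def)
  qed
  have const: "integral (cbox d c) (\<lambda>x. h (x + t *\<^sub>R v)) = integral (cbox a b) h" if "t \<in> {-1..1}" for t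
  proof -
    have "(h has_integral integral (cbox a b) h) (cbox a b)"
      by (intro integrable_integral integrable_continuous continuous_on_subset[OF c0]) auto
    from has_integral_affinity[OF this, of 1 "t *\<^sub>R v"]
    have "((\<lambda>x. h (x + t *\<^sub>R v)) has_integral integral (cbox a b) h) ((\<lambda>x. x - t *\<^sub>R v) ` cbox a b)"
      by simp
    then have "((\<lambda>x. h (x + t *\<^sub>R v)) has_integral integral (cbox a b) h) (cbox d c)"
    proof (rule has_integral_on_superset[OF _ _ sub[OF that]])
      fix x assume "x \<notin> (\<lambda>x. x - t *\<^sub>R v) ` cbox a b"
      then have "x + t *\<^sub>R v \<notin> cbox a b" by (metis add_diff_cancel_right' image_eqI)
      then show "h (x + t *\<^sub>R v) = 0" by (rule supp)
    qed
    then show ?thesis by (rule integral_unique)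
  qed
  have "((\<lambda>t. integral (cbox d c) (\<lambda>x. h (x + t *\<^sub>R v))) has_real_derivative
      integral (cbox d c) (\<lambda>x. fder v h (x + 0 *\<^sub>R v))) (at 0 within {-1..1})"
  proof (rule leibniz_rule_field_derivative)
    show "((\<lambda>t. h (x + t *\<^sub>R v)) has_real_derivative fder v h (x + t *\<^sub>R v)) (at t within {-1..1})" for x t
      by (rule has_field_derivative_at_within, rule has_real_derivative_along_line[OF D])
    show "(\<lambda>x. h (x + t *\<^sub>R v)) integrable_on cbox d c" for t
      by (intro integrable_continuous continuous_on_compose2[OF c0] continuous_intros) auto
    show "continuous_on ({-1..1} \<times> cbox d c) (\<lambda>(t, x). fder v h (x + t *\<^sub>R v))"
      unfolding split_beta
      by (intro continuous_on_compose2[OF c1] continuous_intros) auto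
  qed auto
  then have "((\<lambda>t::real. integral (cbox a b) h) has_real_derivative
      integral (cbox d c) (fder v h)) (at 0 within {-1..1})"
    using has_field_derivative_transform_within[OF _ zero_less_one, of _ _ 0 "{-1..1}" "\<lambda>t. integral (cbox a b) h"] const
    by simp
  then have "((\<lambda>t::real. integral (cbox a b) h) has_real_derivative
      integral (cbox d c) (fder v h)) (at 0)"
    by (subst (asm) at_within_interior) auto
  then have "integral (cbox d c) (fder v h) = 0"
    using DERIV_unique DERIV_const by blast
  moreover have "fder v h integrable_on cbox d c"
    by (intro integrable_continuous continuous_on_subset[OF c1]) auto
  ultimately have "(fder v h has_integral 0) (cbox d c)"
    using integrable_integral by metis
  moreover have "fder v h x = 0" if "x \<notin> cbox a b" for x
  proof -
    have "open (- cbox a b)" by (simp add: closed_cbox open_Compl)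
    then have "frechet_derivative (\<lambda>_. 0) (at x) = frechet_derivative h (at x)"
      using that supp by (intro frechet_derivative_transform_within_open[of _ _ "- cbox a b"]) auto
    then show ?thesis by (metis frechet_derivative_const)
  qed
  ultimately have "((\<lambda>x. if x \<in> cbox a b then fder v h x else 0) has_integral 0) (cbox d c)"
    by (smt (verit) has_integral_cong)
  moreover have "cbox a b \<subseteq> cbox d c" using sub[of 0] by simp
  ultimately show ?thesis using has_integral_restrict by blast
qed

text \<open>The product \<open>\<phi> g\<close>, extended by zero, is continuously differentiable on the whole space, because it
vanishes near every point outside the box.\<close>

lemma has_integral_by_parts:
  fixes \<phi> g :: "'e::euclidean_space \<Rightarrow> real"
  assumes \<phi>: "Ck_on 1 UNIV \<phi>" "\<And>x. x \<notin> cbox a b \<Longrightarrow> \<phi> x = 0"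
    and g: "Ck_on 1 W g" and W: "open W" "cbox a b \<subseteq> W"
  shows "((\<lambda>x. fder v \<phi> x * g x + \<phi> x * fder v g x) has_integral 0) (cbox a b)"
proof -
  define h where "h x = (if x \<in> W then \<phi> x * g x else 0)" for x
  have g1: "Ck_on (Suc 0) W g" and \<phi>1: "Ck_on (Suc 0) UNIV \<phi>" using g \<phi> by auto
  have hz: "h x = 0" if "x \<notin> cbox a b" for x using \<phi>(2)[OF that] by (simp add: h_def)
  have "Ck_on 1 UNIV h"
  proof (rule Ck_on_locally)
    fix x :: 'e
    show "\<exists>V. open V \<and> x \<in> V \<and> Ck_on 1 V h"
    proof (cases "x \<in> cbox a b")
      case True
      have "Ck_on 1 W (\<lambda>x. \<phi> x * g x)"
        by (rule Ck_on_mult[OF W(1) Ck_on_subset[OF \<phi>(1)] g]) auto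
      then have "Ck_on 1 W h"
        by (subst Ck_on_cong[OF W(1), of h "\<lambda>x. \<phi> x * g x"]) (auto simp: h_def)
      then show ?thesis using True W by blast
    next
      case False
      have op: "open (- cbox a b)" by (simp add: closed_cbox open_Compl)
      have "Ck_on 1 (- cbox a b) h"
        by (subst Ck_on_cong[OF op, of h "\<lambda>x. 0"]) (auto simp: hz Ck_on_const[OF op] simp del: One_nat_def)
      then show ?thesis using False op by blast
    qed
  qed
  then have "(fder v h has_integral 0) (cbox a b)"
    using hz by (rule has_integral_derivative_compact_support)
  moreover have "fder v h x = fder v \<phi> x * g x + \<phi> x * fder v g x" if "x \<in> cbox a b" for x
  proof -
    have x: "x \<in> W" using that W by auto
    have "((\<lambda>x. \<phi> x * g x) has_derivative (\<lambda>v. \<phi> x * fder v g x + fder v \<phi> x * g x)) (at x)"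
      using has_derivative_mult[OF Ck_on_SucD_has_derivative[OF \<phi>1 UNIV_I] Ck_on_SucD_has_derivative[OF g1 x]] .
    then have "(h has_derivative (\<lambda>v. \<phi> x * fder v g x + fder v \<phi> x * g x)) (at x)"
      by (rule has_derivative_transform_within_open[OF _ W(1) x]) (simp add: h_def)
    then show ?thesis by (simp add: frechet_derivative_at[symmetric] add.commute)
  qed
  ultimately show ?thesis by (smt (verit) has_integral_cong)
qed

text \<open>Each product of \<open>\<partial>\<^sub>l \<phi>\<close> with the \<open>l\<close>-th determinant is integrated by parts. The constant row \<open>w\<close> contributes
nothing to the derivative \<open>\<partial>\<^sub>l\<close> of that determinant. The rows \<open>\<partial>\<^sub>m X\<close> contribute second derivatives of \<open>X\<close>,
which cancel after summation over \<open>l\<close> by symmetry, and the row \<open>\<eta>\<close> contributes the terms that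
\<open>sum_row_det_trace\<close> evaluates.\<close>

lemma has_integral_row_det_by_parts:
  fixes X \<eta> :: "real ^ 'n::finite \<Rightarrow> real ^ 'n option" and \<phi> :: "real ^ 'n \<Rightarrow> real"
  defines "V \<equiv> \<lambda>u l. fder (axis l 1) X u"
  assumes \<phi>: "Ck_on 1 UNIV \<phi>" "\<And>x. x \<notin> cbox a b \<Longrightarrow> \<phi> x = 0"
    and X: "Ck_on 2 W X" and \<eta>: "Ck_on 1 W \<eta>" and W: "open W" "cbox a b \<subseteq> W"
    and L: "\<And>u. u \<in> cbox a b \<Longrightarrow> \<exists>L. (\<forall>l. fder (axis l 1) \<eta> u = (\<Sum>m\<in>UNIV. L $ m $ l *\<^sub>R V u m)) \<and> trace L = \<tau>"
  shows "((\<lambda>u. (\<Sum>l\<in>UNIV. fder (axis l 1) \<phi> u * row_det (frame (\<eta> u) ((V u)(l := w))))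
            - \<tau> * (\<phi> u * row_det (frame w (V u)))) has_integral 0) (cbox a b)"
proof -
  have X2: "Ck_on (Suc (Suc 0)) W X" and \<eta>1: "Ck_on (Suc 0) W \<eta>" using X \<eta> by (auto simp: numeral_2_eq_2)
  define g where "g l u = row_det (\<lambda>b. frame (\<eta> u) ((V u)(l := w)) b)" for l u
  have rows: "Ck_on 1 W (\<lambda>u. frame (\<eta> u) ((V u)(l := w)) b)" for l b
  proof (cases b)
    case None then show ?thesis using \<eta> by simp
  next
    case (Some m)
    have "Ck_on (Suc 0) W (\<lambda>u. V u m)" unfolding V_def by (rule Ck_on_SucD_frechet[OF X2])
    then show ?thesis using Some Ck_on_const[OF W(1), of 1] by (cases "m = l") (simp_all del: Ck_on.simps)
  qed
  have gC: "Ck_on 1 W (g l)" for l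
    unfolding g_def by (rule Ck_on_row_det[OF W(1) rows])
  have dg: "fder (axis l 1) (g l) u = row_det (frame (fder (axis l 1) \<eta> u) ((V u)(l := w)))
      + (\<Sum>m\<in>UNIV - {l}. row_det ((frame (\<eta> u) (V u))(Some l := w, Some m := fder (axis l 1) (fder (axis m 1) X) u)))"
    if u: "u \<in> W" for l u
  proof -
    \<comment> \<open>the derivatives of the rows of the \<open>l\<close>-th determinant\<close>
    define R' where "R' b h = (case b of None \<Rightarrow> fder h \<eta> u | Some m \<Rightarrow> if m = l then 0 else fder h (fder (axis m 1) X) u)" for b h
    have "((\<lambda>u. frame (\<eta> u) ((V u)(l := w)) b) has_derivative R' b) (at u)" for b
    proof (cases b)
      case None
      then show ?thesis using Ck_on_SucD_has_derivative[OF \<eta>1 u] by (simp add: R'_def[abs_def])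
    next
      case (Some m)
      have "((\<lambda>u. V u m) has_derivative (\<lambda>h. fder h (fder (axis m 1) X) u)) (at u)"
        unfolding V_def using Ck_on_SucD_has_derivative[OF Ck_on_SucD_frechet[OF X2] u] .
      then show ?thesis using Some by (cases "m = l") (simp_all add: R'_def[abs_def])
    qed
    from row_det_has_derivative[OF this]
    have "(g l has_derivative (\<lambda>h. \<Sum>k\<in>UNIV. row_det ((\<lambda>b. frame (\<eta> u) ((V u)(l := w)) b)(k := R' k h)))) (at u)"
      unfolding g_def .
    from frechet_derivative_at[OF this, symmetric]
    have "fder (axis l 1) (g l) u = (\<Sum>k\<in>UNIV. row_det ((\<lambda>b. frame (\<eta> u) ((V u)(l := w)) b)(k := R' k (axis l 1))))"
      by (simp only:)
    also have "\<dots> = row_det ((frame (\<eta> u) ((V u)(l := w)))(None := R' None (axis l 1)))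
       + (\<Sum>m\<in>UNIV. row_det ((frame (\<eta> u) ((V u)(l := w)))(Some m := R' (Some m) (axis l 1))))"
      by (simp only: sum_option)
    also have "(\<Sum>m\<in>UNIV. row_det ((frame (\<eta> u) ((V u)(l := w)))(Some m := R' (Some m) (axis l 1))))
      = (\<Sum>m\<in>UNIV - {l}. row_det ((frame (\<eta> u) (V u))(Some l := w, Some m := fder (axis l 1) (fder (axis m 1) X) u)))"
    proof (rule sum.mono_neutral_cong_right)
      show "\<forall>m\<in>UNIV - (UNIV - {l}). row_det ((frame (\<eta> u) ((V u)(l := w)))(Some m := R' (Some m) (axis l 1))) = 0"
      proof
        fix m assume "m \<in> UNIV - (UNIV - {l})"
        then have "R' (Some m) (axis l 1) = 0 *\<^sub>R w" by (simp add: R'_def)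
        then show "row_det ((frame (\<eta> u) ((V u)(l := w)))(Some m := R' (Some m) (axis l 1))) = 0"
          by (simp only: row_det_scale)
      qed
    qed (auto simp: frame_upd_Some R'_def)
    finally show ?thesis by (simp only: frame_upd_None R'_def option.case)
  qed
  have "((\<lambda>u. \<Sum>l\<in>UNIV. fder (axis l 1) \<phi> u * g l u + \<phi> u * fder (axis l 1) (g l) u) has_integral (\<Sum>l\<in>(UNIV::'n set). 0)) (cbox a b)"
    (is "(?G has_integral _) _") by (intro has_integral_sum finite has_integral_by_parts[OF \<phi> gC W])
  then have "(?G has_integral 0) (cbox a b)" by (simp only: sum.neutral_const)
  moreover have "(\<Sum>l\<in>UNIV. fder (axis l 1) \<phi> u * g l u + \<phi> u * fder (axis l 1) (g l) u)
     = (\<Sum>l\<in>UNIV. fder (axis l 1) \<phi> u * row_det (frame (\<eta> u) ((V u)(l := w)))) - \<tau> * (\<phi> u * row_det (frame w (V u)))"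
    if u: "u \<in> cbox a b" for u
  proof -
    have uW: "u \<in> W" using u W by auto
    obtain L where L': "\<And>l. fder (axis l 1) \<eta> u = (\<Sum>m\<in>UNIV. L $ m $ l *\<^sub>R V u m)" "trace L = \<tau>"
      using L[OF u] by blast
    \<comment> \<open>the second derivatives of \<open>X\<close>, indexed by rows\<close>
    define H where "H b c = (case b of None \<Rightarrow> 0 | Some l \<Rightarrow> (case c of None \<Rightarrow> 0 | Some m \<Rightarrow>
       fder (axis l 1) (fder (axis m 1) X) u))" for b c :: "'n option"
    have Hsym: "H b c = H c b" for b c
      using symmetric_second_derivative[OF X W(1) uW] by (auto simp: H_def split: option.splits)
    have "(\<Sum>l\<in>UNIV. \<Sum>m\<in>UNIV - {l}. row_det ((frame (\<eta> u) (V u))(Some l := w, Some m := H (Some l) (Some m))))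
      = (\<Sum>l\<in>range Some. \<Sum>m\<in>range Some - {l}. row_det ((frame (\<eta> u) (V u))(l := w, m := H l m)))"
    proof -
      have "range Some - {Some l} = Some ` (UNIV - {l})" for l :: 'n by auto
      then show ?thesis by (simp add: sum.reindex)
    qed
    also have "\<dots> = 0" by (rule row_det_antisymmetric_sum[OF Hsym])
    finally have "(\<Sum>l\<in>UNIV. fder (axis l 1) (g l) u) = - \<tau> * row_det (frame w (V u))"
      using sum_row_det_trace[of "\<lambda>l. fder (axis l 1) \<eta> u" L "V u", OF L'(1)] L'(2)
      by (simp add: dg[OF uW] sum.distrib H_def)
    then show ?thesis
      by (simp add: sum.distrib g_def flip: sum_distrib_left)
  qed
  ultimately show ?thesis by (simp cong: has_integral_cong)
qed

section \<open>The Cahn--Hoffman map\<close>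

text \<open>The extension that is positively homogeneous of degree one: multiplying the normal by the volume
density multiplies its value by the density, so that it turns the chart normal into the integrand
\<open>\<gamma>(\<nu>) dA\<close>.\<close>

definition hom_ext :: "('e::euclidean_space \<Rightarrow> real) \<Rightarrow> 'e \<Rightarrow> real" where
  "hom_ext \<gamma> x = norm x * \<gamma> (x /\<^sub>R norm x)"

definition hom_grad :: "('e::euclidean_space \<Rightarrow> real) \<Rightarrow> 'e \<Rightarrow> 'e" where
  "hom_grad \<gamma> x = (\<Sum>b\<in>Basis. fder b (hom_ext \<gamma>) x *\<^sub>R b)"

lemma open_nonzero: "open (- {0::'e::euclidean_space})"
  by auto

lemma Ck_on_normalize: "Ck_on k (- {0}) (\<lambda>x::'e::euclidean_space. x /\<^sub>R norm x)"
proof -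
  have "Ck_on k (- {0::'e}) (\<lambda>x. norm x powr - 1)"
    by (rule Ck_on_compose[OF open_nonzero open_greaterThan _ Ck_on_norm Ck_on_powr]) auto
  then have "Ck_on k (- {0::'e}) (\<lambda>x. (norm x powr - 1) *\<^sub>R x)"
    by (intro Ck_on_scaleR Ck_on_ident open_nonzero)
  then show ?thesis
    by (subst Ck_on_cong[OF open_nonzero, of _ "\<lambda>x. (norm x powr - 1) *\<^sub>R x"]) (auto simp: powr_minus)
qed

lemma Ck_on_hom_ext:
  assumes "Cr_on 2 (sphere 0 1) \<gamma>"
  shows "Ck_on 2 (- {0}) (hom_ext \<gamma>)"
proof (rule Ck_on_locally)
  fix x :: 'a assume x: "x \<in> - {0}"
  then have "x /\<^sub>R norm x \<in> sphere 0 1" by simp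
  from assms[unfolded Cr_on_def, rule_format, OF this] obtain W g where W: "open W" "x /\<^sub>R norm x \<in> W" "\<forall>k. enat k \<le> 2 \<longrightarrow> Ck_on k W g"
    "\<forall>y\<in>sphere 0 1 \<inter> W. \<gamma> y = g y"
    by (elim exE conjE)
  have "Ck_on 2 W g" using W(3) by (simp add: numeral_eq_enat)
  define V where "V = (- {0}) \<inter> (\<lambda>x. x /\<^sub>R norm x) -` W"
  have V: "open V"
    unfolding V_def
    by (rule continuous_open_preimage[OF Ck_on_imp_continuous_on[OF Ck_on_normalize] open_nonzero W(1)])
  have V0: "V \<subseteq> - {0}" by (auto simp: V_def)
  have "Ck_on 2 V (\<lambda>x. norm x * g (x /\<^sub>R norm x))"
    by (intro Ck_on_mult[OF V Ck_on_subset[OF Ck_on_norm V0]]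
        Ck_on_compose[OF V W(1) _ Ck_on_subset[OF Ck_on_normalize V0] \<open>Ck_on 2 W g\<close>])
      (auto simp: V_def)
  moreover have "hom_ext \<gamma> y = norm y * g (y /\<^sub>R norm y)" if "y \<in> V" for y
    using that W(4) by (auto simp: V_def hom_ext_def)
  ultimately have "Ck_on 2 V (hom_ext \<gamma>)"
    by (subst Ck_on_cong[OF V, of _ "\<lambda>x. norm x * g (x /\<^sub>R norm x)"])
  then show "\<exists>V. open V \<and> x \<in> V \<and> Ck_on 2 V (hom_ext \<gamma>)"
    using V x W(2) by (auto simp: V_def)
qed

lemma hom_ext_scaleR: "c > 0 \<Longrightarrow> hom_ext \<gamma> (c *\<^sub>R x) = c * hom_ext \<gamma> x"
  by (simp add: hom_ext_def field_simps)

lemma hom_ext_on_sphere: "norm x = 1 \<Longrightarrow> hom_ext \<gamma> x = \<gamma> x"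
  by (simp add: hom_ext_def)

text \<open>The constant bounds the values on the compact unit sphere.\<close>

lemma hom_ext_bound:
  fixes \<gamma> :: "'e::euclidean_space \<Rightarrow> real"
  assumes "Cr_on 2 (sphere 0 1) \<gamma>"
  shows "\<exists>b. \<forall>v. \<bar>hom_ext \<gamma> v\<bar> \<le> b * norm v"
proof -
  have "continuous_on (sphere 0 1) (hom_ext \<gamma>)"
    by (rule continuous_on_subset[OF Ck_on_imp_continuous_on[OF Ck_on_hom_ext[OF assms]]]) auto
  then have "bounded (hom_ext \<gamma> ` sphere 0 1)" by (intro compact_imp_bounded compact_continuous_image) auto
  then obtain b where b: "\<forall>x\<in>hom_ext \<gamma> ` sphere 0 1. norm x \<le> b" unfolding bounded_iff by blast
  have "\<bar>hom_ext \<gamma> v\<bar> \<le> b * norm v" for v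
  proof (cases "v = 0")
    case False
    then have "v /\<^sub>R norm v \<in> sphere 0 1" by simp
    then have "\<bar>hom_ext \<gamma> (v /\<^sub>R norm v)\<bar> \<le> b" using b by fastforce
    moreover have "hom_ext \<gamma> v = norm v * hom_ext \<gamma> (v /\<^sub>R norm v)"
      using False by (simp add: hom_ext_def)
    ultimately show ?thesis by (simp add: abs_mult mult.commute[of b] mult_left_mono)
  qed (simp add: hom_ext_def)
  then show ?thesis by blast
qed

context
  fixes \<gamma> :: "'e::euclidean_space \<Rightarrow> real"
  assumes \<gamma>: "Cr_on 2 (sphere 0 1) \<gamma>"
begin

lemma Ck_on_Suc_hom_ext: "Ck_on (Suc (Suc 0)) (- {0}) (hom_ext \<gamma>)"
  using Ck_on_hom_ext[OF \<gamma>] by (simp add: numeral_2_eq_2)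

lemma hom_ext_has_derivative:
  assumes "x \<noteq> 0"
  shows "(hom_ext \<gamma> has_derivative (\<lambda>v. hom_grad \<gamma> x \<bullet> v)) (at x)"
proof -
  have D: "(hom_ext \<gamma> has_derivative frechet_derivative (hom_ext \<gamma>) (at x)) (at x)"
    using Ck_on_SucD_has_derivative[OF Ck_on_Suc_hom_ext] assms by simp
  note lin = has_derivative_linear[OF D]
  have "hom_grad \<gamma> x \<bullet> v = fder v (hom_ext \<gamma>) x" for v
  proof -
    have "fder v (hom_ext \<gamma>) x = fder (\<Sum>b\<in>Basis. (v \<bullet> b) *\<^sub>R b) (hom_ext \<gamma>) x"
      by (simp only: euclidean_representation)
    also have "\<dots> = (\<Sum>b\<in>Basis. (v \<bullet> b) *\<^sub>R fder b (hom_ext \<gamma>) x)"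
      by (simp only: linear_sum[OF lin] linear_scale[OF lin])
    also have "\<dots> = hom_grad \<gamma> x \<bullet> v"
      by (simp add: hom_grad_def inner_sum_left inner_commute[of v] mult.commute)
    finally show ?thesis by simp
  qed
  with D show ?thesis by simp
qed

lemma Ck_on_hom_grad: "Ck_on 1 (- {0}) (hom_grad \<gamma>)"
  unfolding hom_grad_def[abs_def] One_nat_def
  by (rule Ck_on_sum[OF open_nonzero], rule Ck_on_scaleR[OF open_nonzero])
    (rule Ck_on_SucD_frechet[OF Ck_on_Suc_hom_ext], rule Ck_on_const[OF open_nonzero])

lemma hom_grad_euler:
  assumes "x \<noteq> 0"
  shows "hom_grad \<gamma> x \<bullet> x = hom_ext \<gamma> x"
proof -
  have "((\<lambda>s. hom_ext \<gamma> (x + s *\<^sub>R x)) has_real_derivative hom_grad \<gamma> x \<bullet> x) (at 0)"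
    by (rule has_real_derivative_along_line) (use hom_ext_has_derivative[OF assms] in simp)
  moreover have "((\<lambda>s. hom_ext \<gamma> (x + s *\<^sub>R x)) has_real_derivative hom_ext \<gamma> x) (at 0)"
  proof (rule has_field_derivative_transform_within_open[of "\<lambda>s. (1 + s) * hom_ext \<gamma> x" _ _ "{-1<..}"])
    show "((\<lambda>s. (1 + s) * hom_ext \<gamma> x) has_real_derivative hom_ext \<gamma> x) (at 0)"
      by (auto intro!: derivative_eq_intros)
    show "(1 + s) * hom_ext \<gamma> x = hom_ext \<gamma> (x + s *\<^sub>R x)" if "s \<in> {-1<..}" for s
    proof -
      have "x + s *\<^sub>R x = (1 + s) *\<^sub>R x" by (simp add: algebra_simps)
      then show ?thesis using hom_ext_scaleR[of "1 + s" \<gamma> x] that by simp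
    qed
  qed auto
  ultimately show ?thesis by (rule DERIV_unique)
qed

lemma hom_grad_scaleR:
  assumes "c > 0" "x \<noteq> 0"
  shows "hom_grad \<gamma> (c *\<^sub>R x) = hom_grad \<gamma> x"
proof -
  have "((\<lambda>x. hom_ext \<gamma> (c *\<^sub>R x)) has_derivative (\<lambda>v. hom_grad \<gamma> (c *\<^sub>R x) \<bullet> (c *\<^sub>R v))) (at x)"
    by (rule has_derivative_compose[of "\<lambda>x. c *\<^sub>R x"])
      (use assms in \<open>auto intro!: derivative_eq_intros hom_ext_has_derivative\<close>)
  moreover have "((\<lambda>x. hom_ext \<gamma> (c *\<^sub>R x)) has_derivative (\<lambda>v. c * (hom_grad \<gamma> x \<bullet> v))) (at x)"
    unfolding hom_ext_scaleR[OF assms(1)]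
    by (intro has_derivative_mult_right hom_ext_has_derivative assms)
  ultimately have "(\<lambda>v. hom_grad \<gamma> (c *\<^sub>R x) \<bullet> (c *\<^sub>R v)) = (\<lambda>v. c * (hom_grad \<gamma> x \<bullet> v))"
    by (rule has_derivative_unique)
  then have "hom_grad \<gamma> (c *\<^sub>R x) \<bullet> v = hom_grad \<gamma> x \<bullet> v" for v
    using assms(1) by (metis inner_scaleR_right mult_cancel_left less_irrefl)
  then show ?thesis by (metis vector_eq_rdot)
qed

text \<open>On the sphere, \<open>\<gamma>\<close> coincides with \<open>hom_ext \<gamma> y - \<gamma> x (\<bar>y\<bar>\<^sup>2 - 1) / 2\<close>. The gradient of this function at \<open>x\<close> is
\<open>hom_grad \<gamma> x - \<gamma> x x\<close>, which is tangential by Euler's identity and therefore is the spherical gradient.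
A tangential vector that represents the zero derivative within the sphere vanishes, as one sees by
differentiating along a great circle.\<close>

lemma cahn_hoffman_eq_hom_grad:
  assumes x: "norm x = 1"
  shows "cahn_hoffman \<gamma> x = hom_grad \<gamma> x"
proof -
  let ?S = "sphere (0::'e) 1"
  have x0: "x \<noteq> 0" using x by auto
  have xS: "x \<in> ?S" using x by simp
  define w where "w = hom_grad \<gamma> x - \<gamma> x *\<^sub>R x"
  have wx: "w \<bullet> x = 0"
    using hom_grad_euler[OF x0] x by (simp add: w_def inner_diff_left hom_ext_on_sphere dot_square_norm)
  have der: "(\<gamma> has_derivative (\<lambda>v. w \<bullet> v)) (at x within ?S)"
  proof (rule has_derivative_transform_within[OF _ zero_less_one xS])
    show "((\<lambda>y. hom_ext \<gamma> y - \<gamma> x * ((y \<bullet> y - 1) / 2)) has_derivative (\<lambda>v. w \<bullet> v)) (at x within ?S)"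
    proof -
      have "((\<lambda>y. \<gamma> x * ((y \<bullet> y - 1) / 2)) has_derivative (\<lambda>v. \<gamma> x * (x \<bullet> v))) (at x within ?S)"
        by (auto intro!: derivative_eq_intros simp: fun_eq_iff inner_commute)
      from has_derivative_diff[OF has_derivative_at_withinI[OF hom_ext_has_derivative[OF x0]] this]
      show ?thesis by (simp add: w_def inner_diff_left)
    qed
    show "hom_ext \<gamma> y - \<gamma> x * ((y \<bullet> y - 1) / 2) = \<gamma> y" if "y \<in> ?S" for y
      using that by (simp add: hom_ext_on_sphere dot_square_norm)
  qed
  have "sphere_gradient \<gamma> x = w"
    unfolding sphere_gradient_def
  proof (rule the_equality)
    show "w \<bullet> x = 0 \<and> (\<gamma> has_derivative (\<bullet>) w) (at x within ?S)" using wx der by simp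
    fix w' assume w': "w' \<bullet> x = 0 \<and> (\<gamma> has_derivative (\<bullet>) w') (at x within ?S)"
    define z where "z = w' - w"
    have zx: "z \<bullet> x = 0" using w' wx by (simp add: z_def inner_diff_left)
    have "((\<lambda>y. \<gamma> y - \<gamma> y) has_derivative (\<lambda>v. w' \<bullet> v - w \<bullet> v)) (at x within ?S)"
      using w' der by (intro has_derivative_diff) auto
    then have zder: "((\<lambda>y. 0::real) has_derivative (\<lambda>v. z \<bullet> v)) (at x within ?S)"
      by (simp add: z_def inner_diff_left)
    show "w' = w"
    proof (rule ccontr)
      assume "w' \<noteq> w"
      then have z: "z \<noteq> 0" by (simp add: z_def)
      define v where "v = z /\<^sub>R norm z"
      have v: "norm v = 1" "v \<bullet> x = 0" using z zx by (simp_all add: v_def)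
      \<comment> \<open>the great circle through \<open>x\<close> with velocity \<open>v\<close>\<close>
      define c where "c s = cos s *\<^sub>R x + sin s *\<^sub>R v" for s
      have "(norm (c s))\<^sup>2 = 1" for s
        using x v by (simp add: c_def power2_norm_eq_inner inner_add inner_commute algebra_simps
            flip: power2_eq_square) (simp add: dot_square_norm)
      then have cS: "range c \<subseteq> ?S" by (auto simp: power2_eq_1_iff) (smt (verit) norm_ge_zero)
      have c0: "c 0 = x" by (simp add: c_def)
      have cder: "(c has_derivative (\<lambda>h. h *\<^sub>R v)) (at 0)"
        unfolding c_def by (auto intro!: derivative_eq_intros)
      have "((\<lambda>s. 0::real) has_derivative (\<lambda>h. z \<bullet> (h *\<^sub>R v))) (at 0)"
        using has_derivative_in_compose[of c "\<lambda>h. h *\<^sub>R v" 0 UNIV "\<lambda>_. 0" "\<lambda>v. z \<bullet> v"] cder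
          has_derivative_subset[OF zder cS] c0 by simp
      then have "(\<lambda>h. z \<bullet> (h *\<^sub>R v)) = (\<lambda>h. 0)"
        using has_derivative_unique has_derivative_const by blast
      then have "z \<bullet> (1 *\<^sub>R v) = 0" by meson
      then show False using z by (simp add: v_def)
    qed
  qed
  then show ?thesis by (simp add: cahn_hoffman_def w_def)
qed

text \<open>Differentiating Euler's identity \<open>hom_grad \<gamma> C \<bullet> C = hom_ext \<gamma> C\<close>, one finds \<open>hom_grad \<gamma> C \<bullet> dC\<close> on both
sides. Applied to the chart normal, this says that the differential of \<open>\<xi> \<circ> \<nu>\<close> takes values in the
tangent space, so that it can be regarded as an endomorphism.\<close>

lemma fder_hom_grad_orthogonal:
  fixes C :: "'d::euclidean_space \<Rightarrow> 'e"
  assumes W: "open W" "u \<in> W" and C: "C differentiable (at u)" "\<And>u. u \<in> W \<Longrightarrow> C u \<noteq> 0"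
  shows "fder v (\<lambda>u. hom_grad \<gamma> (C u)) u \<bullet> C u = 0"
proof -
  have Cu: "C u \<noteq> 0" using W C by blast
  have g1: "Ck_on (Suc 0) (- {0}) (hom_grad \<gamma>)" using Ck_on_hom_grad by simp
  have dC: "(C has_derivative frechet_derivative C (at u)) (at u)"
    using C(1) frechet_derivative_works by blast
  have "(hom_grad \<gamma> has_derivative frechet_derivative (hom_grad \<gamma>) (at (C u))) (at (C u))"
    using Ck_on_SucD_has_derivative[OF g1] Cu by simp
  note dG0 = has_derivative_compose[OF dC this]
  then have dG: "((\<lambda>u. hom_grad \<gamma> (C u)) has_derivative (\<lambda>v. fder v (\<lambda>u. hom_grad \<gamma> (C u)) u)) (at u)"
    using frechet_derivative_at by metis
  have 1: "((\<lambda>u. hom_grad \<gamma> (C u) \<bullet> C u) has_derivative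
      (\<lambda>v. hom_grad \<gamma> (C u) \<bullet> fder v C u + fder v (\<lambda>u. hom_grad \<gamma> (C u)) u \<bullet> C u)) (at u)"
    by (rule has_derivative_inner[OF dG dC])
  have 2: "((\<lambda>u. hom_ext \<gamma> (C u)) has_derivative (\<lambda>v. hom_grad \<gamma> (C u) \<bullet> fder v C u)) (at u)"
    by (rule has_derivative_compose[OF dC hom_ext_has_derivative[OF Cu]])
  then have "((\<lambda>u. hom_grad \<gamma> (C u) \<bullet> C u) has_derivative (\<lambda>v. hom_grad \<gamma> (C u) \<bullet> fder v C u)) (at u)"
    by (rule has_derivative_transform_within_open[OF _ W]) (simp add: hom_grad_euler C(2))
  from has_derivative_unique[OF 1 this]
  have "hom_grad \<gamma> (C u) \<bullet> fder v C u + fder v (\<lambda>u. hom_grad \<gamma> (C u)) u \<bullet> C u = hom_grad \<gamma> (C u) \<bullet> fder v C u"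
    by (rule fun_cong)
  then show ?thesis by simp
qed

end

section \<open>Charts and smooth functions on a closed oriented manifold\<close>

lemma is_chart_openin: "is_chart T c \<Longrightarrow> openin T (fst c)"
  and is_chart_open_range: "is_chart T c \<Longrightarrow> open (snd c ` fst c)"
  by (simp_all add: is_chart_def)

lemma is_chart_subset: "is_chart T c \<Longrightarrow> fst c \<subseteq> topspace T"
  by (rule openin_subset[OF is_chart_openin])

lemma is_chart_inj_on:
  assumes "is_chart T c" shows "inj_on (snd c) (fst c)"
proof -
  have "homeomorphic_map (subtopology T (fst c)) (top_of_set (snd c ` fst c)) (snd c)"
    using assms by (simp add: is_chart_def)
  from homeomorphic_imp_injective_map[OF this] show ?thesis
    by (simp only: topspace_subtopology_subset[OF is_chart_subset[OF assms]])
qed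

lemma chart_inv_left: "is_chart T c \<Longrightarrow> p \<in> fst c \<Longrightarrow> chart_inv c (snd c p) = p"
  unfolding chart_inv_def by (rule inv_into_f_f[OF is_chart_inj_on])

lemma chart_inv_right: "u \<in> snd c ` fst c \<Longrightarrow> snd c (chart_inv c u) = u"
  unfolding chart_inv_def by (rule f_inv_into_f)

lemma chart_inv_in: "u \<in> snd c ` fst c \<Longrightarrow> chart_inv c u \<in> fst c"
  unfolding chart_inv_def by (rule inv_into_into)

lemma chart_image_open:
  assumes "is_chart T c" "openin T W"
  shows "open (snd c ` (fst c \<inter> W))"
proof -
  have "open_map (subtopology T (fst c)) (top_of_set (snd c ` fst c)) (snd c)"
    using assms(1) unfolding is_chart_def by (meson homeomorphic_imp_open_map)
  moreover have "openin (subtopology T (fst c)) (fst c \<inter> W)"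
    using assms openin_subtopology_Int2 by (metis inf_commute openin_subtopology)
  ultimately have "openin (top_of_set (snd c ` fst c)) (snd c ` (fst c \<inter> W))"
    unfolding open_map_def by blast
  then show ?thesis using is_chart_open_range[OF assms(1)] openin_open_eq by blast
qed

lemma chart_continuous_map:
  assumes "is_chart T c"
  shows "continuous_map (subtopology T (fst c)) euclidean (snd c)"
    and "continuous_map (top_of_set (snd c ` fst c)) T (chart_inv c)"
proof -
  have hom: "homeomorphic_map (subtopology T (fst c)) (top_of_set (snd c ` fst c)) (snd c)"
    using assms unfolding is_chart_def by blast
  then show "continuous_map (subtopology T (fst c)) euclidean (snd c)"
    by (rule continuous_map_into_fulltopology[OF homeomorphic_imp_continuous_map])
  obtain g where g: "homeomorphic_maps (subtopology T (fst c)) (top_of_set (snd c ` fst c)) (snd c) g"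
    using hom homeomorphic_map_maps by blast
  have "\<forall>p\<in>fst c. g (snd c p) = p"
    using g unfolding homeomorphic_maps_def topspace_subtopology_subset[OF is_chart_subset[OF assms]]
    by (elim conjE)
  then have "g u = chart_inv c u" if "u \<in> snd c ` fst c" for u
    using chart_inv_in[OF that] chart_inv_right[OF that] by metis
  moreover have "continuous_map (top_of_set (snd c ` fst c)) (subtopology T (fst c)) g"
    using g by (simp only: homeomorphic_maps_def)
  ultimately have "continuous_map (top_of_set (snd c ` fst c)) (subtopology T (fst c)) (chart_inv c)"
    by (elim continuous_map_eq) simp
  then show "continuous_map (top_of_set (snd c ` fst c)) T (chart_inv c)"
    by (rule continuous_map_into_fulltopology)
qed

lemma chart_preimage_openin:
  assumes "is_chart T c" "open U"
  shows "openin T {p \<in> fst c. snd c p \<in> U}"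
proof -
  have "openin (subtopology T (fst c)) {p \<in> topspace (subtopology T (fst c)). snd c p \<in> U}"
    using chart_continuous_map(1)[OF assms(1)] assms(2) by (simp add: continuous_map_def)
  moreover have "topspace (subtopology T (fst c)) = fst c"
    using is_chart_subset[OF assms(1)] by (rule topspace_subtopology_subset)
  ultimately show ?thesis
    using openin_trans_full[OF _ is_chart_openin[OF assms(1)]] by (simp only:)
qed

lemma chart_inv_compactin:
  assumes "is_chart T c" "compact K" "K \<subseteq> snd c ` fst c"
  shows "compactin T (chart_inv c ` K)"
  by (rule image_compactin[OF _ chart_continuous_map(2)[OF assms(1)]])
    (use assms in \<open>simp add: compactin_subtopology\<close>)

lemma chart_image_compact:
  assumes "is_chart T c" "compactin T K" "K \<subseteq> fst c"
  shows "compact (snd c ` K)"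
proof -
  have "compactin (subtopology T (fst c)) K" using assms by (simp add: compactin_subtopology)
  then have "compactin euclidean (snd c ` K)"
    using chart_continuous_map(1)[OF assms(1)] image_compactin by blast
  then show ?thesis by simp
qed

lemma smooth_onD_Ck:
  assumes "is_chart T c" "openin T W" "smooth_on A W f" "c \<in> A"
  shows "Ck_on k (snd c ` (fst c \<inter> W)) (f \<circ> chart_inv c)"
  using assms(3,4) by (intro Cr_on_openD chart_image_open[OF assms(1,2)]) (simp add: smooth_on_def)

lemma smooth_on_subset: "smooth_on A S f \<Longrightarrow> R \<subseteq> S \<Longrightarrow> smooth_on A R f"
  unfolding smooth_on_def by (meson Cr_on_subset Int_mono image_mono subset_refl)

lemma column_diff_matrix:
  "column l (diff_matrix c f p) = fder (axis l 1) (f \<circ> chart_inv c) (snd c p)"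
  by (simp add: diff_matrix_def jacobian_def matrix_def column_def vec_eq_iff)

text \<open>In coordinates, the unit normal times the volume density.\<close>

definition chart_normal ::
    "('a, 'n::finite) chart \<Rightarrow> ('a \<Rightarrow> real ^ 'n option) \<Rightarrow> real ^ 'n \<Rightarrow> real ^ 'n option" where
  "chart_normal c X u = cross (\<lambda>l. fder (axis l 1) (X \<circ> chart_inv c) u)"

lemma cross_diff_matrix: "cross (\<lambda>l. column l (diff_matrix c X p)) = chart_normal c X (snd c p)"
  by (simp add: column_diff_matrix chart_normal_def)

locale manifold =
  fixes T :: "'a topology" and A :: "('a, 'n::finite) chart set"
  assumes manifold: "closed_oriented_manifold T A"
begin

lemma Hausdorff: "Hausdorff_space T" and compact_space: "compact_space T"
  and nonempty: "topspace T \<noteq> {}"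
  using manifold unfolding closed_oriented_manifold_def by auto

lemma chart: "c \<in> A \<Longrightarrow> is_chart T c"
  and charts_cover: "p \<in> topspace T \<Longrightarrow> \<exists>c\<in>A. p \<in> fst c"
  using manifold unfolding closed_oriented_manifold_def oriented_atlas_def by blast+

lemma transition_smooth:
  "c \<in> A \<Longrightarrow> d \<in> A \<Longrightarrow> Cr_on \<infinity> (snd c ` (fst c \<inter> fst d)) (snd d \<circ> chart_inv c)"
  using manifold unfolding closed_oriented_manifold_def oriented_atlas_def by blast

lemma transition_det:
  "c \<in> A \<Longrightarrow> d \<in> A \<Longrightarrow> u \<in> snd c ` (fst c \<inter> fst d) \<Longrightarrow>
    det (jacobian (snd d \<circ> chart_inv c) (at u)) > 0"
  using manifold unfolding closed_oriented_manifold_def oriented_atlas_def by blast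

lemma compactin_imp_closedin_T: "compactin T K \<Longrightarrow> closedin T K"
  using Hausdorff compactin_imp_closedin by blast

lemma smooth_on_locally:
  assumes "S \<subseteq> topspace T"
    and "\<And>p. p \<in> S \<Longrightarrow> \<exists>W. openin T W \<and> p \<in> W \<and> smooth_on A (S \<inter> W) f"
  shows "smooth_on A S f"
  unfolding smooth_on_def
proof
  fix c assume c: "c \<in> A"
  show "Cr_on \<infinity> (snd c ` (fst c \<inter> S)) (f \<circ> chart_inv c)"
  proof (rule Cr_on_locally)
    fix x assume "x \<in> snd c ` (fst c \<inter> S)"
    then obtain p where p: "p \<in> fst c" "p \<in> S" "x = snd c p" by auto
    obtain W where W: "openin T W" "p \<in> W" "smooth_on A (S \<inter> W) f" using assms(2)[OF p(2)] by blast
    have "snd c ` (fst c \<inter> S) \<inter> snd c ` (fst c \<inter> W) \<subseteq> snd c ` (fst c \<inter> (S \<inter> W))"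
      using is_chart_inj_on[OF chart[OF c]] by (auto simp: inj_on_def)
    moreover have "Cr_on \<infinity> (snd c ` (fst c \<inter> (S \<inter> W))) (f \<circ> chart_inv c)"
      using W(3) c unfolding smooth_on_def by blast
    ultimately have "Cr_on \<infinity> (snd c ` (fst c \<inter> S) \<inter> snd c ` (fst c \<inter> W)) (f \<circ> chart_inv c)"
      using Cr_on_subset by blast
    then show "\<exists>V. open V \<and> x \<in> V \<and> Cr_on \<infinity> (snd c ` (fst c \<inter> S) \<inter> V) (f \<circ> chart_inv c)"
      using chart_image_open[OF chart[OF c] W(1)] p W(2) by (intro exI[of _ "snd c ` (fst c \<inter> W)"]) auto
  qed
qed

lemma smooth_on_cong:
  assumes "smooth_on A S f" "\<And>p. p \<in> S \<Longrightarrow> f p = g p"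
  shows "smooth_on A S g"
  unfolding smooth_on_def
proof
  fix c assume c: "c \<in> A"
  show "Cr_on \<infinity> (snd c ` (fst c \<inter> S)) (g \<circ> chart_inv c)"
  proof (rule Cr_on_cong)
    show "Cr_on \<infinity> (snd c ` (fst c \<inter> S)) (f \<circ> chart_inv c)" using assms(1) c by (simp add: smooth_on_def)
  qed (use assms(2) chart_inv_left[OF chart[OF c]] in auto)
qed

lemma smooth_on_add:
  "smooth_on A S f \<Longrightarrow> smooth_on A S g \<Longrightarrow> smooth_on A S (\<lambda>p. f p + g p)"
  unfolding smooth_on_def comp_def by (intro ballI Cr_on_add) blast+

lemma smooth_on_scaleR:
  "smooth_on A S f \<Longrightarrow> smooth_on A S g \<Longrightarrow> smooth_on A S (\<lambda>p. f p *\<^sub>R g p)"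
  unfolding smooth_on_def comp_def by (intro ballI Cr_on_scaleR) blast+

lemma smooth_on_const: "smooth_on A S (\<lambda>p. k)"
  unfolding smooth_on_def comp_def by (intro ballI Cr_on_const)

text \<open>The domain of \<open>c\<close> and the complement of the compact preimage of \<open>K\<close> are open and cover the manifold. On
the former, smoothness follows from that of the transition maps, and on the latter the function is
zero.\<close>

lemma smooth_on_chart_function:
  fixes \<phi> :: "real ^ 'n \<Rightarrow> real"
  assumes c: "c \<in> A" and \<phi>: "\<And>k. Ck_on k UNIV \<phi>"
    and K: "compact K" "K \<subseteq> snd c ` fst c" "\<And>u. u \<notin> K \<Longrightarrow> \<phi> u = 0"
  shows "smooth_on A (topspace T) (\<lambda>p. if p \<in> fst c then \<phi> (snd c p) else 0)"
    (is "smooth_on A _ ?\<psi>")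
proof (rule smooth_on_locally)
  fix p assume p: "p \<in> topspace T"
  show "\<exists>W. openin T W \<and> p \<in> W \<and> smooth_on A (topspace T \<inter> W) ?\<psi>"
  proof (cases "p \<in> fst c")
    case True
    have "smooth_on A (fst c) ?\<psi>"
      unfolding smooth_on_def
    proof
      fix d assume d: "d \<in> A"
      have "Cr_on \<infinity> (snd d ` (fst d \<inter> fst c)) (\<lambda>u. \<phi> ((snd c \<circ> chart_inv d) u))"
        by (rule Cr_on_compose[OF transition_smooth[OF d c] Cr_on_openI[OF open_UNIV \<phi>]]) auto
      then show "Cr_on \<infinity> (snd d ` (fst d \<inter> fst c)) (?\<psi> \<circ> chart_inv d)"
        by (rule Cr_on_cong) (use chart_inv_left[OF chart[OF d]] in auto)
    qed
    then have "smooth_on A (topspace T \<inter> fst c) ?\<psi>" by (rule smooth_on_subset) auto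
    then show ?thesis using True is_chart_openin[OF chart[OF c]] by blast
  next
    case False
    let ?W = "topspace T - chart_inv c ` K"
    have "openin T ?W"
      using compactin_imp_closedin_T[OF chart_inv_compactin[OF chart[OF c] K(1,2)]]
      by (simp add: closedin_def)
    moreover have "chart_inv c ` K \<subseteq> fst c"
      using K(2) by (intro image_subsetI chart_inv_in) blast
    then have "p \<in> ?W" using p False by blast
    moreover have "smooth_on A (topspace T \<inter> ?W) ?\<psi>"
    proof (rule smooth_on_cong[OF smooth_on_const[of _ 0]])
      fix q assume "q \<in> topspace T \<inter> ?W"
      then have "snd c q \<notin> K" if "q \<in> fst c"
        using chart_inv_left[OF chart[OF c] that] by (metis DiffD2 IntD2 image_eqI)
      then show "0 = ?\<psi> q" using K(3) by auto
    qed
    ultimately show ?thesis by blast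
  qed
qed auto

text \<open>This is the chain rule for \<open>f \<circ> d\<^sup>-\<^sup>1 = (f \<circ> c\<^sup>-\<^sup>1) \<circ> (c \<circ> d\<^sup>-\<^sup>1)\<close>; the sign of the determinant expresses the
orientation.\<close>

lemma diff_matrix_change:
  assumes c: "c \<in> A" and d: "d \<in> A" and p: "p \<in> fst c" "p \<in> fst d"
    and f: "(f \<circ> chart_inv c) differentiable (at (snd c p))"
  defines "J \<equiv> jacobian (snd c \<circ> chart_inv d) (at (snd d p))"
  shows "diff_matrix d f p = diff_matrix c f p ** J" "det J > 0"
proof -
  let ?\<tau> = "snd c \<circ> chart_inv d" and ?U = "snd d ` (fst d \<inter> fst c)"
  have U: "open ?U" "snd d p \<in> ?U"
    using chart_image_open[OF chart[OF d] is_chart_openin[OF chart[OF c]]] p by auto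
  show "det J > 0" unfolding J_def by (rule transition_det[OF d c U(2)])
  have "Ck_on (Suc 0) ?U ?\<tau>" by (rule Cr_on_openD[OF U(1) transition_smooth[OF d c]])
  then have \<tau>: "(?\<tau> has_derivative (*v) J) (at (snd d p))"
    using U(2) jacobian_works[of ?\<tau> "at (snd d p)"] unfolding J_def by auto
  have \<tau>p: "?\<tau> (snd d p) = snd c p" using chart_inv_left[OF chart[OF d] p(2)] by simp
  have "((f \<circ> chart_inv c) has_derivative (*v) (diff_matrix c f p)) (at (?\<tau> (snd d p)))"
    using f unfolding \<tau>p diff_matrix_def by (simp add: jacobian_works)
  from has_derivative_compose[OF \<tau> this]
  have "((\<lambda>u. (f \<circ> chart_inv c) (?\<tau> u)) has_derivative (\<lambda>h. diff_matrix c f p *v (J *v h))) (at (snd d p))" .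
  then have "((f \<circ> chart_inv d) has_derivative (\<lambda>h. diff_matrix c f p *v (J *v h))) (at (snd d p))"
  proof (rule has_derivative_transform_within_open[OF _ U])
    fix u assume "u \<in> ?U"
    then obtain q where q: "q \<in> fst d" "q \<in> fst c" "u = snd d q" by auto
    then show "(f \<circ> chart_inv c) (?\<tau> u) = (f \<circ> chart_inv d) u"
      using chart_inv_left[OF chart[OF d] q(1)] chart_inv_left[OF chart[OF c] q(2)] by simp
  qed
  then have "((f \<circ> chart_inv d) has_derivative (*v) (diff_matrix c f p ** J)) (at (snd d p))"
    by (simp add: matrix_vector_mul_assoc)
  from frechet_derivative_at[OF this] show "diff_matrix d f p = diff_matrix c f p ** J"
    unfolding diff_matrix_def[of d] jacobian_def by (metis matrix_of_matrix_vector_mul)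
qed

lemma smooth_on_differentiable:
  assumes "openin T W" "smooth_on A W f" "c \<in> A" "p \<in> W" "p \<in> fst c"
  shows "(f \<circ> chart_inv c) differentiable (at (snd c p))"
  using smooth_onD_Ck[OF chart[OF assms(3)] assms(1-3), of "Suc 0"] assms by auto

lemma chart_normal_change:
  assumes W: "openin T W" "smooth_on A W X" "p \<in> W"
    and c: "c \<in> A" "p \<in> fst c" and d: "d \<in> A" "p \<in> fst d"
  obtains j where "j > 0" "chart_normal d X (snd d p) = j *\<^sub>R chart_normal c X (snd c p)"
proof -
  note f = smooth_on_differentiable[OF W(1,2) c(1) W(3) c(2)]
  note D = diff_matrix_change[OF c(1) d(1) c(2) d(2) f]
  show thesis
    by (rule that[OF D(2)]) (simp only: D(1) cross_columns_mult flip: cross_diff_matrix)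
qed

text \<open>By \<open>chart_normal_change\<close> the normals in two charts differ by a positive factor. Hence the conditions on
a unit normal, which are required in all charts, can be checked in a single one.\<close>

lemma
  assumes W: "openin T W" "smooth_on A W X" "p \<in> W"
    and c: "c \<in> A" "p \<in> fst c" and nz: "chart_normal c X (snd c p) \<noteq> 0"
  shows is_unit_normal_iff: "is_unit_normal A X p w \<longleftrightarrow>
      w = chart_normal c X (snd c p) /\<^sub>R norm (chart_normal c X (snd c p))"
    and unit_normal_eq: "unit_normal A X p =
      chart_normal c X (snd c p) /\<^sub>R norm (chart_normal c X (snd c p))"
    and immersed_in_all_charts: "d \<in> A \<Longrightarrow> p \<in> fst d \<Longrightarrow> inj ((*v) (diff_matrix d X p))"
proof -
  let ?N = "\<lambda>c. chart_normal c X (snd c p)"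
  have other: "?N d \<noteq> 0 \<and> ?N d /\<^sub>R norm (?N d) = ?N c /\<^sub>R norm (?N c)" if d: "d \<in> A" "p \<in> fst d" for d
  proof -
    obtain j where "j > 0" "?N d = j *\<^sub>R ?N c" using chart_normal_change[OF W c d] .
    then show ?thesis using nz by (simp add: field_simps)
  qed
  show iff: "is_unit_normal A X p w \<longleftrightarrow> w = ?N c /\<^sub>R norm (?N c)" for w
  proof
    assume "is_unit_normal A X p w"
    then show "w = ?N c /\<^sub>R norm (?N c)"
      using unit_normal_unique[of w "diff_matrix c X p"] c
      unfolding is_unit_normal_def cross_diff_matrix by blast
  next
    assume w: "w = ?N c /\<^sub>R norm (?N c)"
    show "is_unit_normal A X p w"
      unfolding is_unit_normal_def
    proof (intro conjI ballI impI allI)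
      show "norm w = 1" using w nz by simp
      fix d assume d: "d \<in> A" "p \<in> fst d"
      have nd: "cross (\<lambda>l. column l (diff_matrix d X p)) \<noteq> 0"
        and wd: "w = cross (\<lambda>l. column l (diff_matrix d X p)) /\<^sub>R norm (cross (\<lambda>l. column l (diff_matrix d X p)))"
        using other[OF d] w by (simp_all add: cross_diff_matrix)
      show "w \<bullet> column l (diff_matrix d X p) = 0" for l
        using unit_normal_works(2)[OF nd] wd by simp
      show "0 < det (frame_matrix w (diff_matrix d X p))"
        using unit_normal_works(3)[OF nd] wd by simp
    qed
  qed
  then show "unit_normal A X p = ?N c /\<^sub>R norm (?N c)"
    unfolding unit_normal_def by (intro the_equality) auto
  show "d \<in> A \<Longrightarrow> p \<in> fst d \<Longrightarrow> inj ((*v) (diff_matrix d X p))"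
    using other by (simp add: inj_iff_cross_nz cross_diff_matrix)
qed

lemma immersion_chart_normal_nz:
  "smooth_immersion_on A W X \<Longrightarrow> p \<in> W \<Longrightarrow> c \<in> A \<Longrightarrow> p \<in> fst c \<Longrightarrow> chart_normal c X (snd c p) \<noteq> 0"
  unfolding smooth_immersion_on_def by (metis inj_iff_cross_nz cross_diff_matrix)

lemma volume_density_eq:
  assumes "chart_normal c X (snd c p) \<noteq> 0"
  shows "volume_density c X p = norm (chart_normal c X (snd c p))"
  using det_gram[of "diff_matrix c X p"] assms
  by (simp add: volume_density_def cross_diff_matrix norm_eq_sqrt_inner)

lemma Ck_on_chart_normal:
  assumes "openin T W" "smooth_on A W X" "c \<in> A"
  shows "Ck_on k (snd c ` (fst c \<inter> W)) (chart_normal c X)"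
proof -
  let ?U = "snd c ` (fst c \<inter> W)"
  note U = chart_image_open[OF chart[OF assms(3)] assms(1)]
  note X = smooth_onD_Ck[OF chart[OF assms(3)] assms(1-3), of "Suc k"]
  have rows: "Ck_on k ?U (\<lambda>u. frame (axis a 1) (\<lambda>l. fder (axis l 1) (X \<circ> chart_inv c) u) b)" for a b
  proof (cases b)
    case None
    then show ?thesis using Ck_on_const[OF U] by simp
  next
    case (Some l)
    then show ?thesis using Ck_on_SucD_frechet[OF X, of "axis l 1"] by simp
  qed
  show ?thesis
    unfolding chart_normal_def[abs_def] cross_def
    by (rule Ck_on_vec_lambda[OF U Ck_on_row_det[OF U rows]])
qed

lemma smooth_on_unit_normal:
  assumes W: "openin T W" and imm: "smooth_immersion_on A W X"
  shows "smooth_on A W (unit_normal A X)"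
    and "p \<in> W \<Longrightarrow> is_unit_normal A X p (unit_normal A X p)"
proof -
  have X: "smooth_on A W X" using imm by (simp add: smooth_immersion_on_def)
  show "smooth_on A W (unit_normal A X)"
    unfolding smooth_on_def
  proof
    fix c assume c: "c \<in> A"
    let ?U = "snd c ` (fst c \<inter> W)"
    note U = chart_image_open[OF chart[OF c] W]
    have "Ck_on k ?U (\<lambda>u. chart_normal c X u /\<^sub>R norm (chart_normal c X u))" for k
      by (rule Ck_on_compose[OF U open_nonzero _ Ck_on_chart_normal[OF W X c] Ck_on_normalize])
        (use immersion_chart_normal_nz[OF imm _ c] in auto)
    then have "Cr_on \<infinity> ?U (\<lambda>u. chart_normal c X u /\<^sub>R norm (chart_normal c X u))"
      using Cr_on_openI[OF U] by blast
    then show "Cr_on \<infinity> ?U (unit_normal A X \<circ> chart_inv c)"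
    proof (rule Cr_on_cong)
      fix u assume "u \<in> ?U"
      then obtain p where p: "p \<in> fst c" "p \<in> W" "u = snd c p" by auto
      then show "chart_normal c X u /\<^sub>R norm (chart_normal c X u) = (unit_normal A X \<circ> chart_inv c) u"
        using unit_normal_eq[OF W X p(2) c p(1) immersion_chart_normal_nz[OF imm p(2) c p(1)]]
          chart_inv_left[OF chart[OF c] p(1)] by simp
    qed
  qed
  assume p: "p \<in> W"
  then obtain c where c: "c \<in> A" "p \<in> fst c" using charts_cover openin_subset[OF W] by blast
  note nz = immersion_chart_normal_nz[OF imm p c]
  show "is_unit_normal A X p (unit_normal A X p)"
    using is_unit_normal_iff[OF W X p c nz] unit_normal_eq[OF W X p c nz] by blast
qed

end

section \<open>Pieces, regular points and integrability\<close>

text \<open>The closed sets are removed from \<open>U\<close> one after the other. Either \<open>U\<close> is contained in the one being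
removed and hence in its interior, or a nonempty open set covered by the others remains.\<close>

lemma finite_closed_cover_interior:
  assumes "finite I" "\<And>i. i \<in> I \<Longrightarrow> closedin T (F i)" "openin T U" "U \<noteq> {}" "U \<subseteq> (\<Union>i\<in>I. F i)"
  obtains i where "i \<in> I" "U \<inter> T interior_of F i \<noteq> {}"
proof -
  have "\<exists>i\<in>I. U \<inter> T interior_of F i \<noteq> {}"
    using assms
  proof (induction I arbitrary: U)
    case (insert i I)
    show ?case
    proof (cases "U \<subseteq> F i")
      case True
      then have "U \<subseteq> T interior_of F i" using insert.prems(2) by (simp add: interior_of_maximal)
      then show ?thesis using insert.prems(3) by blast
    next
      case False
      have "openin T (U - F i)" using insert.prems by (simp add: openin_diff)
      then have "\<exists>j\<in>I. (U - F i) \<inter> T interior_of F j \<noteq> {}"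
        using insert.prems False by (intro insert.IH) auto
      then show ?thesis by blast
    qed
  qed auto
  then show thesis using that by blast
qed

lemma (in manifold) smooth_immersion_onI:
  assumes "openin T W" "smooth_on A W X"
    and "\<And>p. p \<in> W \<Longrightarrow> \<exists>c\<in>A. p \<in> fst c \<and> chart_normal c X (snd c p) \<noteq> 0"
  shows "smooth_immersion_on A W X"
  unfolding smooth_immersion_on_def
proof (intro conjI ballI impI assms(2))
  fix p d assume p: "p \<in> W" and d: "d \<in> A" "p \<in> fst d"
  obtain c where c: "c \<in> A" "p \<in> fst c" "chart_normal c X (snd c p) \<noteq> 0" using assms(3)[OF p] by blast
  show "inj ((*v) (diff_matrix d X p))"
    by (rule immersed_in_all_charts[OF assms(1,2) p c d])
qed

lemma smooth_immersion_on_subset: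
  "smooth_immersion_on A W X \<Longrightarrow> V \<subseteq> W \<Longrightarrow> smooth_immersion_on A V X"
  unfolding smooth_immersion_on_def by (meson smooth_on_subset subsetD)

definition regular_set ::
    "'a topology \<Rightarrow> ('a, 'n::finite) chart set \<Rightarrow> ('a \<Rightarrow> real ^ 'n option) \<Rightarrow> 'a set" where
  "regular_set T A X = topspace T - singular_set T A X"

lemma mem_regular_set_iff:
  "p \<in> regular_set T A X \<longleftrightarrow> (\<exists>W. openin T W \<and> p \<in> W \<and> smooth_immersion_on A W X)"
  unfolding regular_set_def singular_set_def using openin_subset by fastforce

lemma openin_regular_set: "openin T (regular_set T A X)"
proof (subst openin_subopen, intro ballI)
  fix p assume "p \<in> regular_set T A X"
  then obtain W where W: "openin T W" "p \<in> W" "smooth_immersion_on A W X"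
    unfolding mem_regular_set_iff by blast
  moreover have "W \<subseteq> regular_set T A X"
    unfolding subset_iff mem_regular_set_iff using W by blast
  ultimately show "\<exists>W. openin T W \<and> p \<in> W \<and> W \<subseteq> regular_set T A X" by blast
qed

lemma (in manifold) smooth_immersion_on_regular_set: "smooth_immersion_on A (regular_set T A X) X"
proof (rule smooth_immersion_onI[OF openin_regular_set])
  show "smooth_on A (regular_set T A X) X"
  proof (rule smooth_on_locally)
    show "regular_set T A X \<subseteq> topspace T" by (simp add: regular_set_def)
    fix p assume "p \<in> regular_set T A X"
    then obtain W where W: "openin T W" "p \<in> W" "smooth_immersion_on A W X"
      unfolding mem_regular_set_iff by blast
    have "smooth_on A (regular_set T A X \<inter> W) X"
      by (rule smooth_on_subset[of _ W]) (use W(3) in \<open>auto simp: smooth_immersion_on_def\<close>)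
    then show "\<exists>W. openin T W \<and> p \<in> W \<and> smooth_on A (regular_set T A X \<inter> W) X" using W by blast
  qed
  fix p assume "p \<in> regular_set T A X"
  then obtain W where W: "openin T W" "p \<in> W" "smooth_immersion_on A W X"
    unfolding mem_regular_set_iff by blast
  obtain c where c: "c \<in> A" "p \<in> fst c" using charts_cover openin_subset[OF W(1)] W(2) by blast
  show "\<exists>c\<in>A. p \<in> fst c \<and> chart_normal c X (snd c p) \<noteq> 0"
    using immersion_chart_normal_nz[OF W(3,2) c] c by blast
qed

lemma (in manifold) smooth_on_regular_set: "smooth_on A (regular_set T A X) X"
  using smooth_immersion_on_regular_set by (simp add: smooth_immersion_on_def)

locale decomposed_manifold = manifold T A
  for T :: "'a topology" and A :: "('a, 'n::finite) chart set" +
  fixes k :: nat and M :: "nat \<Rightarrow> 'a set"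
  assumes decomposition: "manifold_decomposition T A k M"
begin

lemma pieces_cover: "(\<Union>i\<in>{1..k}. M i) = topspace T"
  using decomposition by (simp add: manifold_decomposition_def)

lemma closedin_piece: "i \<in> {1..k} \<Longrightarrow> closedin T (M i)"
  using decomposition compactin_imp_closedin_T
  unfolding manifold_decomposition_def submanifold_piecewise_smooth_boundary_def by blast

lemma interior_disjoint_piece:
  assumes "i \<in> {1..k}" "j \<in> {1..k}" "i \<noteq> j"
  shows "T interior_of M i \<inter> M j = {}"
proof -
  have "M i \<inter> M j \<subseteq> T frontier_of M i"
    using decomposition assms unfolding manifold_decomposition_def by blast
  moreover have "T interior_of M i \<subseteq> M i" by (rule interior_of_subset)
  ultimately show ?thesis unfolding frontier_of_def by blast
qed

lemma meets_interior:
  assumes "openin T U" "U \<noteq> {}"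
  obtains i where "i \<in> {1..k}" "U \<inter> T interior_of M i \<noteq> {}"
proof -
  have "U \<subseteq> (\<Union>i\<in>{1..k}. M i)" unfolding pieces_cover by (rule openin_subset[OF assms(1)])
  from finite_closed_cover_interior[where I = "{1..k}" and F = M, OF finite_atLeastAtMost closedin_piece assms this]
  obtain i where "i \<in> {1..k}" "U \<inter> T interior_of M i \<noteq> {}" .
  then show thesis by (rule that)
qed

text \<open>The restriction of \<open>X\<close> to the piece extends smoothly to a neighbourhood of \<open>p\<close>, even if \<open>p\<close> is a boundary
point. The chart normal of the extension is continuous, hence bounded near \<open>p\<close>, and agrees with that
of \<open>X\<close> in the interior of the piece.\<close>

lemma chart_normal_bound_near_piece:
  assumes smooth: "smooth_on A (M i) X" and i: "i \<in> {1..k}"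
    and c: "c \<in> A" and p: "p \<in> fst c"
  shows "\<exists>W B. openin T W \<and> p \<in> W \<and>
    (\<forall>q\<in>W \<inter> fst c \<inter> T interior_of M i. norm (chart_normal c X (snd c q)) \<le> B)"
proof (cases "p \<in> M i")
  case False
  show ?thesis
  proof (intro exI conjI ballI)
    show "openin T (topspace T - M i)" using closedin_piece[OF i] by (simp add: closedin_def)
    show "p \<in> topspace T - M i" using False p is_chart_subset[OF chart[OF c]] by blast
    fix q assume "q \<in> (topspace T - M i) \<inter> fst c \<inter> T interior_of M i"
    then have False using interior_of_subset[of T "M i"] by blast
    then show "norm (chart_normal c X (snd c q)) \<le> 0" ..
  qed
next
  case True
  let ?x = "snd c p"
  have "Cr_on \<infinity> (snd c ` (fst c \<inter> M i)) (X \<circ> chart_inv c)" using smooth c by (simp add: smooth_on_def)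
  moreover have "?x \<in> snd c ` (fst c \<inter> M i)" using True p by blast
  ultimately obtain V g where V: "open V" "?x \<in> V" "\<And>k. Ck_on k V g"
    "\<And>y. y \<in> snd c ` (fst c \<inter> M i) \<Longrightarrow> y \<in> V \<Longrightarrow> (X \<circ> chart_inv c) y = g y"
    by (rule Cr_on_infinityE) blast
  \<comment> \<open>the chart normal of the local extension \<open>g\<close>\<close>
  define G where "G u = cross (\<lambda>l. fder (axis l 1) g u)" for u
  have rows: "Ck_on 0 V (\<lambda>u. frame (axis a 1) (\<lambda>l. fder (axis l 1) g u) b)" for a b
  proof (cases b)
    case None
    then show ?thesis by simp
  next
    case (Some l)
    then show ?thesis using Ck_on_SucD_frechet[OF V(3), of 0 "axis l 1"] by simp
  qed
  have "Ck_on 0 V G"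
    unfolding G_def[abs_def] cross_def by (rule Ck_on_vec_lambda[OF V(1) Ck_on_row_det[OF V(1) rows]])
  then have "continuous_on V (\<lambda>u. norm (G u))" by (simp add: continuous_on_norm)
  then have V': "open (V \<inter> (\<lambda>u. norm (G u)) -` {..<norm (G ?x) + 1})"
    using continuous_open_preimage[OF _ V(1) open_lessThan] by blast
  let ?V' = "V \<inter> (\<lambda>u. norm (G u)) -` {..<norm (G ?x) + 1}"
  let ?W = "{q \<in> fst c. snd c q \<in> ?V'}"
  have "norm (chart_normal c X (snd c q)) \<le> norm (G ?x) + 1" if q: "q \<in> ?W \<inter> fst c \<inter> T interior_of M i" for q
  proof -
    let ?O = "snd c ` (fst c \<inter> T interior_of M i) \<inter> V"
    have O: "open ?O" using chart_image_open[OF chart[OF c] openin_interior_of] V(1) by blast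
    have qO: "snd c q \<in> ?O" using q by auto
    have eq: "g u = (X \<circ> chart_inv c) u" if "u \<in> ?O" for u
      using that V(4)[of u] interior_of_subset[of T "M i"] by auto
    have "g differentiable (at (snd c q))" using V(3)[of "Suc 0"] q by auto
    from frechet_derivative_transform_within_open[OF this O qO eq]
    have "chart_normal c X (snd c q) = G (snd c q)" by (simp only: chart_normal_def G_def)
    then show ?thesis using q by auto
  qed
  moreover have "openin T ?W" by (rule chart_preimage_openin[OF chart[OF c] V'])
  moreover have "p \<in> ?W" using p V(2) by simp
  ultimately show ?thesis by (intro exI[of _ ?W] exI[of _ "norm (G ?x) + 1"] conjI ballI)
qed

text \<open>By compactness, the local bounds combine to a bound that holds near \<open>K\<close> in the interiors of all pieces.
If a regular point of \<open>K\<close> violated it, then so would all points in a neighbourhood, and this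
neighbourhood meets the interior of a piece.\<close>

lemma chart_normal_bounded:
  assumes X: "piecewise_smooth_weak_immersion T A k M X"
    and c: "c \<in> A" and K: "compactin T K" "K \<subseteq> fst c"
  shows "\<exists>B. \<forall>p\<in>K \<inter> regular_set T A X. norm (chart_normal c X (snd c p)) \<le> B"
proof -
  let ?n = "\<lambda>q. norm (chart_normal c X (snd c q))"
  have "\<exists>W B. openin T W \<and> K \<subseteq> W \<and> (\<forall>q\<in>W \<inter> fst c \<inter> T interior_of M i. ?n q \<le> B)"
    if i: "i \<in> {1..k}" for i
  proof -
    have sm: "smooth_on A (M i) X" using X i by (simp add: piecewise_smooth_weak_immersion_def)
    have "\<forall>p\<in>K. \<exists>W B. openin T W \<and> p \<in> W \<and> (\<forall>q\<in>W \<inter> fst c \<inter> T interior_of M i. ?n q \<le> B)"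
      using chart_normal_bound_near_piece[OF sm i c] K(2) by blast
    then obtain W B where W: "\<forall>p\<in>K. openin T (W p) \<and> p \<in> W p \<and>
        (\<forall>q\<in>W p \<inter> fst c \<inter> T interior_of M i. ?n q \<le> B p)"
      by metis
    have "\<exists>\<F>. finite \<F> \<and> \<F> \<subseteq> W ` K \<and> K \<subseteq> \<Union>\<F>"
      by (rule compactinD[OF K(1)]) (use W in auto)
    then obtain P where P: "finite P" "P \<subseteq> K" "K \<subseteq> \<Union>(W ` P)"
      by (metis finite_subset_image)
    have "openin T (\<Union>(W ` P))" using W P(2) by auto
    moreover have "?n q \<le> (\<Sum>p\<in>P. \<bar>B p\<bar>)" if q: "q \<in> \<Union>(W ` P) \<inter> fst c \<inter> T interior_of M i" for q
    proof -
      obtain p where p: "p \<in> P" "q \<in> W p" using q by blast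
      then have "?n q \<le> B p" using W P(2) q by blast
      also have "\<dots> \<le> \<bar>B p\<bar>" by simp
      also have "\<dots> \<le> (\<Sum>p\<in>P. \<bar>B p\<bar>)" by (rule member_le_sum[OF p(1) _ P(1)]) auto
      finally show ?thesis .
    qed
    ultimately show ?thesis using P(3) by blast
  qed
  then have "\<forall>i\<in>{1..k}. \<exists>W B. openin T W \<and> K \<subseteq> W \<and> (\<forall>q\<in>W \<inter> fst c \<inter> T interior_of M i. ?n q \<le> B)"
    by blast
  then obtain W B where W: "\<forall>i\<in>{1..k}. openin T (W i) \<and> K \<subseteq> W i \<and>
      (\<forall>q\<in>W i \<inter> fst c \<inter> T interior_of M i. ?n q \<le> B i)"
    by metis
  define b where "b = (\<Sum>i\<in>{1..k}. \<bar>B i\<bar>)"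
  have Bb: "B i \<le> b" if "i \<in> {1..k}" for i
  proof -
    have "B i \<le> \<bar>B i\<bar>" by simp
    also have "\<dots> \<le> b" unfolding b_def by (rule member_le_sum[OF that]) auto
    finally show ?thesis .
  qed
  show ?thesis
  proof (rule exI[of _ b], rule ballI, rule ccontr)
    fix p assume p: "p \<in> K \<inter> regular_set T A X" and "\<not> ?n p \<le> b"
    then have pb: "?n p > b" by simp
    let ?R = "regular_set T A X"
    have Rsm: "smooth_on A ?R X"
      by (rule smooth_on_regular_set)
    let ?U = "snd c ` (fst c \<inter> ?R)"
    have U: "open ?U" by (rule chart_image_open[OF chart[OF c] openin_regular_set])
    have "continuous_on ?U (\<lambda>u. norm (chart_normal c X u))"
      by (rule continuous_on_norm[OF Ck_on_imp_continuous_on[OF Ck_on_chart_normal[OF openin_regular_set Rsm c, of 0]]])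
    then have V: "open (?U \<inter> (\<lambda>u. norm (chart_normal c X u)) -` {b<..})"
      by (rule continuous_open_preimage[OF _ U open_greaterThan])
    \<comment> \<open>the open set of regular points near \<open>p\<close> at which the bound fails\<close>
    let ?O = "{q \<in> fst c. snd c q \<in> ?U \<inter> (\<lambda>u. norm (chart_normal c X u)) -` {b<..}} \<inter> (\<Inter>i\<in>{1..k}. W i)"
    have "{1..k} \<noteq> {}" using pieces_cover nonempty by (metis UN_empty)
    then have "openin T (\<Inter>i\<in>{1..k}. W i)" using W by (intro openin_INT2) auto
    then have "openin T ?O" by (intro openin_Int chart_preimage_openin[OF chart[OF c] V])
    moreover have "p \<in> ?O" using p pb K(2) W by auto
    then have "?O \<noteq> {}" by blast
    ultimately obtain i where i: "i \<in> {1..k}" "?O \<inter> T interior_of M i \<noteq> {}" by (rule meets_interior)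
    then obtain q where q: "q \<in> ?O" "q \<in> T interior_of M i" by blast
    have "q \<in> W i \<inter> fst c \<inter> T interior_of M i" using q i(1) by blast
    then have "?n q \<le> B i" using W i(1) by blast
    moreover have "?n q > b" using q(1) by simp
    ultimately show False using Bb[OF i(1)] by simp
  qed
qed

end

lemma set_integrable_bounded_continuous:
  fixes f :: "'e::euclidean_space \<Rightarrow> real"
  assumes "E \<in> sets borel" "bounded E" "continuous_on E f" "\<And>x. x \<in> E \<Longrightarrow> \<bar>f x\<bar> \<le> B"
  shows "set_integrable lborel E f"
proof -
  have "(\<lambda>x. indicat_real E x *\<^sub>R f x) \<in> borel_measurable borel"
    by (rule borel_measurable_continuous_on_indicator[OF assms(1,3)])
  moreover have "emeasure lborel E < \<infinity>" by (rule emeasure_bounded_finite[OF assms(2)])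
  ultimately have "integrable lborel (\<lambda>x. indicat_real E x *\<^sub>R (indicat_real E x *\<^sub>R f x))"
    using assms(1,4)
    by (intro integrableI_bounded_set_indicator[where B = B]) (auto simp: indicator_def)
  then show ?thesis
    unfolding set_integrable_def by (rule back_subst[of "integrable lborel"]) (auto simp: indicator_def)
qed

section \<open>Energy and volume in coordinates\<close>

lemma (in manifold) compact_chart_cover_exists: "\<exists>Q. compact_chart_cover T A Q"
proof -
  have "\<exists>c K U. c \<in> A \<and> compactin T K \<and> K \<subseteq> fst c \<and> openin T U \<and> p \<in> U \<and> U \<subseteq> K" if p: "p \<in> topspace T" for p
  proof -
    obtain c where c: "c \<in> A" "p \<in> fst c" using charts_cover[OF p] by blast
    note ch = chart[OF c(1)]
    obtain r where r: "r > 0" "cball (snd c p) r \<subseteq> snd c ` fst c"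
      using is_chart_open_range[OF ch] c(2) open_contains_cball by blast
    let ?K = "chart_inv c ` cball (snd c p) r" and ?U = "{q \<in> fst c. snd c q \<in> ball (snd c p) r}"
    have "compactin T ?K" by (rule chart_inv_compactin[OF ch compact_cball r(2)])
    moreover have "?K \<subseteq> fst c" using r(2) by (intro image_subsetI chart_inv_in) blast
    moreover have "openin T ?U" by (rule chart_preimage_openin[OF ch open_ball])
    moreover have "p \<in> ?U" using c r by simp
    moreover have "?U \<subseteq> ?K"
    proof
      fix q assume q: "q \<in> ?U"
      then have "q = chart_inv c (snd c q)" using chart_inv_left[OF ch, of q] by simp
      moreover have "snd c q \<in> cball (snd c p) r" using q by auto
      ultimately show "q \<in> ?K" by (rule image_eqI)
    qed
    ultimately show ?thesis using c(1) by (intro exI[of _ c] exI[of _ ?K] exI[of _ ?U] conjI)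
  qed
  then have "\<forall>p\<in>topspace T. \<exists>c K U. c \<in> A \<and> compactin T K \<and> K \<subseteq> fst c \<and> openin T U \<and> p \<in> U \<and> U \<subseteq> K"
    by blast
  then obtain c K U where cKU: "\<forall>p\<in>topspace T. c p \<in> A \<and> compactin T (K p) \<and> K p \<subseteq> fst (c p) \<and>
      openin T (U p) \<and> p \<in> U p \<and> U p \<subseteq> K p"
    unfolding bchoice_iff by (elim exE)
  have "compactin T (topspace T)" using compact_space by (simp add: compact_space_def)
  then have "\<exists>\<F>. finite \<F> \<and> \<F> \<subseteq> U ` topspace T \<and> topspace T \<subseteq> \<Union>\<F>"
  proof (rule compactinD)
    show "openin T V" if "V \<in> U ` topspace T" for V using that cKU by fast
    show "topspace T \<subseteq> \<Union>(U ` topspace T)" using cKU by fast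
  qed
  then obtain P where P: "finite P" "P \<subseteq> topspace T" "topspace T \<subseteq> \<Union>(U ` P)"
    by (metis finite_subset_image)
  obtain ps where ps: "set ps = P" using finite_list[OF P(1)] by blast
  let ?Q = "map (\<lambda>p. (c p, K p)) ps"
  have "(\<Union>p\<in>P. K p) = topspace T"
  proof
    show "(\<Union>p\<in>P. K p) \<subseteq> topspace T"
    proof (rule UN_least)
      fix p assume "p \<in> P"
      then have "compactin T (K p)" using cKU P(2) by (meson subsetD)
      then show "K p \<subseteq> topspace T" by (rule compactin_subset_topspace)
    qed
    have "(\<Union>p\<in>P. U p) \<subseteq> (\<Union>p\<in>P. K p)"
    proof (rule UN_mono[OF subset_refl])
      fix p assume "p \<in> P"
      then show "U p \<subseteq> K p" using cKU P(2) by (meson subsetD)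
    qed
    with P(3) show "topspace T \<subseteq> (\<Union>p\<in>P. K p)" by (rule subset_trans)
  qed
  then have "compact_chart_cover T A ?Q"
    using cKU P(2) ps by (auto simp: compact_chart_cover_def subset_iff)
  then show ?thesis ..
qed

text \<open>The cover on which the definition of \<open>hypersurface_integral\<close> is based; its cells are the disjoint sets
obtained by subtracting from each member the preceding ones.\<close>

definition cover :: "'a topology \<Rightarrow> ('a, 'n::finite) chart set \<Rightarrow> (('a, 'n) chart \<times> 'a set) list" where
  "cover T A = (SOME Q. compact_chart_cover T A Q)"

definition cell :: "'a topology \<Rightarrow> ('a, 'n::finite) chart set \<Rightarrow> nat \<Rightarrow> 'a set" where
  "cell T A j = snd (cover T A ! j) - (\<Union>l<j. snd (cover T A ! l))"

abbreviation cell_chart :: "'a topology \<Rightarrow> ('a, 'n::finite) chart set \<Rightarrow> nat \<Rightarrow> ('a, 'n) chart" where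
  "cell_chart T A j \<equiv> fst (cover T A ! j)"

definition cell_coords :: "'a topology \<Rightarrow> ('a, 'n::finite) chart set \<Rightarrow> ('a \<Rightarrow> real ^ 'n option) \<Rightarrow> nat \<Rightarrow> (real ^ 'n) set" where
  "cell_coords T A X j = snd (cell_chart T A j) ` (cell T A j \<inter> regular_set T A X)"

context manifold
begin

lemma
  assumes "j < length (cover T A)"
  shows cell_chart: "cell_chart T A j \<in> A"
    and cell_compact: "compactin T (snd (cover T A ! j))"
    and cell_compact_subset: "snd (cover T A ! j) \<subseteq> fst (cell_chart T A j)"
proof -
  have "compact_chart_cover T A (cover T A)"
    unfolding cover_def by (rule someI_ex[OF compact_chart_cover_exists])
  then have "\<forall>(c, K)\<in>set (cover T A). c \<in> A \<and> compactin T K \<and> K \<subseteq> fst c"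
    by (simp add: compact_chart_cover_def)
  then have "case cover T A ! j of (c, K) \<Rightarrow> c \<in> A \<and> compactin T K \<and> K \<subseteq> fst c"
    using nth_mem[OF assms] by (rule bspec)
  then show "cell_chart T A j \<in> A" "compactin T (snd (cover T A ! j))"
    "snd (cover T A ! j) \<subseteq> fst (cell_chart T A j)"
    by (simp_all add: case_prod_beta)
qed

lemma cover_covers: "(\<Union>j<length (cover T A). snd (cover T A ! j)) = topspace T"
proof -
  have "compact_chart_cover T A (cover T A)"
    unfolding cover_def by (rule someI_ex[OF compact_chart_cover_exists])
  then have "(\<Union>q\<in>set (cover T A). snd q) = topspace T"
    by (simp add: compact_chart_cover_def case_prod_beta)
  then show ?thesis unfolding set_conv_nth by auto
qed

lemma cell_subset: "j < length (cover T A) \<Longrightarrow> cell T A j \<subseteq> fst (cell_chart T A j)"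
  using cell_compact_subset unfolding cell_def by blast

lemma hypersurface_integral_eq:
  "hypersurface_integral T A X f = (\<Sum>j<length (cover T A).
     set_lebesgue_integral lborel (cell_coords T A X j)
       (\<lambda>u. f (chart_inv (cell_chart T A j) u) *
             norm (chart_normal (cell_chart T A j) X u)))"
proof -
  let ?R = "regular_set T A X"
  have "cell T A j - singular_set T A X = cell T A j \<inter> ?R" if j: "j < length (cover T A)" for j
    using cell_subset[OF j] is_chart_subset[OF chart[OF cell_chart[OF j]]]
    unfolding regular_set_def by blast
  moreover have "f (chart_inv (cell_chart T A j) u) * volume_density (cell_chart T A j) X (chart_inv (cell_chart T A j) u)
     = f (chart_inv (cell_chart T A j) u) * norm (chart_normal (cell_chart T A j) X u)"
    if j: "j < length (cover T A)" and u: "u \<in> cell_coords T A X j" for j u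
  proof -
    let ?c = "cell_chart T A j"
    obtain p where p: "p \<in> cell T A j" "p \<in> ?R" "u = snd ?c p" using u unfolding cell_coords_def by blast
    have pc: "p \<in> fst ?c" using p(1) cell_subset[OF j] by blast
    have nz: "chart_normal ?c X (snd ?c p) \<noteq> 0"
      by (rule immersion_chart_normal_nz[OF smooth_immersion_on_regular_set p(2) cell_chart[OF j] pc])
    then show ?thesis
      using volume_density_eq[OF nz] p(3) chart_inv_left[OF chart[OF cell_chart[OF j]] pc] by simp
  qed
  ultimately show ?thesis
    unfolding hypersurface_integral_def Let_def cover_def[symmetric] cell_def[symmetric]
    by (intro sum.cong refl)
      (auto simp: set_lebesgue_integral_def cell_coords_def indicator_def intro!: Bochner_Integration.integral_cong)
qed

lemma
  assumes j: "j < length (cover T A)" and u: "u \<in> cell_coords T A X j"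
  shows cell_coords_regular: "u \<in> snd (cell_chart T A j) ` (fst (cell_chart T A j) \<inter> regular_set T A X)"
    and cell_coords_nz: "chart_normal (cell_chart T A j) X u \<noteq> 0"
    and cell_coords_unit_normal: "unit_normal A X (chart_inv (cell_chart T A j) u) =
      chart_normal (cell_chart T A j) X u /\<^sub>R norm (chart_normal (cell_chart T A j) X u)"
proof -
  let ?c = "cell_chart T A j" and ?R = "regular_set T A X"
  obtain p where p: "p \<in> cell T A j" "p \<in> ?R" "u = snd ?c p" using u unfolding cell_coords_def by blast
  have pc: "p \<in> fst ?c" using p(1) cell_subset[OF j] by blast
  show "u \<in> snd ?c ` (fst ?c \<inter> ?R)" using p pc by blast
  have nz: "chart_normal ?c X (snd ?c p) \<noteq> 0"
    by (rule immersion_chart_normal_nz[OF smooth_immersion_on_regular_set p(2) cell_chart[OF j] pc])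
  then show "chart_normal ?c X u \<noteq> 0" using p(3) by simp
  have "smooth_on A ?R X" by (rule smooth_on_regular_set)
  from unit_normal_eq[OF openin_regular_set this p(2) cell_chart[OF j] pc nz]
  show "unit_normal A X (chart_inv ?c u) = chart_normal ?c X u /\<^sub>R norm (chart_normal ?c X u)"
    using p(3) chart_inv_left[OF chart[OF cell_chart[OF j]] pc] by simp
qed

lemma anisotropic_energy_eq:
  "anisotropic_energy T A \<gamma> X = (\<Sum>j<length (cover T A).
     set_lebesgue_integral lborel (cell_coords T A X j)
       (\<lambda>u. hom_ext \<gamma> (chart_normal (cell_chart T A j) X u)))"
  unfolding anisotropic_energy_def hypersurface_integral_eq
  by (intro sum.cong refl)
    (auto simp: set_lebesgue_integral_def indicator_def cell_coords_unit_normal hom_ext_def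
      intro!: Bochner_Integration.integral_cong)

lemma enclosed_volume_eq:
  "enclosed_volume T A X = (\<Sum>j<length (cover T A).
     set_lebesgue_integral lborel (cell_coords T A X j)
       (\<lambda>u. X (chart_inv (cell_chart T A j) u) \<bullet> chart_normal (cell_chart T A j) X u))
     / (real CARD('n) + 1)"
proof -
  have "hypersurface_integral T A X (\<lambda>p. X p \<bullet> unit_normal A X p) = (\<Sum>j<length (cover T A).
     set_lebesgue_integral lborel (cell_coords T A X j)
       (\<lambda>u. X (chart_inv (cell_chart T A j) u) \<bullet> chart_normal (cell_chart T A j) X u))"
    unfolding hypersurface_integral_eq
    by (intro sum.cong refl)
      (auto simp: set_lebesgue_integral_def indicator_def cell_coords_unit_normal cell_coords_nz
        intro!: Bochner_Integration.integral_cong)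
  then show ?thesis by (simp add: enclosed_volume_def)
qed

text \<open>Under the chart, the cell becomes the intersection of a compact set with an open one.\<close>

lemma cell_coords_borel:
  assumes j: "j < length (cover T A)"
  shows "cell_coords T A X j \<in> sets borel" "bounded (cell_coords T A X j)"
proof -
  let ?c = "cell_chart T A j" and ?K = "\<lambda>l. snd (cover T A ! l)"
  note ch = chart[OF cell_chart[OF j]]
  let ?O = "regular_set T A X \<inter> (topspace T - (\<Union>l<j. ?K l))"
  have "closedin T (\<Union>l<j. ?K l)"
    using compactin_imp_closedin_T[OF cell_compact] j by (intro closedin_Union) auto
  then have O: "openin T ?O" by (intro openin_Int openin_regular_set) (simp add: closedin_def)
  have "cell T A j \<inter> regular_set T A X = ?K j \<inter> ?O"
    using cell_compact_subset[OF j] is_chart_subset[OF ch] unfolding cell_def by blast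
  also have "\<dots> = ?K j \<inter> (fst ?c \<inter> ?O)" using cell_compact_subset[OF j] by blast
  finally have eq: "cell_coords T A X j = snd ?c ` ?K j \<inter> snd ?c ` (fst ?c \<inter> ?O)"
    unfolding cell_coords_def
    by (simp only: inj_on_image_Int[OF is_chart_inj_on[OF ch] cell_compact_subset[OF j] Int_lower1])
  have K: "compact (snd ?c ` ?K j)"
    by (rule chart_image_compact[OF ch cell_compact[OF j] cell_compact_subset[OF j]])
  show "cell_coords T A X j \<in> sets borel"
    unfolding eq using borel_compact[OF K] borel_open[OF chart_image_open[OF ch O]] by (rule sets.Int)
  show "bounded (cell_coords T A X j)"
    unfolding eq using compact_imp_bounded[OF K] by (rule bounded_subset) blast
qed

end

context decomposed_manifold
begin

text \<open>An integrand of at most linear growth in the chart normal is bounded, because the chart normal is.\<close>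

lemma set_integrable_cell:
  fixes h :: "real ^ 'n \<Rightarrow> real ^ 'n option \<Rightarrow> real"
  assumes X: "piecewise_smooth_weak_immersion T A k M X"
    and j: "j < length (cover T A)"
    and cont: "continuous_on (snd (cell_chart T A j) ` fst (cell_chart T A j) \<times> (- {0})) (\<lambda>(u, v). h u v)"
    and bound: "\<And>u v. u \<in> snd (cell_chart T A j) ` fst (cell_chart T A j) \<Longrightarrow> \<bar>h u v\<bar> \<le> b * norm v"
  shows "set_integrable lborel (cell_coords T A X j) (\<lambda>u. h u (chart_normal (cell_chart T A j) X u))"
proof -
  let ?c = "cell_chart T A j" and ?R = "regular_set T A X"
  note ch = chart[OF cell_chart[OF j]]
  obtain B where B: "\<forall>p\<in>snd (cover T A ! j) \<inter> ?R. norm (chart_normal ?c X (snd ?c p)) \<le> B"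
    using chart_normal_bounded[OF X cell_chart[OF j] cell_compact[OF j] cell_compact_subset[OF j]] ..
  have Rsm: "smooth_on A ?R X" by (rule smooth_on_regular_set)
  have sub: "cell_coords T A X j \<subseteq> snd ?c ` (fst ?c \<inter> ?R)" using cell_coords_regular[OF j] by blast
  have contN: "continuous_on (cell_coords T A X j) (chart_normal ?c X)"
    using Ck_on_imp_continuous_on[OF Ck_on_chart_normal[OF openin_regular_set Rsm cell_chart[OF j], of 0]] sub
    by (rule continuous_on_subset)
  have "continuous_on (cell_coords T A X j) (\<lambda>u. (\<lambda>(u, v). h u v) (u, chart_normal ?c X u))"
    by (rule continuous_on_compose2[OF cont])
      (use contN sub cell_coords_nz[OF j] in \<open>auto intro!: continuous_intros\<close>)
  then have cont': "continuous_on (cell_coords T A X j) (\<lambda>u. h u (chart_normal ?c X u))" by simp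
  have "\<bar>h u (chart_normal ?c X u)\<bar> \<le> \<bar>b\<bar> * B" if u: "u \<in> cell_coords T A X j" for u
  proof -
    obtain p where p: "p \<in> cell T A j" "p \<in> ?R" "u = snd ?c p" using u unfolding cell_coords_def by blast
    have "norm (chart_normal ?c X u) \<le> B" using B p unfolding cell_def by blast
    then have "b * norm (chart_normal ?c X u) \<le> \<bar>b\<bar> * B" by (intro mult_mono) auto
    moreover have "u \<in> snd ?c ` fst ?c" using sub u by blast
    ultimately show ?thesis using bound[of u "chart_normal ?c X u"] by linarith
  qed
  then show ?thesis by (rule set_integrable_bounded_continuous[OF cell_coords_borel[OF j] cont'])
qed

lemma set_integrable_energy:
  assumes "Cr_on 2 (sphere 0 1) \<gamma>" "piecewise_smooth_weak_immersion T A k M X" "j < length (cover T A)"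
  shows "set_integrable lborel (cell_coords T A X j) (\<lambda>u. hom_ext \<gamma> (chart_normal (cell_chart T A j) X u))"
proof -
  obtain b where b: "\<forall>v. \<bar>hom_ext \<gamma> v\<bar> \<le> b * norm v" using hom_ext_bound[OF assms(1)] ..
  show ?thesis
  proof (rule set_integrable_cell[OF assms(2,3) _ b[rule_format]])
    have "continuous_on (snd (cell_chart T A j) ` fst (cell_chart T A j) \<times> - {0}) (\<lambda>x. hom_ext \<gamma> (snd x))"
      by (rule continuous_on_compose2[OF Ck_on_imp_continuous_on[OF Ck_on_hom_ext[OF assms(1)]]])
        (auto intro!: continuous_intros)
    then show "continuous_on (snd (cell_chart T A j) ` fst (cell_chart T A j) \<times> - {0}) (\<lambda>(u, v). hom_ext \<gamma> v)"
      by (simp add: case_prod_unfold)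
  qed
qed

lemma set_integrable_volume:
  assumes X: "piecewise_smooth_weak_immersion T A k M X" and j: "j < length (cover T A)"
  shows "set_integrable lborel (cell_coords T A X j)
    (\<lambda>u. X (chart_inv (cell_chart T A j) u) \<bullet> chart_normal (cell_chart T A j) X u)"
proof -
  let ?c = "cell_chart T A j"
  note ch = chart[OF cell_chart[OF j]]
  have Xc: "continuous_map T euclidean X" using X by (simp add: piecewise_smooth_weak_immersion_def)
  have "compactin T (topspace T)" using compact_space by (simp add: compact_space_def)
  from image_compactin[OF this Xc] have "bounded (X ` topspace T)" by (simp add: compact_imp_bounded)
  then obtain b where b: "\<forall>x\<in>X ` topspace T. norm x \<le> b" unfolding bounded_iff by blast
  have "continuous_map (top_of_set (snd ?c ` fst ?c)) euclidean (X \<circ> chart_inv ?c)"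
    by (rule continuous_map_compose[OF chart_continuous_map(2)[OF ch] Xc])
  then have cont: "continuous_on (snd ?c ` fst ?c) (\<lambda>u. X (chart_inv ?c u))" by (simp add: comp_def)
  show ?thesis
  proof (rule set_integrable_cell[OF X j])
    show "\<bar>X (chart_inv ?c u) \<bullet> v\<bar> \<le> b * norm v" if "u \<in> snd ?c ` fst ?c" for u v
    proof -
      have "chart_inv ?c u \<in> topspace T" using chart_inv_in[OF that] is_chart_subset[OF ch] by blast
      then have "norm (X (chart_inv ?c u)) \<le> b" using b by blast
      then have "norm (X (chart_inv ?c u)) * norm v \<le> b * norm v" by (rule mult_right_mono) simp
      then show ?thesis using Cauchy_Schwarz_ineq2[of "X (chart_inv ?c u)" v] by linarith
    qed
    have "continuous_on (snd ?c ` fst ?c \<times> - {0}) (\<lambda>x. X (chart_inv ?c (fst x)))"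
      by (rule continuous_on_compose2[OF cont]) (auto intro!: continuous_intros)
    then have "continuous_on (snd ?c ` fst ?c \<times> - {0}) (\<lambda>x. X (chart_inv ?c (fst x)) \<bullet> snd x)"
      by (intro continuous_on_inner continuous_on_snd continuous_on_id)
    then show "continuous_on (snd ?c ` fst ?c \<times> - {0}) (\<lambda>(u, v). X (chart_inv ?c u) \<bullet> v)"
      by (simp add: case_prod_unfold)
  qed
qed

end

section \<open>Homotheties\<close>

lemma normalize_scaleR:
  fixes v :: "'e::real_normed_vector"
  shows "c > 0 \<Longrightarrow> (c *\<^sub>R v) /\<^sub>R norm (c *\<^sub>R v) = v /\<^sub>R norm v"
  by (cases "v = 0") (simp_all add: field_simps)

context manifold
begin

lemma fder_chart_scaleR:
  assumes "openin T W" "smooth_on A W X" "c \<in> A" "u \<in> snd c ` (fst c \<inter> W)"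
  shows "fder v ((\<lambda>p. a *\<^sub>R X p) \<circ> chart_inv c) u = a *\<^sub>R fder v (X \<circ> chart_inv c) u"
proof -
  have "(X \<circ> chart_inv c) differentiable (at u)"
    using assms(4) smooth_on_differentiable[OF assms(1-3)] by blast
  from fder_bounded_linear[OF bounded_linear_scaleR_right this] show ?thesis
    by (simp add: comp_def)
qed

lemma chart_normal_scaleR:
  assumes "openin T W" "smooth_on A W X" "c \<in> A" "u \<in> snd c ` (fst c \<inter> W)"
  shows "chart_normal c (\<lambda>p. a *\<^sub>R X p) u = a ^ CARD('n) *\<^sub>R chart_normal c X u"
  unfolding chart_normal_def fder_chart_scaleR[OF assms] by (rule cross_scaleR)

lemma smooth_immersion_on_scaleR:
  assumes W: "openin T W" and imm: "smooth_immersion_on A W X" and a: "a > 0"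
  shows "smooth_immersion_on A W (\<lambda>p. a *\<^sub>R X p)"
proof (rule smooth_immersion_onI[OF W])
  have X: "smooth_on A W X" using imm by (simp add: smooth_immersion_on_def)
  show "smooth_on A W (\<lambda>p. a *\<^sub>R X p)" by (rule smooth_on_scaleR[OF smooth_on_const X])
  fix p assume p: "p \<in> W"
  then obtain c where c: "c \<in> A" "p \<in> fst c" using charts_cover openin_subset[OF W] by blast
  then have "snd c p \<in> snd c ` (fst c \<inter> W)" using p by blast
  from chart_normal_scaleR[OF W X c(1) this] immersion_chart_normal_nz[OF imm p c]
  show "\<exists>c\<in>A. p \<in> fst c \<and> chart_normal c (\<lambda>p. a *\<^sub>R X p) (snd c p) \<noteq> 0"
    using a c by (intro bexI[of _ c]) auto
qed

lemma regular_set_scaleR: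
  assumes a: "a > 0"
  shows "regular_set T A (\<lambda>p. a *\<^sub>R X p) = regular_set T A X"
proof -
  have "smooth_immersion_on A W (\<lambda>p. a *\<^sub>R X p) \<longleftrightarrow> smooth_immersion_on A W X" if W: "openin T W" for W
  proof
    assume "smooth_immersion_on A W (\<lambda>p. a *\<^sub>R X p)"
    from smooth_immersion_on_scaleR[OF W this, of "inverse a"] show "smooth_immersion_on A W X"
      using a by simp
  qed (rule smooth_immersion_on_scaleR[OF W _ a])
  then show ?thesis unfolding set_eq_iff mem_regular_set_iff by blast
qed

lemma cell_coords_scaleR: "a > 0 \<Longrightarrow> cell_coords T A (\<lambda>p. a *\<^sub>R X p) j = cell_coords T A X j"
  by (simp add: cell_coords_def regular_set_scaleR)

lemma chart_normal_scaleR_cell: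
  assumes "j < length (cover T A)" "u \<in> cell_coords T A X j"
  shows "chart_normal (cell_chart T A j) (\<lambda>p. a *\<^sub>R X p) u
    = a ^ CARD('n) *\<^sub>R chart_normal (cell_chart T A j) X u"
  by (rule chart_normal_scaleR[OF openin_regular_set _ cell_chart[OF assms(1)] cell_coords_regular[OF assms]])
    (use smooth_immersion_on_regular_set in \<open>simp add: smooth_immersion_on_def\<close>)

lemma anisotropic_energy_scaleR:
  assumes a: "a > 0"
  shows "anisotropic_energy T A \<gamma> (\<lambda>p. a *\<^sub>R X p) = a ^ CARD('n) * anisotropic_energy T A \<gamma> X"
proof -
  have "set_lebesgue_integral lborel (cell_coords T A X j)
       (\<lambda>u. hom_ext \<gamma> (chart_normal (cell_chart T A j) (\<lambda>p. a *\<^sub>R X p) u))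
     = a ^ CARD('n) * set_lebesgue_integral lborel (cell_coords T A X j)
       (\<lambda>u. hom_ext \<gamma> (chart_normal (cell_chart T A j) X u))"
    if j: "j < length (cover T A)" for j
    using a unfolding set_lebesgue_integral_def integral_mult_right_zero[symmetric]
    by (intro Bochner_Integration.integral_cong refl)
      (auto simp: indicator_def chart_normal_scaleR_cell[OF j] hom_ext_scaleR)
  then show ?thesis
    unfolding anisotropic_energy_eq cell_coords_scaleR[OF a] sum_distrib_left by (intro sum.cong) auto
qed

lemma enclosed_volume_scaleR:
  assumes a: "a > 0"
  shows "enclosed_volume T A (\<lambda>p. a *\<^sub>R X p) = a ^ Suc CARD('n) * enclosed_volume T A X"
proof -
  have "set_lebesgue_integral lborel (cell_coords T A X j)
       (\<lambda>u. (a *\<^sub>R X (chart_inv (cell_chart T A j) u)) \<bullet> chart_normal (cell_chart T A j) (\<lambda>p. a *\<^sub>R X p) u)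
     = a ^ Suc CARD('n) * set_lebesgue_integral lborel (cell_coords T A X j)
       (\<lambda>u. X (chart_inv (cell_chart T A j) u) \<bullet> chart_normal (cell_chart T A j) X u)"
    if j: "j < length (cover T A)" for j
    unfolding set_lebesgue_integral_def integral_mult_right_zero[symmetric]
    by (intro Bochner_Integration.integral_cong refl)
      (auto simp: indicator_def chart_normal_scaleR_cell[OF j])
  then show ?thesis
    unfolding enclosed_volume_eq cell_coords_scaleR[OF a] times_divide_eq_right sum_distrib_left
    by (intro arg_cong2[where f = "(/)"] sum.cong) auto
qed

end

lemma Cr_on_product_scaleR:
  assumes "Cr_on \<infinity> I f" "Cr_on \<infinity> S g"
  shows "Cr_on \<infinity> (I \<times> S) (\<lambda>(t, u). f t *\<^sub>R g u)"
proof -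
  have "Cr_on \<infinity> (I \<times> S) (\<lambda>x. f (fst x))"
    by (rule Cr_on_compose[OF Cr_on_bounded_linear[OF bounded_linear_fst] assms(1)]) auto
  moreover have "Cr_on \<infinity> (I \<times> S) (\<lambda>x. g (snd x))"
    by (rule Cr_on_compose[OF Cr_on_bounded_linear[OF bounded_linear_snd] assms(2)]) auto
  ultimately have "Cr_on \<infinity> (I \<times> S) (\<lambda>x. f (fst x) *\<^sub>R g (snd x))" by (rule Cr_on_scaleR)
  then show ?thesis by (simp add: case_prod_unfold)
qed

context decomposed_manifold
begin

lemma weak_immersion_scaleR:
  assumes X: "piecewise_smooth_weak_immersion T A k M X" and a: "a > 0"
  shows "piecewise_smooth_weak_immersion T A k M (\<lambda>p. a *\<^sub>R X p)"
  unfolding piecewise_smooth_weak_immersion_def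
proof (intro conjI ballI)
  have "continuous_map T euclidean X" using X by (simp add: piecewise_smooth_weak_immersion_def)
  moreover have "continuous_map euclidean euclidean (\<lambda>x. a *\<^sub>R x :: real ^ 'n option)"
    by (simp add: continuous_on_scaleR)
  ultimately have "continuous_map T euclidean ((\<lambda>x. a *\<^sub>R x) \<circ> X)" by (rule continuous_map_compose)
  then show "continuous_map T euclidean (\<lambda>p. a *\<^sub>R X p)" by (simp add: comp_def)
next
  fix i assume i: "i \<in> {1..k}"
  from X i have sm: "smooth_on A (M i) X" and imm: "smooth_immersion_on A (T interior_of M i) X"
    and "\<exists>N. smooth_on A (M i) N \<and> (\<forall>p\<in>M i. norm (N p) = 1) \<and>
             (\<forall>p\<in>T interior_of M i. is_unit_normal A X p (N p))"
    by (simp_all add: piecewise_smooth_weak_immersion_def)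
  then obtain N where N: "smooth_on A (M i) N" "\<forall>p\<in>M i. norm (N p) = 1"
    "\<forall>p\<in>T interior_of M i. is_unit_normal A X p (N p)" by blast
  show "smooth_on A (M i) (\<lambda>p. a *\<^sub>R X p)" by (rule smooth_on_scaleR[OF smooth_on_const sm])
  show "smooth_immersion_on A (T interior_of M i) (\<lambda>p. a *\<^sub>R X p)"
    by (rule smooth_immersion_on_scaleR[OF openin_interior_of imm a])
  show "\<exists>N. smooth_on A (M i) N \<and> (\<forall>p\<in>M i. norm (N p) = 1) \<and>
      (\<forall>p\<in>T interior_of M i. is_unit_normal A (\<lambda>p. a *\<^sub>R X p) p (N p))"
  proof (intro exI[of _ N] conjI ballI N(1))
    show "norm (N p) = 1" if "p \<in> M i" for p using N(2) that by blast
    fix p assume p: "p \<in> T interior_of M i"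
    let ?W = "T interior_of M i"
    have W: "openin T ?W" by simp
    have smW: "smooth_on A ?W X" using imm by (simp add: smooth_immersion_on_def)
    have smW': "smooth_on A ?W (\<lambda>p. a *\<^sub>R X p)" by (rule smooth_on_scaleR[OF smooth_on_const smW])
    obtain c where c: "c \<in> A" "p \<in> fst c" using charts_cover openin_subset[OF W] p by blast
    note nz = immersion_chart_normal_nz[OF imm p c]
    have "snd c p \<in> snd c ` (fst c \<inter> ?W)" using c p by blast
    note sc = chart_normal_scaleR[OF W smW c(1) this, of a]
    have nz': "chart_normal c (\<lambda>p. a *\<^sub>R X p) (snd c p) \<noteq> 0" using nz a by (simp add: sc)
    show "is_unit_normal A (\<lambda>p. a *\<^sub>R X p) p (N p)"
      using N(3)[rule_format, OF p] normalize_scaleR[of "a ^ CARD('n)" "chart_normal c X (snd c p)"] a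
      unfolding is_unit_normal_iff[OF W smW p c nz] is_unit_normal_iff[OF W smW' p c nz'] sc by simp
  qed
qed

section \<open>Positivity of the energy\<close>

text \<open>As in \<open>finite_closed_cover_interior\<close>, the members of the cover are removed one after the other. The first
member whose removal leaves nothing yields an open set contained in its cell.\<close>

lemma open_subset_of_cell:
  obtains U i j where "i \<in> {1..k}" "j < length (cover T A)" "openin T U" "U \<noteq> {}"
    "U \<subseteq> T interior_of M i" "U \<subseteq> cell T A j"
proof -
  have "openin T (topspace T)" by simp
  then obtain i where i: "i \<in> {1..k}" "topspace T \<inter> T interior_of M i \<noteq> {}"
    using nonempty by (rule meets_interior)
  let ?K = "\<lambda>l. snd (cover T A ! l)"
  have step: "\<exists>j<m. \<exists>U. openin T U \<and> U \<noteq> {} \<and> U \<subseteq> V \<and> U \<subseteq> cell T A j"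
    if "m \<le> length (cover T A)" "openin T V" "V \<noteq> {}" "V \<subseteq> (\<Union>l<m. ?K l)" for V m
    using that
  proof (induction m)
    case (Suc m)
    show ?case
    proof (cases "V \<subseteq> (\<Union>l<m. ?K l)")
      case True
      then have "\<exists>j<m. \<exists>U. openin T U \<and> U \<noteq> {} \<and> U \<subseteq> V \<and> U \<subseteq> cell T A j"
        using Suc by simp
      then show ?thesis using less_SucI by blast
    next
      case False
      have "closedin T (\<Union>l<m. ?K l)"
        using compactin_imp_closedin_T[OF cell_compact] Suc.prems(1) by (intro closedin_Union) auto
      then have "openin T (V - (\<Union>l<m. ?K l))" using Suc.prems(2) by (rule openin_diff[rotated])
      moreover have "V - (\<Union>l<m. ?K l) \<subseteq> cell T A m"
        using Suc.prems(4) unfolding cell_def lessThan_Suc by blast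
      moreover have "V - (\<Union>l<m. ?K l) \<noteq> {}" using False by blast
      ultimately show ?thesis by (intro exI[of _ m] conjI exI[of _ "V - (\<Union>l<m. ?K l)"]) auto
    qed
  qed simp
  have "T interior_of M i \<subseteq> (\<Union>l<length (cover T A). ?K l)"
    unfolding cover_covers by (rule interior_of_subset_topspace)
  moreover have "T interior_of M i \<noteq> {}" using i(2) by blast
  ultimately obtain j U where "j < length (cover T A)" "openin T U" "U \<noteq> {}"
    "U \<subseteq> T interior_of M i" "U \<subseteq> cell T A j"
    using step[OF order_refl openin_interior_of[of T "M i"]] by metis
  then show thesis by (rule that[OF i(1)])
qed

lemma interior_subset_regular_set:
  assumes "piecewise_smooth_weak_immersion T A k M X" "i \<in> {1..k}"
  shows "T interior_of M i \<subseteq> regular_set T A X"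
proof
  fix p assume "p \<in> T interior_of M i"
  moreover have "smooth_immersion_on A (T interior_of M i) X"
    using assms by (simp add: piecewise_smooth_weak_immersion_def)
  ultimately show "p \<in> regular_set T A X"
    unfolding mem_regular_set_iff by (intro exI[of _ "T interior_of M i"]) simp
qed

text \<open>No summand is negative. The integrand is positive and the cell of \<open>open_subset_of_cell\<close> contains an open
set, which is not negligible; since the integrand is integrable, the integral over this cell cannot
be zero.\<close>

lemma anisotropic_energy_pos:
  assumes X: "piecewise_smooth_weak_immersion T A k M X"
    and \<gamma>: "\<forall>x\<in>sphere 0 1. \<gamma> x > 0" "Cr_on 2 (sphere 0 1) \<gamma>"
  shows "anisotropic_energy T A \<gamma> X > 0"
proof -
  obtain U i j where U: "i \<in> {1..k}" "j < length (cover T A)" "openin T U" "U \<noteq> {}"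
    "U \<subseteq> T interior_of M i" "U \<subseteq> cell T A j" by (rule open_subset_of_cell)
  let ?h = "\<lambda>j u. hom_ext \<gamma> (chart_normal (cell_chart T A j) X u)"
  let ?E = "cell_coords T A X"
  have pos: "?h j u > 0" if "j < length (cover T A)" "u \<in> ?E j" for j u
  proof -
    have "chart_normal (cell_chart T A j) X u \<noteq> 0" by (rule cell_coords_nz[OF that])
    then show ?thesis using \<gamma>(1) by (simp add: hom_ext_def)
  qed
  have nonneg: "set_lebesgue_integral lborel (?E j) (?h j) \<ge> 0" if "j < length (cover T A)" for j
    unfolding set_lebesgue_integral_def
    by (rule integral_nonneg_AE) (use pos[OF that] in \<open>auto simp: indicator_def less_imp_le\<close>)
  have "set_lebesgue_integral lborel (?E j) (?h j) \<noteq> 0"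
  proof
    assume z: "set_lebesgue_integral lborel (?E j) (?h j) = 0"
    have int: "integrable lborel (\<lambda>u. indicat_real (?E j) u *\<^sub>R ?h j u)"
      using set_integrable_energy[OF \<gamma>(2) X U(2)] unfolding set_integrable_def .
    have "AE u in lborel. indicat_real (?E j) u *\<^sub>R ?h j u = 0"
      using z unfolding set_lebesgue_integral_def
      by (subst integral_nonneg_eq_0_iff_AE[symmetric, OF int])
        (use pos[OF U(2)] in \<open>auto simp: indicator_def less_imp_le\<close>)
    then have "AE u in lborel. u \<notin> ?E j"
      by (rule AE_mp) (use pos[OF U(2)] in \<open>auto simp: indicator_def less_le intro!: AE_I2\<close>)
    then have "?E j \<in> null_sets lborel"
      using cell_coords_borel(1)[OF U(2), of X] by (subst (asm) AE_iff_null_sets[symmetric]) auto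
    then have neg: "negligible (?E j)"
      unfolding negligible_iff_null_sets by (rule null_sets_completionI)
    have "U \<subseteq> fst (cell_chart T A j)" using U(6) cell_subset[OF U(2)] by blast
    then have "snd (cell_chart T A j) ` U = snd (cell_chart T A j) ` (fst (cell_chart T A j) \<inter> U)"
      by (simp add: Int_absorb1)
    then have "open (snd (cell_chart T A j) ` U)"
      using chart_image_open[OF chart[OF cell_chart[OF U(2)]] U(3)] by simp
    moreover have "snd (cell_chart T A j) ` U \<subseteq> ?E j"
      unfolding cell_coords_def using U(5,6) interior_subset_regular_set[OF X U(1)] by blast
    ultimately show False
      using open_not_negligible negligible_subset[OF neg] U(4) by (metis image_is_empty)
  qed
  then have "set_lebesgue_integral lborel (?E j) (?h j) > 0" using nonneg[OF U(2)] by simp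
  then show ?thesis
    unfolding anisotropic_energy_eq using U(2) nonneg by (intro sum_pos2[of _ j]) auto
qed

lemma not_critical_point:
  assumes X: "piecewise_smooth_weak_immersion T A k M X"
    and \<gamma>: "\<forall>x\<in>sphere 0 1. \<gamma> x > 0" "Cr_on 2 (sphere 0 1) \<gamma>"
  shows "\<not> critical_point T A k M \<gamma> X"
proof
  assume crit: "critical_point T A k M \<gamma> X"
  let ?Y = "\<lambda>t p. (1 + t) *\<^sub>R X p"
  let ?F = "anisotropic_energy T A \<gamma> X"
  have "variation T A k M X ?Y"
    unfolding variation_def
  proof (intro conjI ballI exI[of _ 1])
    show "piecewise_smooth_weak_immersion T A k M (?Y t)" if "t \<in> {-1<..<1}" for t
      by (rule weak_immersion_scaleR[OF X]) (use that in auto)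
    fix i c assume ic: "i \<in> {1..k}" "c \<in> A"
    have "smooth_on A (M i) X" using X ic by (simp add: piecewise_smooth_weak_immersion_def)
    then have "Cr_on \<infinity> (snd c ` (fst c \<inter> M i)) (X \<circ> chart_inv c)" using ic by (simp add: smooth_on_def)
    moreover have "Cr_on \<infinity> {-1<..<1} (\<lambda>t::real. 1 + t)"
      by (intro Cr_on_add Cr_on_const Cr_on_bounded_linear bounded_linear_ident)
    ultimately have "Cr_on \<infinity> ({-1<..<1} \<times> snd c ` (fst c \<inter> M i)) (\<lambda>(t, u). (1 + t) *\<^sub>R (X \<circ> chart_inv c) u)"
      by (intro Cr_on_product_scaleR)
    then show "Cr_on \<infinity> ({-1<..<1} \<times> snd c ` (fst c \<inter> M i)) (\<lambda>(t, u). (1 + t) *\<^sub>R X (chart_inv c u))"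
      by (simp add: comp_def)
  qed auto
  then have "((\<lambda>t. anisotropic_energy T A \<gamma> (?Y t)) has_real_derivative 0) (at 0)"
    using crit unfolding critical_point_def by blast
  moreover have "((\<lambda>t. anisotropic_energy T A \<gamma> (?Y t)) has_real_derivative real CARD('n) * ?F) (at 0)"
  proof (rule has_field_derivative_transform_within_open[of "\<lambda>t. (1 + t) ^ CARD('n) * ?F" _ _ "{-1<..}"])
    show "((\<lambda>t. (1 + t) ^ CARD('n) * ?F) has_real_derivative real CARD('n) * ?F) (at 0)"
      by (auto intro!: derivative_eq_intros)
    show "(1 + t) ^ CARD('n) * ?F = anisotropic_energy T A \<gamma> (?Y t)" if "t \<in> {-1<..}" for t
      using that by (subst anisotropic_energy_scaleR) auto
  qed auto
  ultimately have "real CARD('n) * ?F = 0" using DERIV_unique by blast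
  then show False using anisotropic_energy_pos[OF X \<gamma>] by simp
qed

end

section \<open>The trace of the differential of the Cahn--Hoffman field\<close>

lemma matrix_mult_left_cancel:
  fixes D :: "real ^ 'n::finite ^ 'm::finite" and L L' :: "real ^ 'n ^ 'n"
  assumes "inj ((*v) D)" "D ** L = D ** L'"
  shows "L = L'"
proof -
  have "L *v x = L' *v x" for x
  proof (rule injD[OF assms(1)])
    show "D *v (L *v x) = D *v (L' *v x)" using assms(2) by (simp add: matrix_vector_mul_assoc)
  qed
  then show ?thesis by (simp add: matrix_eq)
qed

context manifold
begin

text \<open>Up to a positive factor the unit normal is the chart normal, and \<open>hom_grad \<gamma>\<close> is homogeneous of degree
zero, so \<open>\<xi> \<circ> \<nu>\<close> is the differentiable function \<open>\<eta>\<close> in coordinates. Its partial derivatives are tangential by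
\<open>fder_hom_grad_orthogonal\<close>.\<close>

lemma cahn_hoffman_in_chart:
  fixes X \<gamma>
  assumes \<gamma>: "Cr_on 2 (sphere 0 1) \<gamma>" and p: "p \<in> regular_set T A X" and c: "c \<in> A" "p \<in> fst c"
  defines "f \<equiv> \<lambda>q. cahn_hoffman \<gamma> (unit_normal A X q)"
    and "\<eta> \<equiv> \<lambda>u. hom_grad \<gamma> (chart_normal c X u)"
  shows "(f \<circ> chart_inv c) differentiable (at (snd c p))"
    and "column l (diff_matrix c f p) = fder (axis l 1) \<eta> (snd c p)"
    and "\<exists>L. diff_matrix c f p = diff_matrix c X p ** L"
proof -
  let ?R = "regular_set T A X" and ?N = "chart_normal c X"
  let ?U = "snd c ` (fst c \<inter> ?R)"
  have Rsm: "smooth_on A ?R X" by (rule smooth_on_regular_set)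
  note U = chart_image_open[OF chart[OF c(1)] openin_regular_set[of T A X]]
  have pU: "snd c p \<in> ?U" using p c by blast
  have nz: "?N u \<noteq> 0" if "u \<in> ?U" for u
    using that immersion_chart_normal_nz[OF smooth_immersion_on_regular_set _ c(1)] by blast
  have eq: "\<eta> u = (f \<circ> chart_inv c) u" if u: "u \<in> ?U" for u
  proof -
    obtain q where q: "q \<in> fst c" "q \<in> ?R" "u = snd c q" using u by auto
    have nq: "?N (snd c q) \<noteq> 0" using nz[OF u] q(3) by simp
    have "unit_normal A X q = ?N u /\<^sub>R norm (?N u)"
      using unit_normal_eq[OF openin_regular_set Rsm q(2) c(1) q(1) nq] q(3) by simp
    moreover have "cahn_hoffman \<gamma> (?N u /\<^sub>R norm (?N u)) = hom_grad \<gamma> (?N u /\<^sub>R norm (?N u))"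
      by (rule cahn_hoffman_eq_hom_grad[OF \<gamma>]) (use nz[OF u] in simp)
    moreover have "hom_grad \<gamma> (?N u /\<^sub>R norm (?N u)) = hom_grad \<gamma> (?N u)"
      by (rule hom_grad_scaleR[OF \<gamma>]) (use nz[OF u] in auto)
    ultimately show ?thesis
      using q chart_inv_left[OF chart[OF c(1)] q(1)] by (simp add: f_def \<eta>_def)
  qed
  note NC = Ck_on_chart_normal[OF openin_regular_set Rsm c(1)]
  have "Ck_on 1 ?U \<eta>"
    unfolding \<eta>_def by (rule Ck_on_compose[OF U open_nonzero _ NC Ck_on_hom_grad[OF \<gamma>]]) (use nz in auto)
  then have d\<eta>: "\<eta> differentiable (at (snd c p))" using pU by auto
  from frechet_derivative_transform_within_open[OF d\<eta> U pU eq]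
  have der: "frechet_derivative \<eta> (at (snd c p)) = frechet_derivative (f \<circ> chart_inv c) (at (snd c p))" .
  show "(f \<circ> chart_inv c) differentiable (at (snd c p))"
  proof -
    have "(\<eta> has_derivative frechet_derivative \<eta> (at (snd c p))) (at (snd c p))"
      using d\<eta> by (simp only: frechet_derivative_works)
    from has_derivative_transform_within_open[OF this U pU] show ?thesis
      using eq by (intro differentiableI) blast
  qed
  show col: "column l (diff_matrix c f p) = fder (axis l 1) \<eta> (snd c p)" for l
    unfolding column_diff_matrix der ..
  have dN: "?N differentiable (at (snd c p))" using NC[of "Suc 0"] pU by auto
  have "column l (diff_matrix c f p) \<bullet> ?N (snd c p) = 0" for l
    unfolding col \<eta>_def by (rule fder_hom_grad_orthogonal[OF \<gamma> U pU dN nz])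
  then have "\<exists>y. column l (diff_matrix c f p) = diff_matrix c X p *v y" for l
    using orthogonal_cross_imp_range[of "diff_matrix c X p" "column l (diff_matrix c f p)"] nz[OF pU]
    unfolding cross_diff_matrix by metis
  then obtain y where y: "\<And>l. column l (diff_matrix c f p) = diff_matrix c X p *v y l" by metis
  have "diff_matrix c f p = diff_matrix c X p ** (\<chi> m l. y l $ m)"
  proof -
    have "diff_matrix c f p $ a $ l = (diff_matrix c X p ** (\<chi> m l. y l $ m)) $ a $ l" for a l
      using y[of l] by (simp add: vec_eq_iff column_def matrix_matrix_mult_def matrix_vector_mult_def)
    then show ?thesis by (simp add: vec_eq_iff)
  qed
  then show "\<exists>L. diff_matrix c f p = diff_matrix c X p ** L" ..
qed

text \<open>The mean curvature is defined with a chart chosen separately at each point. Passing from that chart to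
the given one conjugates the matrix of the endomorphism by the Jacobian of the transition map and
hence preserves its trace.\<close>

lemma anisotropic_mean_curvature_eq_trace:
  fixes X \<gamma>
  assumes \<gamma>: "Cr_on 2 (sphere 0 1) \<gamma>" and p: "p \<in> regular_set T A X" and c: "c \<in> A" "p \<in> fst c"
  shows "\<exists>L. (\<forall>l. fder (axis l 1) (\<lambda>u. hom_grad \<gamma> (chart_normal c X u)) (snd c p)
            = (\<Sum>m\<in>UNIV. L $ m $ l *\<^sub>R fder (axis m 1) (X \<circ> chart_inv c) (snd c p)))
          \<and> trace L = - real CARD('n) * anisotropic_mean_curvature A \<gamma> X p"
proof -
  let ?f = "\<lambda>q. cahn_hoffman \<gamma> (unit_normal A X q)"
  let ?R = "regular_set T A X"
  define d where "d = (SOME c. c \<in> A \<and> p \<in> fst c)"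
  have "d \<in> A \<and> p \<in> fst d" unfolding d_def by (rule someI[of _ c]) (use c in blast)
  then have d: "d \<in> A" "p \<in> fst d" by auto
  note fc = cahn_hoffman_in_chart[OF \<gamma> p c]
  obtain L where L: "diff_matrix c ?f p = diff_matrix c X p ** L" using fc(3) by blast
  have Rsm: "smooth_on A ?R X" by (rule smooth_on_regular_set)
  have dX: "(X \<circ> chart_inv c) differentiable (at (snd c p))"
    by (rule smooth_on_differentiable[OF openin_regular_set Rsm c(1) p c(2)])
  define J where "J = jacobian (snd c \<circ> chart_inv d) (at (snd d p))"
  have JX: "diff_matrix d X p = diff_matrix c X p ** J" and detJ: "det J > 0"
    unfolding J_def using diff_matrix_change[OF c(1) d(1) c(2) d(2) dX] by auto
  have Jf: "diff_matrix d ?f p = diff_matrix c ?f p ** J"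
    unfolding J_def by (rule diff_matrix_change(1)[OF c(1) d(1) c(2) d(2) fc(1)])
  have "invertible J" using detJ by (simp add: invertible_det_nz)
  then obtain K where inv: "J ** K = mat 1" unfolding invertible_def by blast
  \<comment> \<open>the matrix in the coordinates of \<open>d\<close>, conjugate to \<open>L\<close>\<close>
  define L' where "L' = K ** (L ** J)"
  have "diff_matrix d X p ** L' = diff_matrix c X p ** ((J ** K) ** (L ** J))"
    unfolding JX L'_def by (simp only: matrix_mul_assoc)
  also have "\<dots> = diff_matrix d ?f p" unfolding Jf L inv by (simp add: matrix_mul_assoc)
  finally have L': "diff_matrix d ?f p = diff_matrix d X p ** L'" ..
  have "inj ((*v) (diff_matrix d X p))"
    using smooth_immersion_on_regular_set p d unfolding smooth_immersion_on_def by blast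
  then have "(THE L. diff_matrix d ?f p = diff_matrix d X p ** L) = L'"
    using L' matrix_mult_left_cancel by (intro the_equality) auto
  then have "anisotropic_mean_curvature A \<gamma> X p = - trace L' / real CARD('n)"
    by (simp add: anisotropic_mean_curvature_def Let_def d_def[symmetric])
  moreover have "trace L' = trace L"
    unfolding L'_def by (subst trace_mul_sym) (simp add: matrix_mul_assoc[symmetric] inv)
  ultimately have "trace L = - real CARD('n) * anisotropic_mean_curvature A \<gamma> X p" by simp
  moreover have "fder (axis l 1) (\<lambda>u. hom_grad \<gamma> (chart_normal c X u)) (snd c p)
            = (\<Sum>m\<in>UNIV. L $ m $ l *\<^sub>R fder (axis m 1) (X \<circ> chart_inv c) (snd c p))" for l
    using fc(2)[of l, symmetric] unfolding L column_matrix_mult column_diff_matrix[of _ c X] .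
  ultimately show ?thesis by blast
qed

section \<open>Local perturbations\<close>

lemma diff_matrix_cong:
  assumes "openin T W" "smooth_on A W X" "\<And>q. q \<in> W \<Longrightarrow> X q = Y q" "p \<in> W" "c \<in> A" "p \<in> fst c"
  shows "diff_matrix c Y p = diff_matrix c X p"
proof -
  have U: "open (snd c ` (fst c \<inter> W))" by (rule chart_image_open[OF chart[OF assms(5)] assms(1)])
  have pU: "snd c p \<in> snd c ` (fst c \<inter> W)" using assms by blast
  have eq: "(X \<circ> chart_inv c) u = (Y \<circ> chart_inv c) u" if "u \<in> snd c ` (fst c \<inter> W)" for u
    using that assms(3) chart_inv_left[OF chart[OF assms(5)]] by auto
  from frechet_derivative_transform_within_open[OF smooth_on_differentiable[OF assms(1,2,5,4,6)] U pU eq]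
  show ?thesis by (simp only: diff_matrix_def jacobian_def)
qed

lemma chart_normal_cong:
  assumes "openin T W" "smooth_on A W X" "\<And>q. q \<in> W \<Longrightarrow> X q = Y q" "p \<in> W" "c \<in> A" "p \<in> fst c"
  shows "chart_normal c Y (snd c p) = chart_normal c X (snd c p)"
  using diff_matrix_cong[OF assms] by (simp flip: cross_diff_matrix)

lemma smooth_immersion_on_cong:
  assumes "openin T W" "smooth_immersion_on A W X" "\<And>q. q \<in> W \<Longrightarrow> X q = Y q"
  shows "smooth_immersion_on A W Y"
  unfolding smooth_immersion_on_def
proof (intro conjI ballI impI)
  have X: "smooth_on A W X" using assms(2) by (simp add: smooth_immersion_on_def)
  show "smooth_on A W Y" by (rule smooth_on_cong[OF X assms(3)])
  fix p c assume "p \<in> W" "c \<in> A" "p \<in> fst c"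
  then show "inj ((*v) (diff_matrix c Y p))"
    using diff_matrix_cong[OF assms(1) X assms(3)] assms(2) by (simp add: smooth_immersion_on_def)
qed

lemma regular_set_transfer:
  assumes "openin T W" "\<And>q. q \<in> W \<Longrightarrow> X q = Y q" "p \<in> W" "p \<in> regular_set T A X"
  shows "p \<in> regular_set T A Y"
proof -
  obtain V where V: "openin T V" "p \<in> V" "smooth_immersion_on A V X"
    using assms(4) unfolding mem_regular_set_iff by blast
  have op: "openin T (V \<inter> W)" using V(1) assms(1) by (rule openin_Int)
  have "smooth_immersion_on A (V \<inter> W) X" by (rule smooth_immersion_on_subset[OF V(3)]) blast
  then have "smooth_immersion_on A (V \<inter> W) Y"
    by (rule smooth_immersion_on_cong[OF op]) (use assms(2) in blast)
  then show ?thesis using op V(2) assms(3) unfolding mem_regular_set_iff by blast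
qed

lemma smooth_on_imp_continuous_map:
  fixes f :: "'a \<Rightarrow> 'b::euclidean_space"
  assumes "smooth_on A (topspace T) f"
  shows "continuous_map T euclidean f"
  unfolding continuous_map_def
proof (intro conjI allI impI)
  fix U :: "'b set" assume "openin euclidean U"
  then have U: "open U" by simp
  show "openin T {x \<in> topspace T. f x \<in> U}"
  proof (subst openin_subopen, intro ballI)
    fix p assume p: "p \<in> {x \<in> topspace T. f x \<in> U}"
    then obtain c where c: "c \<in> A" "p \<in> fst c" using charts_cover by blast
    note ch = chart[OF c(1)]
    let ?S = "snd c ` fst c"
    have "Cr_on \<infinity> (snd c ` (fst c \<inter> topspace T)) (f \<circ> chart_inv c)"
      using assms c(1) by (simp add: smooth_on_def)
    moreover have "fst c \<inter> topspace T = fst c" using is_chart_subset[OF ch] by blast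
    ultimately have "continuous_on ?S (f \<circ> chart_inv c)" using Cr_on_imp_continuous_on by metis
    then have V: "open (?S \<inter> (f \<circ> chart_inv c) -` U)"
      by (rule continuous_open_preimage[OF _ is_chart_open_range[OF ch] U])
    let ?W = "{q \<in> fst c. snd c q \<in> ?S \<inter> (f \<circ> chart_inv c) -` U}"
    have "p \<in> ?W" using p c chart_inv_left[OF ch c(2)] by simp
    moreover have "?W \<subseteq> {x \<in> topspace T. f x \<in> U}"
    proof
      fix q assume q: "q \<in> ?W"
      then show "q \<in> {x \<in> topspace T. f x \<in> U}"
        using chart_inv_left[OF ch, of q] is_chart_subset[OF ch] by auto
    qed
    ultimately show "\<exists>W. openin T W \<and> p \<in> W \<and> W \<subseteq> {x \<in> topspace T. f x \<in> U}"
      using chart_preimage_openin[OF ch V] by (intro exI[of _ ?W] conjI)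
  qed
qed auto

end

section \<open>Perturbation by a bump in one cell\<close>

lemma cross_rank_one:
  "cross (\<lambda>l. v l + \<alpha> l *\<^sub>R w) = cross v + (\<Sum>l\<in>UNIV. \<alpha> l *\<^sub>R cross (v(l := w)))"
proof -
  have "row_det (frame e (\<lambda>l. v l + \<alpha> l *\<^sub>R w))
     = row_det (frame e v) + (\<Sum>l\<in>UNIV. \<alpha> l * row_det (frame e (v(l := w))))" for e
  proof -
    have "frame e (\<lambda>l. v l + \<alpha> l *\<^sub>R w) = (\<lambda>b. frame e v b + case_option 0 \<alpha> b *\<^sub>R w)"
      by (auto simp: fun_eq_iff split: option.splits)
    then have "row_det (frame e (\<lambda>l. v l + \<alpha> l *\<^sub>R w))
       = row_det (frame e v) + (\<Sum>b\<in>UNIV. case_option 0 \<alpha> b * row_det ((frame e v)(b := w)))"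
      by (simp only: row_det_rank_one)
    also have "(\<Sum>b\<in>UNIV. case_option 0 \<alpha> b * row_det ((frame e v)(b := w)))
       = (\<Sum>l\<in>UNIV. \<alpha> l * row_det (frame e (v(l := w))))"
      by (simp only: sum_option option.case frame_upd_Some mult_zero_left add_0_left)
    finally show ?thesis .
  qed
  then show ?thesis by (simp add: cross_def vec_eq_iff)
qed

text \<open>The set \<open>U\<close> lies inside a single cell and a single piece, and the support of \<open>\<phi>\<close> in the coordinates of
that cell is contained in a box in the image of \<open>U\<close>. Hence the perturbed maps \<open>Z s\<close> differ from \<open>X\<close> only in
\<open>U\<close>.\<close>

locale bump_perturbation = decomposed_manifold T A k M
  for T :: "'a topology" and A :: "('a, 'n::finite) chart set" and k :: nat and M :: "nat \<Rightarrow> 'a set" +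
  fixes X :: "'a \<Rightarrow> real ^ 'n option" and i j :: nat and U :: "'a set"
    and \<phi> :: "real ^ 'n \<Rightarrow> real" and a b :: "real ^ 'n" and w :: "real ^ 'n option"
  assumes X: "piecewise_smooth_weak_immersion T A k M X"
    and i: "i \<in> {1..k}" and j: "j < length (cover T A)"
    and U: "openin T U" "U \<subseteq> T interior_of M i" "U \<subseteq> cell T A j"
    and \<phi>: "\<And>k. Ck_on k UNIV \<phi>" "\<And>u. u \<notin> cbox a b \<Longrightarrow> \<phi> u = 0"
    and box: "cbox a b \<subseteq> snd (cell_chart T A j) ` U"
begin

abbreviation "c \<equiv> cell_chart T A j"
abbreviation "N \<equiv> chart_normal c X"

definition D :: "(real ^ 'n) set" where "D = snd c ` U"
definition V :: "real ^ 'n \<Rightarrow> 'n \<Rightarrow> real ^ 'n option" where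
  "V u l = fder (axis l 1) (X \<circ> chart_inv c) u"
text \<open>The derivative of the chart normal of \<open>Z s\<close> with respect to \<open>s\<close>, cf. \<open>chart_normal_Z\<close>.\<close>

definition dN :: "real ^ 'n \<Rightarrow> real ^ 'n option" where
  "dN u = (\<Sum>l\<in>UNIV. fder (axis l 1) \<phi> u *\<^sub>R cross ((V u)(l := w)))"
definition bump :: "'a \<Rightarrow> real" where "bump p = (if p \<in> fst c then \<phi> (snd c p) else 0)"
definition Z :: "real \<Rightarrow> 'a \<Rightarrow> real ^ 'n option" where "Z s p = X p + (s * bump p) *\<^sub>R w"
definition outside :: "'a set" where "outside = topspace T - chart_inv c ` cbox a b"
text \<open>The values of \<open>s\<close> for which \<open>Z s\<close> is an immersion on \<open>U\<close>.\<close>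

definition admissible :: "real \<Rightarrow> bool" where "admissible s \<longleftrightarrow> (\<forall>u\<in>D. N u + s *\<^sub>R dN u \<noteq> 0)"

lemma c: "c \<in> A" and ch: "is_chart T c"
  using cell_chart[OF j] chart by auto

lemma U_subset: "U \<subseteq> fst c"
  using U(3) cell_subset[OF j] by blast

lemma D_eq: "D = snd c ` (fst c \<inter> U)"
  unfolding D_def using U_subset by (simp add: Int_absorb1)

lemma open_D: "open D"
  unfolding D_eq by (rule chart_image_open[OF ch U(1)])

lemma box_D: "cbox a b \<subseteq> D"
  using box by (simp add: D_def)

lemma smooth_immersion_U: "smooth_immersion_on A U X"
  using X i by (auto intro: smooth_immersion_on_subset[OF _ U(2)] simp: piecewise_smooth_weak_immersion_def)

lemma smooth_U: "smooth_on A U X"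
  using smooth_immersion_U by (simp add: smooth_immersion_on_def)

lemma Ck_X: "Ck_on m D (X \<circ> chart_inv c)"
  unfolding D_eq by (rule smooth_onD_Ck[OF ch U(1) smooth_U c])

lemma Ck_N: "Ck_on m D N"
  unfolding D_eq by (rule Ck_on_chart_normal[OF U(1) smooth_U c])

lemma N_nz: "u \<in> D \<Longrightarrow> N u \<noteq> 0"
  unfolding D_eq using immersion_chart_normal_nz[OF smooth_immersion_U _ c] by blast

lemma N_eq: "N u = cross (V u)"
  by (simp only: chart_normal_def V_def[abs_def])

lemma support_subset: "chart_inv c ` cbox a b \<subseteq> U"
proof
  fix p assume "p \<in> chart_inv c ` cbox a b"
  then obtain q where "q \<in> U" "p = chart_inv c (snd c q)" using box by blast
  then show "p \<in> U" using chart_inv_left[OF ch] U_subset by auto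
qed

lemma openin_outside: "openin T outside"
proof -
  have "compactin T (chart_inv c ` cbox a b)"
    by (rule chart_inv_compactin[OF ch compact_cbox]) (use box U_subset in blast)
  then show ?thesis using compactin_imp_closedin_T by (simp add: outside_def closedin_def)
qed

lemma U_or_outside: "p \<in> topspace T \<Longrightarrow> p \<in> U \<or> p \<in> outside"
  using support_subset by (auto simp: outside_def)

lemma bump_outside: "p \<in> outside \<Longrightarrow> bump p = 0"
proof -
  assume p: "p \<in> outside"
  have "snd c p \<notin> cbox a b" if "p \<in> fst c"
    using p chart_inv_left[OF ch that] unfolding outside_def by (metis DiffD2 image_eqI)
  then show "bump p = 0" using \<phi>(2) by (simp add: bump_def)
qed

lemma Z_outside: "p \<in> outside \<Longrightarrow> Z s p = X p"
  by (simp add: Z_def bump_outside)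

lemma bump_smooth: "S \<subseteq> topspace T \<Longrightarrow> smooth_on A S bump"
  unfolding bump_def[abs_def]
  by (rule smooth_on_subset[OF smooth_on_chart_function[OF c \<phi>(1) compact_cbox _ \<phi>(2)]])
    (use subset_trans[OF box image_mono[OF U_subset]] in auto)

lemma Z_smooth:
  assumes "smooth_on A S X" "S \<subseteq> topspace T"
  shows "smooth_on A S (Z s)"
proof -
  have "smooth_on A S (\<lambda>p. bump p *\<^sub>R (s *\<^sub>R w))"
    by (rule smooth_on_scaleR[OF bump_smooth[OF assms(2)] smooth_on_const])
  from smooth_on_add[OF assms(1) this] show ?thesis
    by (simp add: Z_def[abs_def] mult.commute)
qed

lemma Z_in_chart: "u \<in> D \<Longrightarrow> Z s (chart_inv c u) = X (chart_inv c u) + (s * \<phi> u) *\<^sub>R w"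
  using chart_inv_right chart_inv_in U_subset by (auto simp: Z_def bump_def D_def chart_inv_left[OF ch])

text \<open>The differential of \<open>Z s\<close> is that of \<open>X\<close> plus the matrix \<open>s w (\<partial> \<phi>)\<^sup>T\<close> of rank one, so the dependence on \<open>s\<close> is
exactly affine.\<close>

lemma chart_normal_Z:
  assumes u: "u \<in> D"
  shows "chart_normal c (Z s) u = N u + s *\<^sub>R dN u"
proof -
  have dX: "((X \<circ> chart_inv c) has_derivative (\<lambda>h. fder h (X \<circ> chart_inv c) u)) (at u)"
    using Ck_on_SucD_has_derivative[OF Ck_X u] .
  have d\<phi>: "(\<phi> has_derivative (\<lambda>h. fder h \<phi> u)) (at u)"
    using Ck_on_SucD_has_derivative[OF \<phi>(1) UNIV_I] .
  have "((\<lambda>u. (X \<circ> chart_inv c) u + \<phi> u *\<^sub>R (s *\<^sub>R w)) has_derivative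
      (\<lambda>h. fder h (X \<circ> chart_inv c) u + fder h \<phi> u *\<^sub>R (s *\<^sub>R w))) (at u)"
    by (rule has_derivative_add[OF dX bounded_linear.has_derivative[OF bounded_linear_scaleR_left d\<phi>]])
  then have "((Z s \<circ> chart_inv c) has_derivative
      (\<lambda>h. fder h (X \<circ> chart_inv c) u + fder h \<phi> u *\<^sub>R (s *\<^sub>R w))) (at u)"
    by (rule has_derivative_transform_within_open[OF _ open_D u]) (simp add: Z_in_chart mult.commute)
  from frechet_derivative_at[OF this, symmetric]
  have "fder (axis l 1) (Z s \<circ> chart_inv c) u = V u l + (s * fder (axis l 1) \<phi> u) *\<^sub>R w" for l
    by (simp add: V_def mult.commute)
  then have "chart_normal c (Z s) u = cross (\<lambda>l. V u l + (s * fder (axis l 1) \<phi> u) *\<^sub>R w)"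
    unfolding chart_normal_def by simp
  then show ?thesis
    unfolding cross_rank_one by (simp add: N_eq dN_def scaleR_sum_right)
qed

lemma dN_off_box: "u \<notin> cbox a b \<Longrightarrow> dN u = 0"
proof -
  assume u: "u \<notin> cbox a b"
  have "open (- cbox a b)" by (simp add: closed_cbox open_Compl)
  then have "frechet_derivative (\<lambda>_. 0) (at u) = frechet_derivative \<phi> (at u)"
    using u \<phi>(2) by (intro frechet_derivative_transform_within_open[of _ _ "- cbox a b"]) auto
  then have "fder v \<phi> u = 0" for v by (metis frechet_derivative_const)
  then show ?thesis by (simp add: dN_def)
qed

lemma inner_dN: "e \<bullet> dN u = (\<Sum>l\<in>UNIV. fder (axis l 1) \<phi> u * row_det (frame e ((V u)(l := w))))"
  by (simp add: dN_def inner_sum_right row_det_frame)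

lemma w_inner_dN: "w \<bullet> dN u = 0"
proof -
  have "row_det (frame w ((V u)(l := w))) = 0" for l
    by (rule row_det_identical[of None "Some l"]) auto
  then show ?thesis by (simp add: inner_dN)
qed

lemma continuous_dN: "continuous_on D dN"
proof -
  have "Ck_on 0 D (\<lambda>u. cross ((V u)(l := w)))" for l
  proof -
    have rows: "Ck_on 0 D (\<lambda>u. frame (axis e 1) ((V u)(l := w)) b)" for e b
    proof (cases b)
      case (Some m)
      then show ?thesis
        using Ck_on_SucD_frechet[OF Ck_X, of 0 "axis m 1"] by (cases "m = l") (simp_all add: V_def)
    qed simp
    show ?thesis
      unfolding cross_def by (rule Ck_on_vec_lambda[OF open_D Ck_on_row_det[OF open_D rows]])
  qed
  moreover have "Ck_on 0 D (\<lambda>u. fder (axis l 1) \<phi> u)" for l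
    by (rule Ck_on_subset[OF Ck_on_SucD_frechet[OF \<phi>(1)]]) simp
  ultimately have "Ck_on 0 D dN"
    unfolding dN_def[abs_def] by (intro Ck_on_sum[OF open_D] Ck_on_scaleR[OF open_D])
  then show ?thesis by simp
qed

text \<open>Outside the box \<open>dN\<close> vanishes, and on the compact box \<open>norm (N u)\<close> is bounded below by a positive number
and \<open>norm (dN u)\<close> is bounded above.\<close>

lemma admissible_near_0: "\<exists>e>0. \<forall>s. \<bar>s\<bar> < e \<longrightarrow> admissible s"
proof (cases "cbox a b = {}")
  case True
  then have "dN u = 0" for u using dN_off_box by simp
  then show ?thesis using N_nz by (intro exI[of _ 1]) (simp add: admissible_def)
next
  case False
  have "continuous_on (cbox a b) (\<lambda>u. norm (N u))"
    using continuous_on_subset[OF Ck_on_imp_continuous_on[OF Ck_N[of 0]] box_D] by (rule continuous_on_norm)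
  then obtain u0 where u0: "u0 \<in> cbox a b" "\<And>u. u \<in> cbox a b \<Longrightarrow> norm (N u0) \<le> norm (N u)"
    using continuous_attains_inf[OF compact_cbox False] by blast
  have m: "norm (N u0) > 0" using N_nz u0(1) box_D by auto
  have "continuous_on (cbox a b) (\<lambda>u. norm (dN u))"
    using continuous_on_subset[OF continuous_dN box_D] by (rule continuous_on_norm)
  then obtain u1 where u1: "\<And>u. u \<in> cbox a b \<Longrightarrow> norm (dN u) \<le> norm (dN u1)"
    using continuous_attains_sup[OF compact_cbox False] by blast
  let ?e = "norm (N u0) / (norm (dN u1) + 1)"
  have pos: "norm (dN u1) + 1 > 0" by (smt (verit) norm_ge_zero)
  have "admissible s" if s: "\<bar>s\<bar> < ?e" for s
    unfolding admissible_def
  proof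
    fix u assume u: "u \<in> D"
    show "N u + s *\<^sub>R dN u \<noteq> 0"
    proof (cases "u \<in> cbox a b")
      case True
      have "norm (s *\<^sub>R dN u) \<le> \<bar>s\<bar> * (norm (dN u1) + 1)"
        using u1[OF True] by (simp add: mult_left_mono)
      also have "\<dots> < norm (N u0)" using s pos by (simp add: pos_less_divide_eq)
      also have "\<dots> \<le> norm (N u)" by (rule u0(2)[OF True])
      finally have lt: "norm (s *\<^sub>R dN u) < norm (N u)" .
      show ?thesis
      proof
        assume "N u + s *\<^sub>R dN u = 0"
        then have "N u = - (s *\<^sub>R dN u)" by (simp add: eq_neg_iff_add_eq_0)
        then have "norm (N u) = norm (s *\<^sub>R dN u)" by (simp only: norm_minus_cancel)
        then show False using lt by simp
      qed
    next
      case False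
      then show ?thesis using N_nz[OF u] dN_off_box by simp
    qed
  qed
  then show ?thesis using m pos by (intro exI[of _ ?e]) auto
qed

lemma Z_immersion_U:
  assumes "admissible s"
  shows "smooth_immersion_on A U (Z s)"
proof (rule smooth_immersion_onI[OF U(1) Z_smooth[OF smooth_U openin_subset[OF U(1)]]])
  fix p assume p: "p \<in> U"
  then have "snd c p \<in> D" by (simp add: D_def)
  then have "chart_normal c (Z s) (snd c p) \<noteq> 0"
    using assms by (simp add: chart_normal_Z admissible_def)
  then show "\<exists>c\<in>A. p \<in> fst c \<and> chart_normal c (Z s) (snd c p) \<noteq> 0"
    using c p U_subset by blast
qed

text \<open>On \<open>U\<close> both maps are immersions, and near the remaining points they coincide.\<close>

lemma regular_set_Z:
  assumes "admissible s"
  shows "regular_set T A (Z s) = regular_set T A X"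
proof (intro subset_antisym subsetI)
  fix p assume p: "p \<in> regular_set T A (Z s)"
  then have "p \<in> U \<or> p \<in> outside" using U_or_outside by (simp add: regular_set_def)
  then show "p \<in> regular_set T A X"
  proof
    assume "p \<in> U"
    then show ?thesis using interior_subset_regular_set[OF X i] U(2) by blast
  next
    assume "p \<in> outside"
    then show ?thesis by (intro regular_set_transfer[OF openin_outside Z_outside _ p])
  qed
next
  fix p assume p: "p \<in> regular_set T A X"
  then have "p \<in> U \<or> p \<in> outside" using U_or_outside by (simp add: regular_set_def)
  then show "p \<in> regular_set T A (Z s)"
  proof
    assume "p \<in> U"
    then show ?thesis using Z_immersion_U[OF assms] U(1) unfolding mem_regular_set_iff by blast
  next
    assume "p \<in> outside"
    then show ?thesis by (intro regular_set_transfer[OF openin_outside Z_outside[symmetric] _ p])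
  qed
qed

end

lemma set_integral_change_on_subset:
  fixes f g :: "'e::euclidean_space \<Rightarrow> real"
  assumes f: "set_integrable lborel S f" and g: "set_integrable lborel S g"
    and S: "S \<in> sets borel" and B: "compact B" "B \<subseteq> S"
    and eq: "\<And>u. u \<in> S - B \<Longrightarrow> f u = g u"
  shows "set_lebesgue_integral lborel S f = set_lebesgue_integral lborel S g + (integral B f - integral B g)"
proof -
  have Bb: "B \<in> sets lborel" using borel_compact[OF B(1)] by simp
  have SB: "S - B \<in> sets lborel" using S Bb by simp
  have split: "set_lebesgue_integral lborel S h = set_lebesgue_integral lborel (S - B) h + integral B h"
    if h: "set_integrable lborel S h" for h :: "'e \<Rightarrow> real"
  proof -
    have hB: "set_integrable lborel B h" by (rule set_integrable_subset[OF h Bb B(2)])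
    have hSB: "set_integrable lborel (S - B) h" by (rule set_integrable_subset[OF h SB]) blast
    have "(S - B) \<union> B = S" using B(2) by blast
    then show ?thesis
      using set_integral_Un[OF _ hSB hB] set_borel_integral_eq_integral(2)[OF hB] by auto
  qed
  have "set_lebesgue_integral lborel (S - B) f = set_lebesgue_integral lborel (S - B) g"
    unfolding set_lebesgue_integral_def
  proof (intro Bochner_Integration.integral_cong refl)
    show "indicat_real (S - B) u *\<^sub>R f u = indicat_real (S - B) u *\<^sub>R g u" for u
    proof (cases "u \<in> S - B")
      case False
      then have "indicat_real (S - B) u = 0" by (simp only: indicator_eq_0_iff not_False_eq_True)
      then show ?thesis by (simp only: scaleR_zero_left)
    qed (simp only: eq)
  qed
  then show ?thesis using split[OF f] split[OF g] by simp
qed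

context bump_perturbation
begin

lemma chart_normal_Z_outside:
  assumes "p \<in> outside" "p \<in> regular_set T A X" "d \<in> A" "p \<in> fst d"
  shows "chart_normal d (Z s) (snd d p) = chart_normal d X (snd d p)"
proof (rule chart_normal_cong)
  show "openin T (outside \<inter> regular_set T A X)"
    by (rule openin_Int[OF openin_outside openin_regular_set])
  have "smooth_on A (regular_set T A X) X" by (rule smooth_on_regular_set)
  then show "smooth_on A (outside \<inter> regular_set T A X) X" by (rule smooth_on_subset) blast
qed (use assms Z_outside in auto)

lemma Z_weak_immersion:
  assumes s: "admissible s"
  shows "piecewise_smooth_weak_immersion T A k M (Z s)"
  unfolding piecewise_smooth_weak_immersion_def
proof (intro conjI ballI)
  have "continuous_map T euclidean X" using X by (simp add: piecewise_smooth_weak_immersion_def)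
  moreover have "smooth_on A (topspace T) (\<lambda>p. bump p *\<^sub>R (s *\<^sub>R w))"
    by (rule smooth_on_scaleR[OF bump_smooth[OF subset_refl] smooth_on_const])
  then have "continuous_map T euclidean (\<lambda>p. bump p *\<^sub>R (s *\<^sub>R w))" by (rule smooth_on_imp_continuous_map)
  ultimately have "continuous_map T euclidean (\<lambda>p. X p + bump p *\<^sub>R (s *\<^sub>R w))" by (rule continuous_map_add)
  then show "continuous_map T euclidean (Z s)" by (simp add: Z_def[abs_def] mult.commute)
next
  fix i' assume i': "i' \<in> {1..k}"
  let ?I = "T interior_of M i'"
  from X i' have sm: "smooth_on A (M i') X"
    and "\<exists>N. smooth_on A (M i') N \<and> (\<forall>p\<in>M i'. norm (N p) = 1) \<and> (\<forall>p\<in>?I. is_unit_normal A X p (N p))"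
    by (simp_all add: piecewise_smooth_weak_immersion_def)
  then obtain n where n: "smooth_on A (M i') n" "\<forall>p\<in>M i'. norm (n p) = 1"
    "\<forall>p\<in>?I. is_unit_normal A X p (n p)" by blast
  have Msub: "M i' \<subseteq> topspace T" using closedin_subset[OF closedin_piece[OF i']] .
  show "smooth_on A (M i') (Z s)" by (rule Z_smooth[OF sm Msub])
  have "?I \<subseteq> regular_set T A (Z s)"
    unfolding regular_set_Z[OF s] by (rule interior_subset_regular_set[OF X i'])
  then show imm: "smooth_immersion_on A ?I (Z s)"
    by (rule smooth_immersion_on_subset[OF smooth_immersion_on_regular_set])
  \<comment> \<open>the normal field is changed on the interior only; it is the old one away from the bump\<close>
  define n' where "n' p = (if p \<in> ?I then unit_normal A (Z s) p else n p)" for p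
  have n'_outside: "n' p = n p" if p: "p \<in> outside" for p
  proof (cases "p \<in> ?I")
    case True
    have pR: "p \<in> regular_set T A X" using interior_subset_regular_set[OF X i'] True by blast
    then have pZ: "p \<in> regular_set T A (Z s)" by (simp add: regular_set_Z[OF s])
    have "p \<in> topspace T" using pR by (simp add: regular_set_def)
    then obtain d where d: "d \<in> A" "p \<in> fst d" using charts_cover by blast
    have smX: "smooth_on A (regular_set T A Y) Y" for Y
      by (rule smooth_on_regular_set)
    have nz: "chart_normal d X (snd d p) \<noteq> 0"
      by (rule immersion_chart_normal_nz[OF smooth_immersion_on_regular_set pR d])
    note eq = chart_normal_Z_outside[OF p pR d, of s]
    have nzZ: "chart_normal d (Z s) (snd d p) \<noteq> 0" using nz by (simp add: eq)
    have "is_unit_normal A X p (n p)" using n(3) True by blast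
    then have "n p = chart_normal d X (snd d p) /\<^sub>R norm (chart_normal d X (snd d p))"
      by (simp only: is_unit_normal_iff[OF openin_regular_set smX pR d nz])
    also have "\<dots> = unit_normal A (Z s) p"
      by (simp only: unit_normal_eq[OF openin_regular_set smX pZ d nzZ] eq)
    finally show ?thesis using True by (simp add: n'_def)
  qed (simp add: n'_def)
  show "\<exists>N. smooth_on A (M i') N \<and> (\<forall>p\<in>M i'. norm (N p) = 1) \<and>
      (\<forall>p\<in>?I. is_unit_normal A (Z s) p (N p))"
  proof (intro exI[of _ n'] conjI ballI)
    show unit: "is_unit_normal A (Z s) p (n' p)" if "p \<in> ?I" for p
      using smooth_on_unit_normal(2)[OF openin_interior_of imm that] that by (simp add: n'_def)
    show "norm (n' p) = 1" if "p \<in> M i'" for p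
    proof (cases "p \<in> ?I")
      case True
      then show ?thesis using unit by (simp add: is_unit_normal_def)
    next
      case False
      then show ?thesis using n(2) \<open>p \<in> M i'\<close> by (simp add: n'_def)
    qed
    show "smooth_on A (M i') n'"
    proof (rule smooth_on_locally[OF Msub])
      fix p assume p: "p \<in> M i'"
      consider "p \<in> U" | "p \<in> outside" using U_or_outside p Msub by blast
      then show "\<exists>W. openin T W \<and> p \<in> W \<and> smooth_on A (M i' \<inter> W) n'"
      proof cases
        case 1
        have "i' = i" using interior_disjoint_piece[OF i i'] 1 p U(2) by blast
        then have I: "p \<in> ?I" using 1 U(2) by blast
        have "smooth_on A ?I (unit_normal A (Z s))"
          by (rule smooth_on_unit_normal(1)[OF openin_interior_of imm])
        then have "smooth_on A ?I n'" by (rule smooth_on_cong) (simp add: n'_def)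
        then have "smooth_on A (M i' \<inter> ?I) n'" by (rule smooth_on_subset) blast
        then show ?thesis using I by (intro exI[of _ ?I]) simp
      next
        case 2
        have "smooth_on A (M i' \<inter> outside) n" by (rule smooth_on_subset[OF n(1)]) blast
        then have "smooth_on A (M i' \<inter> outside) n'" by (rule smooth_on_cong) (simp add: n'_outside)
        then show ?thesis using 2 openin_outside by blast
      qed
    qed
  qed
qed

lemma box_cell: "cbox a b \<subseteq> cell_coords T A X j"
proof -
  have "U \<subseteq> cell T A j \<inter> regular_set T A X"
    using U(2,3) interior_subset_regular_set[OF X i] by blast
  then have "snd c ` U \<subseteq> cell_coords T A X j" unfolding cell_coords_def by (rule image_mono)
  then show ?thesis using box by blast
qed

text \<open>The integrands for \<open>Z s\<close> and \<open>X\<close> differ only over the box, which belongs to the cell \<open>j\<close>. Integrability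
over this cell allows the integral over the box to be split off.\<close>

lemma cell_sum_Z:
  fixes H :: "real ^ 'n option \<Rightarrow> real ^ 'n option \<Rightarrow> real"
  defines "h \<equiv> \<lambda>Y j u. H (Y (chart_inv (cell_chart T A j) u)) (chart_normal (cell_chart T A j) Y u)"
  assumes s: "admissible s"
    and int: "\<And>Y. piecewise_smooth_weak_immersion T A k M Y \<Longrightarrow> set_integrable lborel (cell_coords T A Y j) (h Y j)"
  shows "(\<Sum>j<length (cover T A). set_lebesgue_integral lborel (cell_coords T A (Z s) j) (h (Z s) j))
    = (\<Sum>j<length (cover T A). set_lebesgue_integral lborel (cell_coords T A X j) (h X j))
      + (integral (cbox a b) (\<lambda>u. H (X (chart_inv c u) + (s * \<phi> u) *\<^sub>R w) (N u + s *\<^sub>R dN u))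
         - integral (cbox a b) (\<lambda>u. H (X (chart_inv c u)) (N u)))"
proof -
  have coords: "cell_coords T A (Z s) j' = cell_coords T A X j'" for j'
    by (simp add: cell_coords_def regular_set_Z[OF s])
  have outside_eq: "h (Z s) j' (snd (cell_chart T A j') p) = h X j' (snd (cell_chart T A j') p)"
    if "j' < length (cover T A)" "p \<in> cell T A j'" "p \<in> regular_set T A X" "p \<in> outside" for j' p
  proof -
    have d: "cell_chart T A j' \<in> A" "p \<in> fst (cell_chart T A j')"
      using cell_chart cell_subset that by blast+
    show ?thesis
      unfolding h_def chart_inv_left[OF chart[OF d(1)] d(2)] chart_normal_Z_outside[OF that(4,3) d]
        Z_outside[OF that(4)] ..
  qed
  have other: "set_lebesgue_integral lborel (cell_coords T A X j') (h (Z s) j')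
      = set_lebesgue_integral lborel (cell_coords T A X j') (h X j')"
    if j': "j' < length (cover T A)" "j' \<noteq> j" for j'
    unfolding set_lebesgue_integral_def
  proof (intro Bochner_Integration.integral_cong refl)
    fix u
    have "h (Z s) j' u = h X j' u" if u: "u \<in> cell_coords T A X j'"
    proof -
      obtain p where p: "p \<in> cell T A j'" "p \<in> regular_set T A X" "u = snd (cell_chart T A j') p"
        using u unfolding cell_coords_def by blast
      have "cell T A j' \<inter> cell T A j = {}"
        using j'(2) unfolding cell_def by (cases "j' < j") auto
      then have "p \<notin> U" using p(1) U(3) by blast
      then have "p \<in> outside" using U_or_outside p(2) by (auto simp: regular_set_def)
      then show ?thesis using outside_eq[OF j'(1) p(1,2)] p(3) by simp
    qed
    then show "indicat_real (cell_coords T A X j') u *\<^sub>R h (Z s) j' u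
        = indicat_real (cell_coords T A X j') u *\<^sub>R h X j' u"
      by (simp add: indicator_def)
  qed
  have "set_integrable lborel (cell_coords T A X j) (h (Z s) j)"
    using int[OF Z_weak_immersion[OF s]] by (simp only: coords)
  then have main: "set_lebesgue_integral lborel (cell_coords T A X j) (h (Z s) j)
      = set_lebesgue_integral lborel (cell_coords T A X j) (h X j)
        + (integral (cbox a b) (h (Z s) j) - integral (cbox a b) (h X j))"
  proof (rule set_integral_change_on_subset[OF _ int[OF X] cell_coords_borel(1)[OF j] compact_cbox box_cell])
    fix u assume u: "u \<in> cell_coords T A X j - cbox a b"
    then obtain p where p: "p \<in> cell T A j" "p \<in> regular_set T A X" "u = snd c p"
      unfolding cell_coords_def by blast
    have "p \<notin> chart_inv c ` cbox a b"
    proof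
      assume "p \<in> chart_inv c ` cbox a b"
      then obtain v where v: "v \<in> cbox a b" "p = chart_inv c v" by blast
      then have "snd c p = v" using chart_inv_right[of v c] box U_subset by blast
      then show False using u p(3) v(1) by simp
    qed
    then have "p \<in> outside" using p(2) by (simp add: outside_def regular_set_def)
    then show "h (Z s) j u = h X j u" using outside_eq[OF j p(1,2)] p(3) by simp
  qed
  have "integral (cbox a b) (h (Z s) j) = integral (cbox a b) (\<lambda>u. H (X (chart_inv c u) + (s * \<phi> u) *\<^sub>R w) (N u + s *\<^sub>R dN u))"
  proof (rule Henstock_Kurzweil_Integration.integral_cong)
    fix u assume "u \<in> cbox a b"
    then have "u \<in> D" using box_D by blast
    then show "h (Z s) j u = H (X (chart_inv c u) + (s * \<phi> u) *\<^sub>R w) (N u + s *\<^sub>R dN u)"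
      by (simp only: h_def chart_normal_Z Z_in_chart)
  qed
  then have main': "set_lebesgue_integral lborel (cell_coords T A X j) (h (Z s) j)
      = set_lebesgue_integral lborel (cell_coords T A X j) (h X j)
        + (integral (cbox a b) (\<lambda>u. H (X (chart_inv c u) + (s * \<phi> u) *\<^sub>R w) (N u + s *\<^sub>R dN u))
           - integral (cbox a b) (\<lambda>u. H (X (chart_inv c u)) (N u)))"
    using main by (simp add: h_def)
  have "(\<Sum>j'\<in>{..<length (cover T A)} - {j}. set_lebesgue_integral lborel (cell_coords T A X j') (h (Z s) j'))
     = (\<Sum>j'\<in>{..<length (cover T A)} - {j}. set_lebesgue_integral lborel (cell_coords T A X j') (h X j'))"
    by (rule sum.cong) (use other in auto)
  then show ?thesis
    unfolding coords using j main' by (simp add: sum.remove[of _ j])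
qed

lemma energy_Z:
  assumes "Cr_on 2 (sphere 0 1) \<gamma>" "admissible s"
  shows "anisotropic_energy T A \<gamma> (Z s) = anisotropic_energy T A \<gamma> X
    + (integral (cbox a b) (\<lambda>u. hom_ext \<gamma> (N u + s *\<^sub>R dN u)) - integral (cbox a b) (\<lambda>u. hom_ext \<gamma> (N u)))"
  unfolding anisotropic_energy_eq
  by (rule cell_sum_Z[OF assms(2), where H = "\<lambda>x. hom_ext \<gamma>"])
    (rule set_integrable_energy[OF assms(1) _ j])

lemma integral_inner_dN:
  assumes \<eta>: "Ck_on 1 D \<eta>"
    and L: "\<And>u. u \<in> cbox a b \<Longrightarrow> \<exists>L. (\<forall>l. fder (axis l 1) \<eta> u = (\<Sum>m\<in>UNIV. L $ m $ l *\<^sub>R V u m)) \<and> trace L = \<tau>"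
  shows "integral (cbox a b) (\<lambda>u. \<eta> u \<bullet> dN u) = \<tau> * integral (cbox a b) (\<lambda>u. \<phi> u * (w \<bullet> N u))"
proof -
  have V: "V u = (\<lambda>l. fder (axis l 1) (X \<circ> chart_inv c) u)" for u by (simp only: V_def[abs_def])
  have "((\<lambda>u. (\<Sum>l\<in>UNIV. fder (axis l 1) \<phi> u * row_det (frame (\<eta> u)
        ((\<lambda>l. fder (axis l 1) (X \<circ> chart_inv c) u)(l := w))))
      - \<tau> * (\<phi> u * row_det (frame w (\<lambda>l. fder (axis l 1) (X \<circ> chart_inv c) u)))) has_integral 0) (cbox a b)"
    by (rule has_integral_row_det_by_parts[OF \<phi>(1) _ Ck_X \<eta> open_D box_D])
      (erule \<phi>(2), erule L[unfolded V_def])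
  then have "((\<lambda>u. \<eta> u \<bullet> dN u - \<tau> * (\<phi> u * (w \<bullet> N u))) has_integral 0) (cbox a b)"
    by (simp only: inner_dN N_eq V row_det_frame)
  then have 0: "integral (cbox a b) (\<lambda>u. \<eta> u \<bullet> dN u - \<tau> * (\<phi> u * (w \<bullet> N u))) = 0"
    by (rule integral_unique)
  have c1: "continuous_on (cbox a b) \<eta>" "continuous_on (cbox a b) dN" "continuous_on (cbox a b) N"
    "continuous_on (cbox a b) \<phi>"
    using Ck_on_imp_continuous_on[OF \<eta>] continuous_dN Ck_on_imp_continuous_on[OF Ck_N[of 0]] box_D
      Ck_on_imp_continuous_on[OF \<phi>(1)[of 0]] continuous_on_subset by blast+
  have "(\<lambda>u. \<eta> u \<bullet> dN u) integrable_on cbox a b" "(\<lambda>u. \<tau> * (\<phi> u * (w \<bullet> N u))) integrable_on cbox a b"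
    by (intro integrable_continuous continuous_intros c1)+
  then show ?thesis using 0 by (simp add: integral_diff)
qed

text \<open>The rate at which the enclosed volume of \<open>Z s\<close> changes, cf. \<open>volume_Z\<close>.\<close>

definition \<beta> :: real where "\<beta> = integral (cbox a b) (\<lambda>u. \<phi> u * (w \<bullet> N u))"

text \<open>The term of second order in \<open>s\<close> is zero because \<open>w \<bullet> dN u = 0\<close>. In the term of first order, the
integral of \<open>X \<bullet> dN\<close> is \<open>n \<beta>\<close> by parts, which together with the direct contribution \<open>\<beta>\<close> cancels the
factor \<open>1 / (n + 1)\<close> in the enclosed volume.\<close>

lemma volume_Z:
  assumes s: "admissible s"
  shows "enclosed_volume T A (Z s) = enclosed_volume T A X + s * \<beta>"
proof -
  have c1: "continuous_on (cbox a b) (\<lambda>u. X (chart_inv c u))" "continuous_on (cbox a b) dN"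
    "continuous_on (cbox a b) N" "continuous_on (cbox a b) \<phi>"
    using Ck_on_imp_continuous_on[OF Ck_X[of 0]] continuous_dN Ck_on_imp_continuous_on[OF Ck_N[of 0]] box_D
      Ck_on_imp_continuous_on[OF \<phi>(1)[of 0]] continuous_on_subset unfolding comp_def by blast+
  have "(X (chart_inv c u) + (s * \<phi> u) *\<^sub>R w) \<bullet> (N u + s *\<^sub>R dN u)
     = X (chart_inv c u) \<bullet> N u + (s * (\<phi> u * (w \<bullet> N u)) + s * (X (chart_inv c u) \<bullet> dN u))" for u
    by (simp add: inner_add_left inner_add_right w_inner_dN algebra_simps)
  then have "integral (cbox a b) (\<lambda>u. (X (chart_inv c u) + (s * \<phi> u) *\<^sub>R w) \<bullet> (N u + s *\<^sub>R dN u))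
     = integral (cbox a b) (\<lambda>u. X (chart_inv c u) \<bullet> N u + (s * (\<phi> u * (w \<bullet> N u)) + s * (X (chart_inv c u) \<bullet> dN u)))"
    by simp
  also have "\<dots> = integral (cbox a b) (\<lambda>u. X (chart_inv c u) \<bullet> N u)
      + (s * integral (cbox a b) (\<lambda>u. \<phi> u * (w \<bullet> N u)) + s * integral (cbox a b) (\<lambda>u. X (chart_inv c u) \<bullet> dN u))"
    by (subst Henstock_Kurzweil_Integration.integral_add;
        (intro integrable_add integrable_continuous continuous_intros c1)?)+ simp
  also have "integral (cbox a b) (\<lambda>u. X (chart_inv c u) \<bullet> dN u) = real CARD('n) * \<beta>"
  proof -
    have "\<exists>L. (\<forall>l. fder (axis l 1) (X \<circ> chart_inv c) u = (\<Sum>m\<in>UNIV. L $ m $ l *\<^sub>R V u m)) \<and> trace L = real CARD('n)" for u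
    proof (intro exI[of _ "mat 1"] conjI allI)
      show "fder (axis l 1) (X \<circ> chart_inv c) u = (\<Sum>m\<in>UNIV. (mat 1 :: real^'n^'n) $ m $ l *\<^sub>R V u m)" for l
        by (simp add: mat_def V_def if_distrib[of "\<lambda>x. x *\<^sub>R _"] cong: if_cong)
      show "trace (mat 1 :: real^'n^'n) = real CARD('n)" by (rule trace_I)
    qed
    from integral_inner_dN[OF Ck_X this] show ?thesis by (simp add: \<beta>_def)
  qed
  finally have *: "integral (cbox a b) (\<lambda>u. (X (chart_inv c u) + (s * \<phi> u) *\<^sub>R w) \<bullet> (N u + s *\<^sub>R dN u))
      - integral (cbox a b) (\<lambda>u. X (chart_inv c u) \<bullet> N u) = (real CARD('n) + 1) * (s * \<beta>)"
    by (simp add: \<beta>_def algebra_simps)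
  let ?I = "\<lambda>Y. \<Sum>j<length (cover T A). set_lebesgue_integral lborel (cell_coords T A Y j)
       (\<lambda>u. Y (chart_inv (cell_chart T A j) u) \<bullet> chart_normal (cell_chart T A j) Y u)"
  have sum_eq: "?I (Z s) = ?I X
      + (integral (cbox a b) (\<lambda>u. (X (chart_inv c u) + (s * \<phi> u) *\<^sub>R w) \<bullet> (N u + s *\<^sub>R dN u))
         - integral (cbox a b) (\<lambda>u. X (chart_inv c u) \<bullet> N u))"
    by (rule cell_sum_Z[OF s, where H = "(\<bullet>)"]) (rule set_integrable_volume[OF _ j])
  have "real CARD('n) + 1 \<noteq> 0" by (smt (verit) of_nat_0_le_iff)
  then show ?thesis
    unfolding enclosed_volume_eq sum_eq * by (simp add: add_divide_distrib)
qed

text \<open>This is the first variation formula: differentiation under the integral sign gives the integral of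
\<open>hom_grad \<gamma> (N u) \<bullet> dN u\<close>, which by parts becomes the integral of the trace \<open>- n \<Lambda>\<close> times \<open>\<phi> (w \<bullet> N)\<close>.\<close>

lemma energy_Z_has_derivative:
  assumes \<gamma>: "Cr_on 2 (sphere 0 1) \<gamma>"
    and \<Lambda>: "\<And>p. p \<in> regular_set T A X \<Longrightarrow> anisotropic_mean_curvature A \<gamma> X p = 0"
  shows "((\<lambda>s. anisotropic_energy T A \<gamma> (Z s)) has_real_derivative 0) (at 0)"
proof -
  obtain e where e: "e > 0" "\<And>s. \<bar>s\<bar> < e \<Longrightarrow> admissible s" using admissible_near_0 by blast
  define r where "r = e / 2"
  have r: "r > 0" "\<And>s. s \<in> {-r..r} \<Longrightarrow> admissible s" using e by (auto simp: r_def)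
  let ?g = "\<lambda>s u. hom_ext \<gamma> (N u + s *\<^sub>R dN u)"
  let ?g' = "\<lambda>s u. hom_grad \<gamma> (N u + s *\<^sub>R dN u) \<bullet> dN u"
  have nz: "N u + s *\<^sub>R dN u \<noteq> 0" if "s \<in> {-r..r}" "u \<in> cbox a b" for s u
    using r(2)[OF that(1)] that(2) box_D by (auto simp: admissible_def)
  have c1: "continuous_on (cbox a b) dN" "continuous_on (cbox a b) N"
    using continuous_dN Ck_on_imp_continuous_on[OF Ck_N[of 0]] box_D continuous_on_subset by blast+
  note G = Ck_on_imp_continuous_on[OF Ck_on_hom_ext[OF \<gamma>]] Ck_on_imp_continuous_on[OF Ck_on_hom_grad[OF \<gamma>]]
  have "((\<lambda>s. integral (cbox a b) (?g s)) has_real_derivative integral (cbox a b) (?g' 0)) (at 0 within {-r..r})"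
  proof (rule leibniz_rule_field_derivative)
    show "((\<lambda>s. ?g s u) has_real_derivative ?g' s u) (at s within {-r..r})"
      if "s \<in> {-r..r}" "u \<in> cbox a b" for s u
      by (rule has_field_derivative_at_within, rule has_real_derivative_along_line)
        (rule hom_ext_has_derivative[OF \<gamma> nz[OF that]])
    show "?g s integrable_on cbox a b" if "s \<in> {-r..r}" for s
      by (intro integrable_continuous continuous_on_compose2[OF G(1)] continuous_intros c1)
        (use nz[OF that] in auto)
    have c2: "continuous_on ({-r..r} \<times> cbox a b) (\<lambda>x. N (snd x))" "continuous_on ({-r..r} \<times> cbox a b) (\<lambda>x. dN (snd x))"
      by (rule continuous_on_compose2[OF c1(2)] continuous_on_compose2[OF c1(1)]; auto intro!: continuous_intros)+
    have "continuous_on ({-r..r} \<times> cbox a b) (\<lambda>x. ?g' (fst x) (snd x))"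
      by (intro continuous_intros c2 continuous_on_compose2[OF G(2)]) (use nz in auto)
    then show "continuous_on ({-r..r} \<times> cbox a b) (\<lambda>(s, u). ?g' s u)"
      by (simp add: case_prod_unfold)
  qed (use r in auto)
  then have der: "((\<lambda>s. integral (cbox a b) (?g s)) has_real_derivative integral (cbox a b) (?g' 0)) (at 0)"
    using r(1) by (subst (asm) at_within_interior) auto
  have "integral (cbox a b) (\<lambda>u. hom_grad \<gamma> (N u) \<bullet> dN u) = 0 * integral (cbox a b) (\<lambda>u. \<phi> u * (w \<bullet> N u))"
  proof (rule integral_inner_dN)
    show "Ck_on 1 D (\<lambda>u. hom_grad \<gamma> (N u))"
      by (rule Ck_on_compose[OF open_D open_nonzero _ Ck_N Ck_on_hom_grad[OF \<gamma>]]) (use N_nz in auto)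
    fix u assume "u \<in> cbox a b"
    then obtain p where p: "p \<in> U" "u = snd c p" using box by blast
    have pR: "p \<in> regular_set T A X" using p(1) U(2) interior_subset_regular_set[OF X i] by blast
    have pc: "p \<in> fst c" using p(1) U_subset by blast
    show "\<exists>L. (\<forall>l. fder (axis l 1) (\<lambda>u. hom_grad \<gamma> (N u)) u = (\<Sum>m\<in>UNIV. L $ m $ l *\<^sub>R V u m)) \<and> trace L = 0"
      using anisotropic_mean_curvature_eq_trace[OF \<gamma> pR c pc] \<Lambda>[OF pR] p(2) by (simp add: V_def)
  qed
  then have "((\<lambda>s. integral (cbox a b) (?g s)) has_real_derivative 0) (at 0)"
    using der by simp
  then have "((\<lambda>s. anisotropic_energy T A \<gamma> X + (integral (cbox a b) (?g s) - integral (cbox a b) (\<lambda>u. hom_ext \<gamma> (N u))))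
      has_real_derivative 0) (at 0)"
    by (auto intro!: derivative_eq_intros)
  then show ?thesis
    by (rule has_field_derivative_transform_within_open[of _ _ _ "{-r<..<r}"])
      (use r energy_Z[OF \<gamma>] in auto)
qed

lemma variation_scaled_Z:
  assumes \<sigma>: "Cr_on \<infinity> {-e<..<e} \<sigma>" "\<sigma> 0 = 0" "\<And>t. t \<in> {-e<..<e} \<Longrightarrow> admissible (\<sigma> t)"
    and e: "0 < e" "e \<le> 1"
  shows "variation T A k M X (\<lambda>t p. (1 + t) *\<^sub>R Z (\<sigma> t) p)"
  unfolding variation_def
proof (intro conjI ballI exI[of _ e] e(1))
  show "(1 + 0) *\<^sub>R Z (\<sigma> 0) p = X p" for p by (simp add: Z_def \<sigma>(2))
  show "piecewise_smooth_weak_immersion T A k M (\<lambda>p. (1 + t) *\<^sub>R Z (\<sigma> t) p)" if "t \<in> {-e<..<e}" for t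
    by (rule weak_immersion_scaleR[OF Z_weak_immersion[OF \<sigma>(3)[OF that]]]) (use that e in auto)
  fix i' d assume i': "i' \<in> {1..k}" and d: "d \<in> A"
  let ?I = "{-e<..<e}" and ?S = "snd d ` (fst d \<inter> M i')"
  have Msub: "M i' \<subseteq> topspace T" using closedin_subset[OF closedin_piece[OF i']] .
  have "smooth_on A (M i') X" using X i' by (simp add: piecewise_smooth_weak_immersion_def)
  then have sX: "Cr_on \<infinity> ?S (X \<circ> chart_inv d)" using d by (simp add: smooth_on_def)
  have sb: "Cr_on \<infinity> ?S (bump \<circ> chart_inv d)" using bump_smooth[OF Msub] d by (simp add: smooth_on_def)
  have sw: "Cr_on \<infinity> ?S (\<lambda>u. (bump \<circ> chart_inv d) u *\<^sub>R w)" by (rule Cr_on_scaleR[OF sb Cr_on_const])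
  have l: "Cr_on \<infinity> ?I (\<lambda>t. 1 + t)"
    by (intro Cr_on_add Cr_on_const Cr_on_bounded_linear bounded_linear_ident)
  have l\<sigma>: "Cr_on \<infinity> ?I (\<lambda>t. (1 + t) * \<sigma> t)" by (rule Cr_on_mult[OF l \<sigma>(1)])
  have "Cr_on \<infinity> (?I \<times> ?S) (\<lambda>x. (\<lambda>(t, u). (1 + t) *\<^sub>R (X \<circ> chart_inv d) u) x
      + (\<lambda>(t, u). ((1 + t) * \<sigma> t) *\<^sub>R ((bump \<circ> chart_inv d) u *\<^sub>R w)) x)"
    by (rule Cr_on_add[OF Cr_on_product_scaleR[OF l sX] Cr_on_product_scaleR[OF l\<sigma> sw]])
  then show "Cr_on \<infinity> (?I \<times> ?S) (\<lambda>(t, u). (1 + t) *\<^sub>R Z (\<sigma> t) (chart_inv d u))"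
    by (rule Cr_on_cong) (auto simp: Z_def algebra_simps)
qed

text \<open>The function \<open>\<sigma>\<close> solves \<open>(1 + t)\<^sup>n\<^sup>+\<^sup>1 (V + \<sigma>(t) \<beta>) = V\<close>, so the variation \<open>(1 + t) Z (\<sigma>(t))\<close> preserves the
volume. Its energy is \<open>(1 + t)\<^sup>n\<close> times that of \<open>Z (\<sigma>(t))\<close>, and the second factor is stationary.\<close>

lemma not_volume_constrained_critical_point:
  assumes \<gamma>: "\<forall>x\<in>sphere 0 1. \<gamma> x > 0" "Cr_on 2 (sphere 0 1) \<gamma>" and \<beta>: "\<beta> \<noteq> 0"
    and \<Lambda>: "\<And>p. p \<in> regular_set T A X \<Longrightarrow> anisotropic_mean_curvature A \<gamma> X p = 0"
  shows "\<not> volume_constrained_critical_point T A k M \<gamma> X"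
proof
  assume crit: "volume_constrained_critical_point T A k M \<gamma> X"
  let ?V = "enclosed_volume T A X" and ?F = "anisotropic_energy T A \<gamma> X"
  define m where "m = Suc CARD('n)"
  define \<sigma> where "\<sigma> t = (?V / \<beta>) * ((1 + t) powr (- real m) + (-1))" for t
  have \<sigma>0: "\<sigma> 0 = 0" by (simp add: \<sigma>_def)
  obtain e0 where e0: "e0 > 0" "\<And>s. \<bar>s\<bar> < e0 \<Longrightarrow> admissible s" using admissible_near_0 by blast
  have "isCont \<sigma> 0" unfolding \<sigma>_def by (intro continuous_intros) auto
  then obtain e1 where e1: "e1 > 0" "\<And>t. \<bar>t\<bar> < e1 \<Longrightarrow> \<bar>\<sigma> t\<bar> < e0"
    using e0(1) \<sigma>0 unfolding continuous_at_eps_delta by (auto simp: dist_real_def)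
  define e where "e = min e1 1"
  have e: "0 < e" "e \<le> 1" using e1(1) by (auto simp: e_def)
  have adm: "admissible (\<sigma> t)" if "t \<in> {-e<..<e}" for t
    using that by (intro e0(2) e1(2)) (auto simp: e_def)
  let ?Y = "\<lambda>t p. (1 + t) *\<^sub>R Z (\<sigma> t) p"
  have "Cr_on \<infinity> {-e<..<e} (\<lambda>t. 1 + t)"
    by (intro Cr_on_add Cr_on_const Cr_on_bounded_linear bounded_linear_ident)
  then have "Cr_on \<infinity> {-e<..<e} (\<lambda>t. (1 + t) powr (- real m))"
    by (rule Cr_on_powr) (use e in auto)
  then have "Cr_on \<infinity> {-e<..<e} \<sigma>"
    unfolding \<sigma>_def by (intro Cr_on_mult Cr_on_add Cr_on_const)
  then have var: "variation T A k M X ?Y" by (intro variation_scaled_Z[of e] \<sigma>0 adm e)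
  have vol: "enclosed_volume T A (?Y t) = ?V" if t: "t \<in> {-e<..<e}" for t
  proof -
    have pos: "1 + t > 0" using t e by auto
    have "enclosed_volume T A (?Y t) = (1 + t) ^ m * (?V + \<sigma> t * \<beta>)"
      unfolding m_def enclosed_volume_scaleR[OF pos] volume_Z[OF adm[OF t]] ..
    also have "?V + \<sigma> t * \<beta> = ?V * (1 + t) powr (- real m)"
      using \<beta> by (simp add: \<sigma>_def field_simps)
    also have "(1 + t) ^ m * (?V * (1 + t) powr (- real m)) = ?V"
      using pos by (simp add: powr_minus powr_realpow field_simps)
    finally show ?thesis .
  qed
  have "\<forall>\<^sub>F t in nhds 0. t \<in> {-e<..<e}"
    using e by (intro eventually_nhds_in_open) auto
  then have "\<forall>\<^sub>F t in nhds 0. enclosed_volume T A (?Y t) = ?V"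
    by (rule eventually_mono) (rule vol)
  with crit var have "((\<lambda>t. anisotropic_energy T A \<gamma> (?Y t)) has_real_derivative 0) (at 0)"
    unfolding volume_constrained_critical_point_def by blast
  moreover have "((\<lambda>t. anisotropic_energy T A \<gamma> (?Y t)) has_real_derivative real CARD('n) * ?F) (at 0)"
  proof (rule has_field_derivative_transform_within_open[of
        "\<lambda>t. (1 + t) ^ CARD('n) * anisotropic_energy T A \<gamma> (Z (\<sigma> t))" _ _ "{-e<..<e}"])
    have "(\<sigma> has_real_derivative (?V / \<beta>) * (- real m)) (at 0)"
      unfolding \<sigma>_def using \<beta> by (auto intro!: derivative_eq_intros)
    moreover have "((\<lambda>s. anisotropic_energy T A \<gamma> (Z s)) has_real_derivative 0) (at (\<sigma> 0))"
      unfolding \<sigma>0 by (rule energy_Z_has_derivative[OF \<gamma>(2) \<Lambda>])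
    ultimately have "((\<lambda>t. anisotropic_energy T A \<gamma> (Z (\<sigma> t))) has_real_derivative 0) (at 0)"
      using DERIV_chain2 by fastforce
    moreover have "((\<lambda>t::real. (1 + t) ^ CARD('n)) has_real_derivative real CARD('n)) (at 0)"
      by (auto intro!: derivative_eq_intros)
    moreover have "Z (\<sigma> 0) = X" by (simp add: \<sigma>0 Z_def[abs_def])
    ultimately show "((\<lambda>t. (1 + t) ^ CARD('n) * anisotropic_energy T A \<gamma> (Z (\<sigma> t)))
        has_real_derivative real CARD('n) * ?F) (at 0)"
      using DERIV_mult[of "\<lambda>t. (1 + t) ^ CARD('n)" "real CARD('n)" 0 UNIV "\<lambda>t. anisotropic_energy T A \<gamma> (Z (\<sigma> t))" 0]
      by simp
    show "(1 + t) ^ CARD('n) * anisotropic_energy T A \<gamma> (Z (\<sigma> t)) = anisotropic_energy T A \<gamma> (?Y t)"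
      if "t \<in> {-e<..<e}" for t
      using that e by (subst anisotropic_energy_scaleR) auto
  qed (use e in auto)
  ultimately have "real CARD('n) * ?F = 0" using DERIV_unique by blast
  then show False using anisotropic_energy_pos[OF X \<gamma>] by simp
qed

end

text \<open>The bump is placed at a point of the set from \<open>open_subset_of_cell\<close>, and \<open>w\<close> is the chart normal at that
point. In a sufficiently small box \<open>w \<bullet> N\<close> is positive, and hence so is \<open>\<beta>\<close>.\<close>

lemma (in decomposed_manifold) no_zero_anisotropic_mean_curvature:
  assumes X: "piecewise_smooth_weak_immersion T A k M X"
    and \<gamma>: "\<forall>x\<in>sphere 0 1. \<gamma> x > 0" "Cr_on 2 (sphere 0 1) \<gamma>"
  shows "\<not> has_constant_anisotropic_mean_curvature T A k M \<gamma> X 0"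
proof
  assume H: "has_constant_anisotropic_mean_curvature T A k M \<gamma> X 0"
  obtain U i j where U: "i \<in> {1..k}" "j < length (cover T A)" "openin T U" "U \<noteq> {}"
    "U \<subseteq> T interior_of M i" "U \<subseteq> cell T A j" by (rule open_subset_of_cell)
  let ?c = "cell_chart T A j"
  let ?N = "chart_normal ?c X"
  note ch = chart[OF cell_chart[OF U(2)]]
  have imm: "smooth_immersion_on A U X"
    using X U(1) by (auto intro: smooth_immersion_on_subset[OF _ U(5)] simp: piecewise_smooth_weak_immersion_def)
  have Uc: "U \<subseteq> fst ?c" using U(6) cell_subset[OF U(2)] by blast
  let ?D = "snd ?c ` (fst ?c \<inter> U)"
  have D: "open ?D" by (rule chart_image_open[OF ch U(3)])
  have "smooth_on A U X" using imm by (simp add: smooth_immersion_on_def)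
  then have contN: "continuous_on ?D ?N"
    using Ck_on_imp_continuous_on[OF Ck_on_chart_normal[OF U(3) _ cell_chart[OF U(2)], of X 0]] by blast
  obtain p where p: "p \<in> U" using U(4) by blast
  define u0 where "u0 = snd ?c p"
  have u0: "u0 \<in> ?D" using p Uc by (auto simp: u0_def)
  define w where "w = ?N u0"
  have w: "w \<noteq> 0"
    unfolding w_def u0_def using immersion_chart_normal_nz[OF imm p cell_chart[OF U(2)]] p Uc by blast
  have "continuous_on ?D (\<lambda>u. w \<bullet> ?N u)" by (intro continuous_intros contN)
  then have "open (?D \<inter> (\<lambda>u. w \<bullet> ?N u) -` {0<..})"
    by (rule continuous_open_preimage[OF _ D open_greaterThan])
  moreover have "u0 \<in> ?D \<inter> (\<lambda>u. w \<bullet> ?N u) -` {0<..}" using u0 w by (simp add: w_def)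
  ultimately obtain a b where ab: "cbox a b \<subseteq> ?D \<inter> (\<lambda>u. w \<bullet> ?N u) -` {0<..}" "u0 \<in> box a b"
    by (rule open_contains_cbox)
  obtain r where r: "r > 0" "ball u0 r \<subseteq> box a b" using ab(2) open_box open_contains_ball by metis
  from ex_smooth_bump[OF r(1), of u0]
  obtain \<phi> :: "real ^ 'n \<Rightarrow> real" where \<phi>': "\<forall>k. Ck_on k UNIV \<phi>" "\<forall>x. \<phi> x \<ge> 0" "\<phi> u0 > 0" "\<forall>x. x \<notin> ball u0 r \<longrightarrow> \<phi> x = 0"
    by (elim exE conjE)
  note \<phi> = \<phi>'[rule_format]
  have \<phi>0: "\<phi> u = 0" if "u \<notin> cbox a b" for u
    using that r(2) box_subset_cbox by (intro \<phi>(4)) blast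
  interpret bump_perturbation T A k M X i j U \<phi> a b w
    by unfold_locales (use X U \<phi> \<phi>0 ab(1) in auto)
  have "\<beta> \<noteq> 0"
  proof
    assume "\<beta> = 0"
    moreover have "continuous_on (cbox a b) (\<lambda>u. \<phi> u * (w \<bullet> ?N u))"
    proof (intro continuous_intros)
      show "continuous_on (cbox a b) \<phi>"
        using Ck_on_imp_continuous_on[OF \<phi>(1)[of 0]] continuous_on_subset by blast
      show "continuous_on (cbox a b) ?N" using contN ab(1) continuous_on_subset by blast
    qed
    moreover have "\<phi> u * (w \<bullet> ?N u) \<ge> 0" if "u \<in> cbox a b" for u
      using that ab(1) \<phi>'(2) by (intro mult_nonneg_nonneg) auto
    ultimately have "\<forall>u\<in>cbox a b. \<phi> u * (w \<bullet> ?N u) = 0"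
      using integral_cbox_eq_0_iff[of a b "\<lambda>u. \<phi> u * (w \<bullet> ?N u)"] ab(2) unfolding \<beta>_def by blast
    moreover have "u0 \<in> cbox a b" using ab(2) box_subset_cbox by blast
    ultimately show False using \<phi>'(3) w by (auto simp: w_def)
  qed
  moreover have "anisotropic_mean_curvature A \<gamma> X p = 0" if "p \<in> regular_set T A X" for p
    using H that unfolding has_constant_anisotropic_mean_curvature_def regular_set_def by blast
  moreover have "volume_constrained_critical_point T A k M \<gamma> X"
    using H unfolding has_constant_anisotropic_mean_curvature_def by blast
  ultimately show False using not_volume_constrained_critical_point[OF \<gamma>] by blast
qed

theorem proposition9p5:
  fixes \<gamma> :: "real ^ 'n::finite option \<Rightarrow> real"
  assumes "\<forall>x\<in>sphere 0 1. \<gamma> x > 0"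
    and "Cr_on 2 (sphere 0 1) \<gamma>"
  shows "(\<nexists>(T :: 'a topology) (A :: ('a, 'n) chart set) k M X.
            closed_weakly_immersed_hypersurface T A k M X \<and>
            critical_point T A k M \<gamma> X) \<and>
         (\<nexists>(T :: 'a topology) (A :: ('a, 'n) chart set) k M X.
            closed_weakly_immersed_hypersurface T A k M X \<and>
            has_constant_anisotropic_mean_curvature T A k M \<gamma> X 0)"
proof -
  have "\<not> critical_point T A k M \<gamma> X \<and> \<not> has_constant_anisotropic_mean_curvature T A k M \<gamma> X 0"
    if H: "closed_weakly_immersed_hypersurface T A k M X"
    for T :: "'a topology" and A :: "('a, 'n) chart set" and k M X
  proof -
    interpret decomposed_manifold T A k M
      by unfold_locales (use H in \<open>simp_all add: closed_weakly_immersed_hypersurface_def\<close>)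
    have "piecewise_smooth_weak_immersion T A k M X"
      using H by (simp add: closed_weakly_immersed_hypersurface_def)
    then show ?thesis using not_critical_point no_zero_anisotropic_mean_curvature assms by blast
  qed
  then show ?thesis by blast
qed

end
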